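(* Let $q\in(0,1)$ and let $n\ge 1$, $m\ge 2$ be integers, $N=n+m$. The representation $T$ of the algebra $\mathscr{D}(\mathscr{H}_{n,m})_q$ of finite functions on the quantum hyperbolic space in the pre-Hilbert space $\mathscr{H}$ is faithful (i.e. $T(f)=0$ with $f\in\mathscr{D}(\mathscr{H}_{n,m})_q$ implies $f=0$).
   Context: Notation: $\mathbb{Z}_+=\{0,1,2,\dots\}$, $\mathbb{N}=\{1,2,\dots\}$; algebras are over $\mathbb{C}$. $\mathrm{Pol}(\widehat{\mathscr{H}}_{n,m})_q$ is the unital $*$-algebra with generators $t_1,\dots,t_N$ and relations $t_it_j=qt_jt_i$ for $i<j$; $t_it_j^*=qt_j^*t_i$ for $i\ne j$; $t_it_i^*=t_i^*t_i+(q^{-2}-1)\sum_{k=i+1}^N t_kt_k^*$ for $i>n$; $t_it_i^*=t_i^*t_i+(q^{-2}-1)\sum_{k=i+1}^n t_kt_k^*-(q^{-2}-1)\sum_{k=n+1}^N t_kt_k^*$ for $i\le n$. The element $c=-\sum_{j=1}^n t_jt_j^*+\sum_{j=n+1}^N t_jt_j^*$ is central. $\mathrm{Pol}(\widetilde{\mathscr{H}}_{n,m})_q$ is the $*$-algebra obtained by adding the relation $c=1$. Put $x_{n+1}=\sum_{k=n+1}^N t_kt_k^*$. The $*$-algebra $\mathrm{Fun}(\widetilde{\mathscr{H}}_{n,m})$ is obtained from $\mathrm{Pol}(\widetilde{\mathscr{H}}_{n,m})_q$ by adding a generator $f_0$ and the relations $t_j^*f_0=f_0t_j=0$ for $j\le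 n$; $x_{n+1}f_0=f_0x_{n+1}=f_0$; $f_0^2=f_0^*=f_0$; $t_jf_0=f_0t_j$, $t_j^*f_0=f_0t_j^*$ for $j\ge n+1$. For $\varphi\in\mathbb{R}/2\pi\mathbb{Z}$ let $I_\varphi$ be its $*$-automorphism with $I_\varphi(t_j)=e^{i\varphi}t_j$, $I_\varphi(f_0)=f_0$, and let $\mathrm{Fun}(\mathscr{H}_{n,m})=\{f: I_\varphi f=f\ \forall\varphi\}$. Finally $\mathscr{D}(\mathscr{H}_{n,m})_q$ is the two-sided ideal of $\mathrm{Fun}(\mathscr{H}_{n,m})$ generated by $f_0$. The pre-Hilbert space $\mathscr{H}$ is the linear span of an orthonormal basis $\{e(i_1,\dots,i_{N-1}) : i_1,\dots,i_n\in-\mathbb{Z}_+,\ i_{n+1},\dots,i_{N-1}\in\mathbb{N}\}$. The $*$-representation $T$ is given by, with $e=e(i_1,\dots,i_{N-1})$ and $S_j=\sum_{k=1}^{j-1}i_k$: for $j\le n$: $T(t_j)e=q^{S_j}(q^{2(i_j-1)}-1)^{1/2}e(\dots,i_j-1,\dots)$, $T(t_j^* )e=q^{S_j}(q^{2i_j}-1)^{1/2}e(\dots,i_j+1,\dots)$; for $n<j<N$: $T(t_j)e=q^{S_j}(1-q^{2(i_j-1)})^{1/2}e(\dots,i_j-1,\dots)$, $T(t_j^* )e=q^{S_j}(1-q^{2i_j})^{1/2}e(\dots,i_j+1,\dots)$; $T(t_N)e=T(t_N^* )e=q^{S_N}e$; $T(f_0)=P$, the orthogonal projection onto the span of the vectors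 $e(0,\dots,0,i_{n+1},\dots,i_{N-1})$, $i_{n+1},\dots,i_{N-1}\in\mathbb{N}$. (A term with zero coefficient is understood as $0$.) *)

theory Defs
  imports Complex_Main "HOL-Library.Poly_Mapping" "HOL-Library.FuncSet"
    "HOL-Algebra.QuotRing" "HOL-Algebra.Subrings"
begin

section \<open>Finitely supported complex functions\<close>

definition scale :: "complex \<Rightarrow> ('k \<Rightarrow>\<^sub>0 complex) \<Rightarrow> ('k \<Rightarrow>\<^sub>0 complex)" where
  "scale c v = Poly_Mapping.map ((*) c) v"

text \<open>The linear extension of a map given on the basis.\<close>

definition lin :: "('k \<Rightarrow> ('l \<Rightarrow>\<^sub>0 complex)) \<Rightarrow> ('k \<Rightarrow>\<^sub>0 complex) \<Rightarrow> ('l \<Rightarrow>\<^sub>0 complex)" where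
  "lin \<phi> v = (\<Sum>k\<in>Poly_Mapping.keys v. scale (Poly_Mapping.lookup v k) (\<phi> k))"


section \<open>Unital $*$-algebras given by generators and relations\<close>

datatype 'x letter = Gen 'x | Adj 'x

fun letter_gen :: "'x letter \<Rightarrow> 'x" where
  "letter_gen (Gen x) = x"
| "letter_gen (Adj x) = x"

fun star_letter :: "'x letter \<Rightarrow> 'x letter" where
  "star_letter (Gen x) = Adj x"
| "star_letter (Adj x) = Gen x"

text \<open>
  The free monoid, written additively so that the convolution product of
  \<^theory>\<open>HOL-Library.Poly_Mapping\<close> makes \<open>'x fword \<Rightarrow>\<^sub>0 complex\<close>
  the free unital complex algebra on the letters.
\<close>

datatype 'x fword = FWord (letters: "'x letter list")

instantiation fword :: (type) monoid_add
begin
definition "0 = FWord []"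
definition "u + v = FWord (letters u @ letters v)"
instance
  by standard (auto simp: zero_fword_def plus_fword_def)
end

type_synonym 'x free_star = "'x fword \<Rightarrow>\<^sub>0 complex"

definition gen :: "'x \<Rightarrow> 'x free_star" where
  "gen x = Poly_Mapping.single (FWord [Gen x]) 1"

definition adj :: "'x \<Rightarrow> 'x free_star" where
  "adj x = Poly_Mapping.single (FWord [Adj x]) 1"

definition star_word :: "'x fword \<Rightarrow> 'x fword" where
  "star_word w = FWord (rev (map star_letter (letters w)))"

definition star :: "'x free_star \<Rightarrow> 'x free_star" where
  "star a = (\<Sum>w\<in>Poly_Mapping.keys a.
      Poly_Mapping.single (star_word w) (cnj (Poly_Mapping.lookup a w)))"

definition words_over :: "'x set \<Rightarrow> 'x fword set" where
  "words_over X = {w. letter_gen ` set (letters w) \<subseteq> X}"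

definition free_star_alg :: "'x set \<Rightarrow> 'x free_star ring" where
  "free_star_alg X =
    \<lparr>carrier = {a. Poly_Mapping.keys a \<subseteq> words_over X},
     mult = (*), one = 1, zero = 0, add = (+)\<rparr>"

text \<open>
  A set \<open>E\<close> of pairs \<open>(l, r)\<close> stands for the relations \<open>l = r\<close>; in a $*$-algebra
  these entail the adjoint relations. An ideal of a unital algebra is closed under scalars, so
  the ring-theoretic ideal below is the $*$-ideal generated by the relations.
\<close>

definition star_ideal :: "'x set \<Rightarrow> ('x free_star \<times> 'x free_star) set \<Rightarrow> 'x free_star set" where
  "star_ideal X E =
    genideal (free_star_alg X) ((\<lambda>(l, r). l - r) ` E \<union> (\<lambda>(l, r). star (l - r)) ` E)"

definition presented ::
    "'x set \<Rightarrow> ('x free_star \<times> 'x free_star) set \<Rightarrow> 'x free_star set ring" where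
  "presented X E = free_star_alg X Quot star_ideal X E"

definition cls ::
    "'x set \<Rightarrow> ('x free_star \<times> 'x free_star) set \<Rightarrow> 'x free_star \<Rightarrow> 'x free_star set" where
  "cls X E a = star_ideal X E +>\<^bsub>free_star_alg X\<^esub> a"


section \<open>The function algebras of the quantum hyperbolic space\<close>

datatype hgen = TG nat | F0

abbreviation tgen :: "nat \<Rightarrow> hgen free_star" where "tgen j \<equiv> gen (TG j)"
abbreviation tadj :: "nat \<Rightarrow> hgen free_star" where "tadj j \<equiv> adj (TG j)"
abbreviation f0gen :: "hgen free_star" where "f0gen \<equiv> gen F0"
abbreviation f0adj :: "hgen free_star" where "f0adj \<equiv> adj F0"

definition rels_hat :: "nat \<Rightarrow> nat \<Rightarrow> real \<Rightarrow> (hgen free_star \<times> hgen free_star) set" where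
  "rels_hat n m q =
     {(tgen i * tgen j, scale q (tgen j * tgen i)) | i j. 1 \<le> i \<and> i < j \<and> j \<le> n + m}
   \<union> {(tgen i * tadj j, scale q (tadj j * tgen i))
       | i j. i \<in> {1..n+m} \<and> j \<in> {1..n+m} \<and> i \<noteq> j}
   \<union> {(tgen i * tadj i, tadj i * tgen i + scale (q powi (-2) - 1) (\<Sum>k=i+1..n+m. tgen k * tadj k))
       | i. n < i \<and> i \<le> n + m}
   \<union> {(tgen i * tadj i, tadj i * tgen i + scale (q powi (-2) - 1) (\<Sum>k=i+1..n. tgen k * tadj k)
                             - scale (q powi (-2) - 1) (\<Sum>k=n+1..n+m. tgen k * tadj k))
       | i. 1 \<le> i \<and> i \<le> n}"

definition c_elem :: "nat \<Rightarrow> nat \<Rightarrow> hgen free_star" where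
  "c_elem n m = - (\<Sum>j=1..n. tgen j * tadj j) + (\<Sum>j=n+1..n+m. tgen j * tadj j)"

definition rels_tilde :: "nat \<Rightarrow> nat \<Rightarrow> real \<Rightarrow> (hgen free_star \<times> hgen free_star) set" where
  "rels_tilde n m q = rels_hat n m q \<union> {(c_elem n m, 1)}"

definition x_elem :: "nat \<Rightarrow> nat \<Rightarrow> hgen free_star" where
  "x_elem n m = (\<Sum>k=n+1..n+m. tgen k * tadj k)"

definition rels_f0 :: "nat \<Rightarrow> nat \<Rightarrow> (hgen free_star \<times> hgen free_star) set" where
  "rels_f0 n m =
     {(tadj j * f0gen, 0) | j. j \<in> {1..n}}
   \<union> {(f0gen * tgen j, 0) | j. j \<in> {1..n}}
   \<union> {(x_elem n m * f0gen, f0gen), (f0gen * x_elem n m, f0gen),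
      (f0gen * f0gen, f0gen), (f0adj, f0gen)}
   \<union> {(tgen j * f0gen, f0gen * tgen j) | j. j \<in> {n+1..n+m}}
   \<union> {(tadj j * f0gen, f0gen * tadj j) | j. j \<in> {n+1..n+m}}"

definition hgens :: "nat \<Rightarrow> nat \<Rightarrow> hgen set" where
  "hgens n m = insert F0 (TG ` {1..n+m})"

definition fun_rels :: "nat \<Rightarrow> nat \<Rightarrow> real \<Rightarrow> (hgen free_star \<times> hgen free_star) set" where
  "fun_rels n m q = rels_tilde n m q \<union> rels_f0 n m"

definition Fun_tilde :: "nat \<Rightarrow> nat \<Rightarrow> real \<Rightarrow> hgen free_star set ring" where
  "Fun_tilde n m q = presented (hgens n m) (fun_rels n m q)"

abbreviation fun_cls :: "nat \<Rightarrow> nat \<Rightarrow> real \<Rightarrow> hgen free_star \<Rightarrow> hgen free_star set" where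
  "fun_cls n m q \<equiv> cls (hgens n m) (fun_rels n m q)"

fun rot_letter :: "real \<Rightarrow> hgen letter \<Rightarrow> complex" where
  "rot_letter \<phi> (Gen (TG j)) = cis \<phi>"
| "rot_letter \<phi> (Adj (TG j)) = cnj (cis \<phi>)"
| "rot_letter \<phi> (Gen F0) = 1"
| "rot_letter \<phi> (Adj F0) = 1"

text \<open>
  The automorphism multiplying the generators \<open>TG j\<close> by \<open>cis \<phi>\<close>, first on the free algebra and
  then, by taking images of cosets, on the quotient.
\<close>

definition rot_free :: "real \<Rightarrow> hgen free_star \<Rightarrow> hgen free_star" where
  "rot_free \<phi> = lin (\<lambda>w. Poly_Mapping.single w (prod_list (map (rot_letter \<phi>) (letters w))))"

definition rot :: "real \<Rightarrow> hgen free_star set \<Rightarrow> hgen free_star set" where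
  "rot \<phi> C = rot_free \<phi> ` C"

definition Fun_H :: "nat \<Rightarrow> nat \<Rightarrow> real \<Rightarrow> hgen free_star set ring" where
  "Fun_H n m q = (Fun_tilde n m q)
     \<lparr>carrier := {f \<in> carrier (Fun_tilde n m q). \<forall>\<phi>. rot \<phi> f = f}\<rparr>"

definition D_H :: "nat \<Rightarrow> nat \<Rightarrow> real \<Rightarrow> hgen free_star set set" where
  "D_H n m q = genideal (Fun_H n m q) {fun_cls n m q f0gen}"


section \<open>The representation\<close>

type_synonym vec = "(nat \<Rightarrow> int) \<Rightarrow>\<^sub>0 complex"

text \<open>A multi-index is an extensional function on \<open>{1..N-1}\<close>.\<close>

definition idx :: "nat \<Rightarrow> nat \<Rightarrow> (nat \<Rightarrow> int) set" where
  "idx n m = (\<Pi>\<^sub>E j\<in>{1..n+m-1}. if j \<le> n then {..0} else {1..})"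

abbreviation ebas :: "(nat \<Rightarrow> int) \<Rightarrow> vec" where "ebas i \<equiv> Poly_Mapping.single i 1"

definition Hspace :: "nat \<Rightarrow> nat \<Rightarrow> vec set" where
  "Hspace n m = {v. Poly_Mapping.keys v \<subseteq> idx n m}"

definition hinner :: "vec \<Rightarrow> vec \<Rightarrow> complex" where
  "hinner u v = (\<Sum>i\<in>Poly_Mapping.keys u. Poly_Mapping.lookup u i * cnj (Poly_Mapping.lookup v i))"

definition Ssum :: "nat \<Rightarrow> (nat \<Rightarrow> int) \<Rightarrow> int" where
  "Ssum j i = (\<Sum>k=1..<j. i k)"

text \<open>
  The letters act on basis vectors; only \<open>TG j\<close> with \<open>1 \<le> j \<le> n + m\<close> occurs in the algebras. At
  the boundary of the index range the square root vanishes, and with it the whole term.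
\<close>

fun act_letter :: "nat \<Rightarrow> nat \<Rightarrow> real \<Rightarrow> hgen letter \<Rightarrow> (nat \<Rightarrow> int) \<Rightarrow> vec" where
  "act_letter n m q (Gen (TG j)) i =
    (if j \<le> n then
       scale (q powi Ssum j i * sqrt (q powi (2 * (i j - 1)) - 1)) (ebas (i(j := i j - 1)))
     else if j < n + m then
       scale (q powi Ssum j i * sqrt (1 - q powi (2 * (i j - 1)))) (ebas (i(j := i j - 1)))
     else scale (q powi Ssum j i) (ebas i))"
| "act_letter n m q (Adj (TG j)) i =
    (if j \<le> n then
       scale (q powi Ssum j i * sqrt (q powi (2 * i j) - 1)) (ebas (i(j := i j + 1)))
     else if j < n + m then
       scale (q powi Ssum j i * sqrt (1 - q powi (2 * i j))) (ebas (i(j := i j + 1)))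
     else scale (q powi Ssum j i) (ebas i))"
| "act_letter n m q (Gen F0) i = (if \<forall>k\<in>{1..n}. i k = 0 then ebas i else 0)"
| "act_letter n m q (Adj F0) i = (if \<forall>k\<in>{1..n}. i k = 0 then ebas i else 0)"

fun act_letters :: "nat \<Rightarrow> nat \<Rightarrow> real \<Rightarrow> hgen letter list \<Rightarrow> vec \<Rightarrow> vec" where
  "act_letters n m q [] v = v"
| "act_letters n m q (x # xs) v = lin (act_letter n m q x) (act_letters n m q xs v)"

definition act :: "nat \<Rightarrow> nat \<Rightarrow> real \<Rightarrow> hgen free_star \<Rightarrow> vec \<Rightarrow> vec" where
  "act n m q a v = lin (\<lambda>w. act_letters n m q (letters w) v) a"

text \<open>
  On a class of \<open>Fun_tilde\<close> the representation is the common value of \<open>act\<close> on all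
  representatives; see \<open>rep_fun_cls\<close> below.
\<close>

definition rep :: "nat \<Rightarrow> nat \<Rightarrow> real \<Rightarrow> hgen free_star set \<Rightarrow> vec \<Rightarrow> vec" where
  "rep n m q C v = the_elem ((\<lambda>a. act n m q a v) ` C)"


section \<open>Well-definedness\<close>

subsection \<open>Linear extension\<close>

lemma lookup_scale [simp]: "Poly_Mapping.lookup (scale c v) k = c * Poly_Mapping.lookup v k"
  by (simp add: scale_def Poly_Mapping.map.rep_eq when_def)

lemma scale_simps [simp]:
  "scale 0 v = 0" "scale 1 v = v" "scale c 0 = 0" "scale c (scale d v) = scale (c * d) v"
  "scale c (Poly_Mapping.single k d) = Poly_Mapping.single k (c * d)"
  by (rule poly_mapping_eqI; simp add: lookup_single when_def)+

lemma scale_add: "scale c (u + v) = scale c u + scale c v"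
  and scale_add_left: "scale (c + d) u = scale c u + scale d u"
  by (rule poly_mapping_eqI; simp add: lookup_add algebra_simps)+

lemma scale_minus: "scale c (- u) = - scale c u"
  by (rule poly_mapping_eqI) simp

lemma scale_sum: "scale c (sum f A) = (\<Sum>x\<in>A. scale c (f x))"
  by (induction A rule: infinite_finite_induct) (auto simp: scale_add)

lemma poly_mapping_induct_on [consumes 1, case_names zero single add]:
  fixes v :: "'k \<Rightarrow>\<^sub>0 'c::comm_monoid_add"
  assumes "Poly_Mapping.keys v \<subseteq> A"
    and "P 0" "\<And>k c. k \<in> A \<Longrightarrow> P (Poly_Mapping.single k c)"
    and "\<And>u v. Poly_Mapping.keys u \<subseteq> A \<Longrightarrow> Poly_Mapping.keys v \<subseteq> A \<Longrightarrow> P u \<Longrightarrow> P v \<Longrightarrow> P (u + v)"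
  shows "P v"
proof -
  have eq: "v = (\<Sum>k\<in>Poly_Mapping.keys v. Poly_Mapping.single k (Poly_Mapping.lookup v k))"
    by (rule poly_mapping_eqI) (auto simp: lookup_sum lookup_single when_def in_keys_iff sum.delta)
  have "finite K \<Longrightarrow> K \<subseteq> A \<Longrightarrow>
      Poly_Mapping.keys (\<Sum>k\<in>K. Poly_Mapping.single k (Poly_Mapping.lookup v k)) \<subseteq> A \<and>
      P (\<Sum>k\<in>K. Poly_Mapping.single k (Poly_Mapping.lookup v k))" for K
  proof (induction K rule: finite_induct)
    case (insert x F)
    then have "Poly_Mapping.keys (Poly_Mapping.single x (Poly_Mapping.lookup v x)) \<subseteq> A" by auto
    with insert show ?case
      using keys_add[of "Poly_Mapping.single x (Poly_Mapping.lookup v x)"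
          "\<Sum>k\<in>F. Poly_Mapping.single k (Poly_Mapping.lookup v k)"]
      by (auto intro!: assms(3,4))
  qed (simp add: assms)
  from this[of "Poly_Mapping.keys v"] show ?thesis using eq assms(1) by simp
qed

lemma scale_mult: "scale c (a * b) = scale c a * b" "scale c (a * b) = a * scale c b"
  for a b :: "'x free_star"
proof -
  have sc: "scale c p = Poly_Mapping.single 0 c * p" for p :: "'x free_star"
    by (simp add: scale_def mult_map_scale_conv_mult)
  have com: "Poly_Mapping.single 0 c * p = p * Poly_Mapping.single 0 c" for p :: "'x free_star"
  proof -
    have "Poly_Mapping.keys p \<subseteq> UNIV" by simp
    then show ?thesis
      by (induction p rule: poly_mapping_induct_on)
        (simp_all add: mult_single distrib_left distrib_right mult.commute)
  qed
  show "scale c (a * b) = scale c a * b"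
    by (simp add: sc mult.assoc)
  show "scale c (a * b) = a * scale c b"
    using com[of a] by (simp add: sc flip: mult.assoc)
qed

lemma lin_superset:
  "finite A \<Longrightarrow> Poly_Mapping.keys v \<subseteq> A \<Longrightarrow> lin \<phi> v = (\<Sum>k\<in>A. scale (Poly_Mapping.lookup v k) (\<phi> k))"
  unfolding lin_def by (rule sum.mono_neutral_left) (auto simp: in_keys_iff)

lemma lin_zero [simp]: "lin \<phi> 0 = 0"
  by (simp add: lin_def)

lemma lin_single [simp]: "lin \<phi> (Poly_Mapping.single k c) = scale c (\<phi> k)"
  by (simp add: lin_def)

lemma lin_add: "lin \<phi> (u + v) = lin \<phi> u + lin \<phi> v"
  using keys_add[of u v]
  by (simp add: lin_superset[of "Poly_Mapping.keys u \<union> Poly_Mapping.keys v"]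
      lookup_add scale_add_left sum.distrib)

lemma lin_scale: "lin \<phi> (scale c v) = scale c (lin \<phi> v)"
proof -
  have "Poly_Mapping.keys (scale c v) \<subseteq> Poly_Mapping.keys v" by (auto simp: in_keys_iff)
  then show ?thesis
    by (simp add: lin_superset[of "Poly_Mapping.keys v"] scale_sum)
qed

lemma lin_uminus: "lin \<phi> (- v) = - lin \<phi> v"
  using lin_add[of \<phi> v "- v"] by (simp add: add_eq_0_iff)

lemma lin_diff: "lin \<phi> (u - v) = lin \<phi> u - lin \<phi> v"
  using lin_add[of \<phi> u "- v"] by (simp add: lin_uminus)

lemma lin_sum: "lin \<phi> (sum f A) = (\<Sum>x\<in>A. lin \<phi> (f x))"
  by (induction A rule: infinite_finite_induct) (auto simp: lin_add)

lemma lin_pointwise_add: "lin (\<lambda>k. \<phi> k + \<psi> k) v = lin \<phi> v + lin \<psi> v"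
  by (simp add: lin_def scale_add sum.distrib)

lemma lin_pointwise_scale: "lin (\<lambda>k. scale c (\<phi> k)) v = scale c (lin \<phi> v)"
  by (simp add: lin_def scale_sum mult.commute)

lemma keys_lin: "Poly_Mapping.keys v \<subseteq> A \<Longrightarrow> (\<And>k. k \<in> A \<Longrightarrow> Poly_Mapping.keys (\<phi> k) \<subseteq> B) \<Longrightarrow>
    Poly_Mapping.keys (lin \<phi> v) \<subseteq> B"
proof (induction v rule: poly_mapping_induct_on)
  case (add u v)
  then show ?case using keys_add[of "lin \<phi> u" "lin \<phi> v"] by (auto simp: lin_add)
qed (force simp: in_keys_iff)+


subsection \<open>The free $*$-algebra\<close>

lemma free_star_alg_simps [simp]:
  "carrier (free_star_alg X) = {a. Poly_Mapping.keys a \<subseteq> words_over X}"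
  "mult (free_star_alg X) = (*)" "one (free_star_alg X) = 1"
  "zero (free_star_alg X) = 0" "add (free_star_alg X) = (+)"
  by (simp_all add: free_star_alg_def)

lemma words_over_simps [simp]:
  "0 \<in> words_over X"
  "u \<in> words_over X \<Longrightarrow> v \<in> words_over X \<Longrightarrow> u + v \<in> words_over X"
  "FWord xs \<in> words_over X \<longleftrightarrow> letter_gen ` set xs \<subseteq> X"
  by (auto simp: words_over_def zero_fword_def plus_fword_def)

lemma free_star_alg_closed:
  fixes a b :: "'x free_star"
  assumes "Poly_Mapping.keys a \<subseteq> words_over X" "Poly_Mapping.keys b \<subseteq> words_over X"
  shows "Poly_Mapping.keys (a + b) \<subseteq> words_over X" "Poly_Mapping.keys (a - b) \<subseteq> words_over X"
    "Poly_Mapping.keys (a * b) \<subseteq> words_over X"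
proof -
  show "Poly_Mapping.keys (a + b) \<subseteq> words_over X"
    using keys_add[of a b] assms by blast
  show "Poly_Mapping.keys (a - b) \<subseteq> words_over X"
    using keys_add[of a "- b"] assms by auto
  show "Poly_Mapping.keys (a * b) \<subseteq> words_over X"
  proof
    fix w assume "w \<in> Poly_Mapping.keys (a * b)"
    then obtain u v where "w = u + v" "u \<in> Poly_Mapping.keys a" "v \<in> Poly_Mapping.keys b"
      using keys_mult[of a b] by blast
    with assms show "w \<in> words_over X" by (auto intro!: words_over_simps(2))
  qed
qed

lemma scale_closed:
  "Poly_Mapping.keys a \<subseteq> words_over X \<Longrightarrow> Poly_Mapping.keys (scale c a) \<subseteq> words_over X"
  by (auto simp: in_keys_iff)

lemma ring_free_star_alg: "ring (free_star_alg X)"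
proof (rule ringI)
  show "abelian_group (free_star_alg X)"
  proof (rule abelian_groupI)
    fix x assume "x \<in> carrier (free_star_alg X)"
    then show "\<exists>y\<in>carrier (free_star_alg X). y \<oplus>\<^bsub>free_star_alg X\<^esub> x = \<zero>\<^bsub>free_star_alg X\<^esub>"
      by (intro bexI[of _ "- x"]) (simp_all add: free_star_alg_closed)
  qed (simp_all add: free_star_alg_closed add.assoc add.commute)
  show "Group.monoid (free_star_alg X)"
    by (rule monoidI) (simp_all add: free_star_alg_closed mult.assoc)
qed (simp_all add: distrib_left distrib_right)

lemma star_letter_star [simp]: "star_letter (star_letter x) = x"
  by (cases x) auto

lemma letter_gen_star [simp]: "letter_gen (star_letter x) = letter_gen x"
  by (cases x) auto

lemma star_word_star [simp]: "star_word (star_word w) = w"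
  by (cases w) (simp add: star_word_def rev_map comp_def)

lemma star_word_add: "star_word (u + v) = star_word v + star_word u"
  by (simp add: star_word_def plus_fword_def)

lemma star_word_over [simp]: "star_word w \<in> words_over X \<longleftrightarrow> w \<in> words_over X"
  by (simp add: star_word_def words_over_def image_image)

lemma star_superset:
  "finite A \<Longrightarrow> Poly_Mapping.keys a \<subseteq> A \<Longrightarrow>
    star a = (\<Sum>w\<in>A. Poly_Mapping.single (star_word w) (cnj (Poly_Mapping.lookup a w)))"
  unfolding star_def by (rule sum.mono_neutral_left) (auto simp: in_keys_iff)

lemma star_zero [simp]: "star 0 = 0"
  by (simp add: star_def)

lemma star_single [simp]:
  "star (Poly_Mapping.single w c) = Poly_Mapping.single (star_word w) (cnj c)"
  by (simp add: star_def)

lemma star_gen: "star (gen x) = adj x" "star (adj x) = gen x"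
  by (simp_all add: gen_def adj_def star_word_def)

lemma star_one: "star 1 = 1"
  by (simp add: star_word_def zero_fword_def flip: single_one)

lemma star_add: "star (a + b) = star a + star b"
  using keys_add[of a b]
  by (simp add: star_superset[of "Poly_Mapping.keys a \<union> Poly_Mapping.keys b"]
      lookup_add single_add sum.distrib)

lemma star_uminus: "star (- a) = - star a"
  using star_add[of a "- a"] by (simp add: add_eq_0_iff)

lemma star_star: "star (star a) = a"
proof -
  have "Poly_Mapping.keys a \<subseteq> UNIV" by simp
  then show ?thesis
    by (induction a rule: poly_mapping_induct_on) (auto simp: star_add)
qed

lemma star_mult: "star (a * b) = star b * star a"
proof -
  have "Poly_Mapping.keys a \<subseteq> UNIV" "Poly_Mapping.keys b \<subseteq> UNIV" by simp_all
  then show ?thesis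
  proof (induction a rule: poly_mapping_induct_on)
    case (single k c)
    from this(2) show ?case
      by (induction b rule: poly_mapping_induct_on)
        (auto simp: star_add mult_single star_word_add distrib_left distrib_right mult.commute)
  qed (auto simp: star_add distrib_left distrib_right)
qed

lemma star_carrier: "Poly_Mapping.keys a \<subseteq> words_over X \<Longrightarrow> Poly_Mapping.keys (star a) \<subseteq> words_over X"
proof (induction a rule: poly_mapping_induct_on)
  case (add u v)
  then show ?case using keys_add[of "star u" "star v"] by (auto simp: star_add)
qed auto

lemma star_ideal_carrier:
  assumes "\<And>l r. (l, r) \<in> E \<Longrightarrow> l - r \<in> carrier (free_star_alg X)"
  shows "(\<lambda>(l, r). l - r) ` E \<union> (\<lambda>(l, r). star (l - r)) ` E \<subseteq> carrier (free_star_alg X)"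
proof -
  have "l - r \<in> carrier (free_star_alg X) \<and> star (l - r) \<in> carrier (free_star_alg X)"
    if "(l, r) \<in> E" for l r
    using assms[OF that] star_carrier[of "l - r" X] by simp
  then show ?thesis
    unfolding Un_subset_iff image_subset_iff by (simp add: split_beta)
qed

lemma star_ideal_ideal:
  assumes "\<And>l r. (l, r) \<in> E \<Longrightarrow> l - r \<in> carrier (free_star_alg X)"
  shows "ideal (star_ideal X E) (free_star_alg X)"
  unfolding star_ideal_def
  by (rule ring.genideal_ideal[OF ring_free_star_alg star_ideal_carrier[OF assms]])

lemma star_ideal_minimal:
  assumes "ideal K (free_star_alg X)"
    and "\<And>l r. (l, r) \<in> E \<Longrightarrow> l - r \<in> K \<and> star (l - r) \<in> K"
  shows "star_ideal X E \<subseteq> K"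
  unfolding star_ideal_def
  by (rule ring.genideal_minimal[OF ring_free_star_alg assms(1)]) (use assms(2) in \<open>simp add: image_subset_iff split_beta\<close>)

lemma star_ideal_contains:
  assumes "\<And>l r. (l, r) \<in> E \<Longrightarrow> l - r \<in> carrier (free_star_alg X)" and "(l, r) \<in> E"
  shows "l - r \<in> star_ideal X E" "star (l - r) \<in> star_ideal X E"
proof -
  have "(\<lambda>(l, r). l - r) ` E \<union> (\<lambda>(l, r). star (l - r)) ` E \<subseteq> star_ideal X E"
    unfolding star_ideal_def
    by (rule ring.genideal_self[OF ring_free_star_alg star_ideal_carrier[OF assms(1)]])
  with assms(2) show "l - r \<in> star_ideal X E" "star (l - r) \<in> star_ideal X E"
    unfolding Un_subset_iff image_subset_iff by force+
qed

lemma ideal_free_star_algI: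
  assumes "K \<subseteq> carrier (free_star_alg X)" "0 \<in> K"
    and "\<And>a b. a \<in> K \<Longrightarrow> b \<in> K \<Longrightarrow> a + b \<in> K" "\<And>a. a \<in> K \<Longrightarrow> - a \<in> K"
    and "\<And>a x. a \<in> K \<Longrightarrow> x \<in> carrier (free_star_alg X) \<Longrightarrow> x * a \<in> K"
    and "\<And>a x. a \<in> K \<Longrightarrow> x \<in> carrier (free_star_alg X) \<Longrightarrow> a * x \<in> K"
  shows "ideal K (free_star_alg X)"
proof (rule idealI[OF ring_free_star_alg])
  interpret ring "free_star_alg X" by (rule ring_free_star_alg)
  show "subgroup K (add_monoid (free_star_alg X))"
  proof (rule add.subgroupI)
    fix a b assume a: "a \<in> K" and b: "b \<in> K"
    have "\<ominus>\<^bsub>free_star_alg X\<^esub> a = - a"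
    proof (rule minus_equality)
      show "a \<in> carrier (free_star_alg X)" "- a \<in> carrier (free_star_alg X)"
        using a assms(1,4) by blast+
    qed simp
    then show "\<ominus>\<^bsub>free_star_alg X\<^esub> a \<in> K" using assms(4) a by simp
    show "a \<oplus>\<^bsub>free_star_alg X\<^esub> b \<in> K" using assms(3) a b by simp
  next
    show "K \<subseteq> carrier (free_star_alg X)" by (rule assms(1))
    show "K \<noteq> {}" using assms(2) by blast
  qed
next
  fix a x assume "a \<in> K" "x \<in> carrier (free_star_alg X)"
  then show "x \<otimes>\<^bsub>free_star_alg X\<^esub> a \<in> K" "a \<otimes>\<^bsub>free_star_alg X\<^esub> x \<in> K"
    using assms(5,6) by simp_all
qed

text \<open>The star maps the defining ideal into itself, so it acts on the quotient.\<close>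

lemma star_ideal_star:
  assumes "\<And>l r. (l, r) \<in> E \<Longrightarrow> l - r \<in> carrier (free_star_alg X)"
    and "a \<in> star_ideal X E"
  shows "star a \<in> star_ideal X E"
proof -
  interpret J: ideal "star_ideal X E" "free_star_alg X"
    by (rule star_ideal_ideal[OF assms(1)])
  have uminus: "- b \<in> star_ideal X E" if "b \<in> star_ideal X E" for b
  proof -
    have "- b = \<ominus>\<^bsub>free_star_alg X\<^esub> b"
      using J.a_Hcarr[OF that] by (intro J.minus_equality[symmetric]) auto
    with that show ?thesis by simp
  qed
  have carr: "Poly_Mapping.keys b \<subseteq> words_over X" if "b \<in> star_ideal X E" for b
    using J.a_Hcarr[OF that] by simp
  have zero: "0 \<in> star_ideal X E" using additive_subgroup.zero_closed[OF J.is_additive_subgroup] by simp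
  have add: "b + d \<in> star_ideal X E" if "b \<in> star_ideal X E" "d \<in> star_ideal X E" for b d
    using additive_subgroup.a_closed[OF J.is_additive_subgroup that] by simp
  have mult: "x * b \<in> star_ideal X E" "b * x \<in> star_ideal X E"
    if "b \<in> star_ideal X E" "Poly_Mapping.keys x \<subseteq> words_over X" for b x
    using J.I_l_closed[OF that(1), of x] J.I_r_closed[OF that(1), of x] that(2) by simp_all
  have "ideal {a \<in> star_ideal X E. star a \<in> star_ideal X E} (free_star_alg X)"
  proof (rule ideal_free_star_algI)
    show "{a \<in> star_ideal X E. star a \<in> star_ideal X E} \<subseteq> carrier (free_star_alg X)"
      using carr by auto
  qed (simp_all add: zero add mult uminus star_add star_uminus star_mult star_carrier)
  then have "star_ideal X E \<subseteq> {a \<in> star_ideal X E. star a \<in> star_ideal X E}"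
    by (rule star_ideal_minimal)
      (simp add: star_star star_ideal_contains[OF assms(1)])
  with assms(2) show ?thesis by blast
qed

lemma cls_eq_iff:
  assumes "ideal (star_ideal X E) (free_star_alg X)"
    and "a \<in> carrier (free_star_alg X)" "b \<in> carrier (free_star_alg X)"
  shows "cls X E a = cls X E b \<longleftrightarrow> a - b \<in> star_ideal X E"
proof -
  interpret J: ideal "star_ideal X E" "free_star_alg X" by fact
  have m: "a \<ominus>\<^bsub>free_star_alg X\<^esub> b = a - b"
  proof -
    have "\<ominus>\<^bsub>free_star_alg X\<^esub> b = - b"
      using assms(3) by (intro J.minus_equality) auto
    then show ?thesis by (simp add: a_minus_def)
  qed
  show ?thesis
    unfolding cls_def
    using J.quotient_eq_iff_same_a_r_cos[OF assms] m by auto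
qed

lemma cls_eq: "cls X E a = {j + a | j. j \<in> star_ideal X E}"
  by (auto simp: cls_def a_r_coset_def r_coset_def)

lemma carrier_presented: "carrier (presented X E) = cls X E ` carrier (free_star_alg X)"
  by (auto simp: presented_def FactRing_def A_RCOSETS_def RCOSETS_def cls_def a_r_coset_def)


subsection \<open>The action of the free algebra\<close>

lemma act_zero [simp]: "act n m q 0 v = 0"
  by (simp add: act_def)

lemma act_add: "act n m q (a + b) v = act n m q a v + act n m q b v"
  by (simp add: act_def lin_add)

lemma act_uminus: "act n m q (- a) v = - act n m q a v"
  by (simp add: act_def lin_uminus)

lemma act_diff: "act n m q (a - b) v = act n m q a v - act n m q b v"
  by (simp add: act_def lin_diff)

lemma act_scale: "act n m q (scale c a) v = scale c (act n m q a v)"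
  by (simp add: act_def lin_scale)

lemma act_sum: "act n m q (sum f A) v = (\<Sum>x\<in>A. act n m q (f x) v)"
  by (simp add: act_def lin_sum)

lemma act_single: "act n m q (Poly_Mapping.single w c) v = scale c (act_letters n m q (letters w) v)"
  by (simp add: act_def)

lemma act_one [simp]: "act n m q 1 v = v"
  by (simp add: act_single zero_fword_def flip: single_one)

lemma act_gen [simp]:
  "act n m q (gen x) v = lin (act_letter n m q (Gen x)) v"
  "act n m q (adj x) v = lin (act_letter n m q (Adj x)) v"
  by (simp_all add: gen_def adj_def act_single)

lemma act_letters_add: "act_letters n m q xs (u + v) = act_letters n m q xs u + act_letters n m q xs v"
  by (induction xs) (auto simp: lin_add)

lemma act_letters_scale: "act_letters n m q xs (scale c v) = scale c (act_letters n m q xs v)"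
  by (induction xs) (auto simp: lin_scale)

lemma act_letters_append: "act_letters n m q (xs @ ys) v = act_letters n m q xs (act_letters n m q ys v)"
  by (induction xs) auto

lemma act_add_vec: "act n m q a (u + v) = act n m q a u + act n m q a v"
  by (simp add: act_def act_letters_add lin_pointwise_add)

lemma act_scale_vec: "act n m q a (scale c v) = scale c (act n m q a v)"
  by (simp add: act_def act_letters_scale lin_pointwise_scale)

lemma act_zero_vec [simp]: "act n m q a 0 = 0"
  using act_scale_vec[of n m q a 0 0] by simp

lemma act_mult: "act n m q (a * b) v = act n m q a (act n m q b v)"
proof -
  have "Poly_Mapping.keys a \<subseteq> UNIV" "Poly_Mapping.keys b \<subseteq> UNIV" by simp_all
  then show ?thesis
  proof (induction a rule: poly_mapping_induct_on)
    case (single k c)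
    from this(2) show ?case
      by (induction b rule: poly_mapping_induct_on)
        (simp_all add: distrib_left act_add act_add_vec act_single mult_single
          plus_fword_def act_letters_append act_letters_scale)
  qed (auto simp: act_add distrib_right)
qed

lemma idx_iff: "i \<in> idx n m \<longleftrightarrow>
    (\<forall>j. 1 \<le> j \<and> j < n + m \<longrightarrow> (if j \<le> n then i j \<le> 0 else i j \<ge> 1)) \<and>
    (\<forall>j. \<not> (1 \<le> j \<and> j < n + m) \<longrightarrow> i j = undefined)"
proof -
  have "j \<in> {1..n+m-1} \<longleftrightarrow> 1 \<le> j \<and> j < n + m" for j by auto
  then show ?thesis
    unfolding idx_def PiE_iff extensional_def Ball_def by (auto split: if_splits)
qed

lemma idx_upd:
  assumes "i \<in> idx n m" "1 \<le> j" "j < n + m" "if j \<le> n then c \<le> 0 else c \<ge> 1"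
  shows "i(j := c) \<in> idx n m"
  using assms unfolding idx_iff by (simp split: if_splits)

lemma idx_bounds:
  assumes "i \<in> idx n m" "1 \<le> j" "j < n + m"
  shows "j \<le> n \<Longrightarrow> i j \<le> 0" "n < j \<Longrightarrow> i j \<ge> 1"
proof -
  have "if j \<le> n then i j \<le> 0 else i j \<ge> 1" using assms unfolding idx_iff by blast
  then show "j \<le> n \<Longrightarrow> i j \<le> 0" "n < j \<Longrightarrow> i j \<ge> 1" by simp_all
qed

lemma in_Hspace_add: "u \<in> Hspace n m \<Longrightarrow> v \<in> Hspace n m \<Longrightarrow> u + v \<in> Hspace n m"
  using keys_add[of u v] by (auto simp: Hspace_def)

lemma in_Hspace_scale: "v \<in> Hspace n m \<Longrightarrow> scale c v \<in> Hspace n m"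
  by (auto simp: Hspace_def in_keys_iff)

lemma act_letter_Hspace:
  assumes "i \<in> idx n m" "letter_gen x \<in> hgens n m" "m \<ge> 1"
  shows "act_letter n m q x i \<in> Hspace n m"
proof -
  have single: "Poly_Mapping.single k c \<in> Hspace n m" if "k \<in> idx n m \<or> c = 0" for k c
    using that by (auto simp: Hspace_def)
  have zero: "0 \<in> Hspace n m" by (simp add: Hspace_def)
  consider k where "x = Gen (TG k)" | k where "x = Adj (TG k)" | "x = Gen F0 \<or> x = Adj F0"
    by (metis hgen.exhaust letter.exhaust)
  then show ?thesis
  proof cases
    case (1 k)
    then have k: "1 \<le> k" using assms(2) by (auto simp: hgens_def)
    consider "k \<le> n" | "n < k" "k < n + m" "i k = 1" | "n < k" "k < n + m" "i k > 1" | "k = n + m"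
      using idx_bounds(2)[OF assms(1) k] assms(2) 1 by (fastforce simp: hgens_def)
    then show ?thesis
    proof cases
      case 1
      with idx_bounds(1)[OF assms(1) k] assms(3) have "i(k := i k - 1) \<in> idx n m"
        by (intro idx_upd[OF assms(1) k]) auto
      with 1 \<open>x = _\<close> show ?thesis by (simp add: single)
    next
      case 3
      then have "i(k := i k - 1) \<in> idx n m"
        by (intro idx_upd[OF assms(1) k]) auto
      with 3 \<open>x = _\<close> show ?thesis by (simp add: single)
    qed (use assms \<open>x = _\<close> in \<open>simp_all add: single zero\<close>)
  next
    case (2 k)
    then have k: "1 \<le> k" using assms(2) by (auto simp: hgens_def)
    consider "k \<le> n" "i k = 0" | "k \<le> n" "i k < 0" | "n < k" "k < n + m" | "k = n + m"
      using idx_bounds(1)[OF assms(1) k] assms(2,3) 2 by (fastforce simp: hgens_def)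
    then show ?thesis
    proof cases
      case 2
      with assms(3) have "i(k := i k + 1) \<in> idx n m"
        by (intro idx_upd[OF assms(1) k]) auto
      with 2 \<open>x = _\<close> show ?thesis by (simp add: single)
    next
      case 3
      with idx_bounds(2)[OF assms(1) k] have "i(k := i k + 1) \<in> idx n m"
        by (intro idx_upd[OF assms(1) k]) auto
      with 3 \<open>x = _\<close> show ?thesis by (simp add: single)
    qed (use assms \<open>x = _\<close> in \<open>simp_all add: single zero\<close>)
  next
    case 3
    with assms(1) show ?thesis by (auto simp: single zero)
  qed
qed

lemma act_letters_Hspace:
  "m \<ge> 1 \<Longrightarrow> v \<in> Hspace n m \<Longrightarrow> letter_gen ` set xs \<subseteq> hgens n m \<Longrightarrow> act_letters n m q xs v \<in> Hspace n m"
proof (induction xs)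
  case (Cons x xs)
  then have "Poly_Mapping.keys (act_letters n m q xs v) \<subseteq> idx n m" by (auto simp: Hspace_def)
  then have "Poly_Mapping.keys (lin (act_letter n m q x) (act_letters n m q xs v)) \<subseteq> idx n m"
    by (rule keys_lin) (use act_letter_Hspace Cons.prems in \<open>auto simp: Hspace_def\<close>)
  then show ?case by (simp add: Hspace_def)
qed simp

lemma act_Hspace:
  assumes "m \<ge> 1" "v \<in> Hspace n m" "a \<in> carrier (free_star_alg (hgens n m))"
  shows "act n m q a v \<in> Hspace n m"
proof -
  have "Poly_Mapping.keys a \<subseteq> words_over (hgens n m)" using assms by simp
  then have "Poly_Mapping.keys (lin (\<lambda>w. act_letters n m q (letters w) v) a) \<subseteq> idx n m"
    by (rule keys_lin)
      (use act_letters_Hspace[OF assms(1,2)] in \<open>auto simp: Hspace_def words_over_def\<close>)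
  then show ?thesis by (simp add: act_def Hspace_def)
qed

lemma act_eq_0_Hspace:
  assumes "v \<in> Hspace n m" "\<And>i. i \<in> idx n m \<Longrightarrow> act n m q a (ebas i) = 0"
  shows "act n m q a v = 0"
proof -
  have "Poly_Mapping.keys v \<subseteq> idx n m" using assms(1) by (simp add: Hspace_def)
  then show ?thesis
  proof (induction v rule: poly_mapping_induct_on)
    case (single k c)
    have "Poly_Mapping.single k c = scale c (ebas k)" by simp
    then show ?case using single assms(2) by (metis act_scale_vec scale_simps(3))
  qed (auto simp: act_add_vec)
qed

lemma hinner_superset: "finite A \<Longrightarrow> Poly_Mapping.keys u \<subseteq> A \<Longrightarrow>
    hinner u v = (\<Sum>i\<in>A. Poly_Mapping.lookup u i * cnj (Poly_Mapping.lookup v i))"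
  unfolding hinner_def by (rule sum.mono_neutral_left) (auto simp: in_keys_iff)

lemma hinner_add_left: "hinner (u + u') v = hinner u v + hinner u' v"
  using keys_add[of u u']
  by (simp add: hinner_superset[of "Poly_Mapping.keys u \<union> Poly_Mapping.keys u'"]
      lookup_add sum.distrib distrib_right)

lemma hinner_add_right: "hinner u (v + v') = hinner u v + hinner u v'"
  by (simp add: hinner_def lookup_add sum.distrib distrib_left)

lemma hinner_zero [simp]: "hinner 0 v = 0" "hinner u 0 = 0"
  by (simp_all add: hinner_def)

lemma hinner_single [simp]: "hinner (Poly_Mapping.single i c) v = c * cnj (Poly_Mapping.lookup v i)"
  by (simp add: hinner_def)

lemma hinner_scale: "hinner (scale c u) v = c * hinner u v" "hinner u (scale c v) = cnj c * hinner u v"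
proof -
  have "Poly_Mapping.keys (scale c u) \<subseteq> Poly_Mapping.keys u" by (auto simp: in_keys_iff)
  then show "hinner (scale c u) v = c * hinner u v"
    by (simp add: hinner_superset[of "Poly_Mapping.keys u"] sum_distrib_left mult.assoc)
  show "hinner u (scale c v) = cnj c * hinner u v"
    by (simp add: hinner_def sum_distrib_left mult_ac)
qed

lemma hinner_basis: "hinner (ebas i) (ebas j) = (if i = j then 1 else 0)"
  by (simp add: lookup_single when_def)

lemma hinner_self_eq_0: "hinner v v = 0 \<longleftrightarrow> v = 0"
proof -
  have "hinner v v = of_real (\<Sum>i\<in>Poly_Mapping.keys v. (cmod (Poly_Mapping.lookup v i))\<^sup>2)"
    by (simp add: hinner_def complex_norm_square del: of_real_power)
  also have "\<dots> = 0 \<longleftrightarrow> Poly_Mapping.keys v = {}"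
    by (subst of_real_eq_0_iff, subst sum_nonneg_eq_0_iff) (auto simp: in_keys_iff intro!: poly_mapping_eqI)
  finally show ?thesis by simp
qed

lemma Ssum_upd [simp]: "k \<le> j \<Longrightarrow> Ssum k (i(j := c)) = Ssum k i"
  by (auto simp: Ssum_def intro!: sum.cong)

lemma hinner_ebas_right: "hinner (ebas i) v = cnj (Poly_Mapping.lookup v i)"
  by simp

lemma act_letter_adjoint_Gen:
  "hinner (act_letter n m q (Gen x) i) (ebas j) = hinner (ebas i) (act_letter n m q (Adj x) j)"
proof (cases x)
  case (TG k)
  show ?thesis
  proof (cases "j = i(k := i k - 1)")
    case True
    then show ?thesis by (simp add: TG lookup_single when_def)
  next
    case False
    then have "i \<noteq> j(k := j k + 1)" by auto
    with False have "j(k := j k + 1) \<noteq> i" "i(k := i k - 1) \<noteq> j" by metis+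
    then show ?thesis
      by (auto simp: TG lookup_single when_def)
  qed
next
  case F0
  then show ?thesis by (simp add: lookup_single when_def)
qed

lemma act_letter_adjoint:
  "hinner (act_letter n m q x i) (ebas j) = hinner (ebas i) (act_letter n m q (star_letter x) j)"
proof (cases x)
  case (Adj y)
  have sym: "hinner (ebas l) (act_letter n m q (Gen y) k) =
      cnj (hinner (act_letter n m q (Gen y) k) (ebas l))" for k l
    by (cases y) (simp_all add: lookup_single when_def)
  have sym': "hinner (act_letter n m q (Adj y) k) (ebas l) =
      cnj (hinner (ebas l) (act_letter n m q (Adj y) k))" for k l
    by (cases y) (simp_all add: lookup_single when_def)
  show ?thesis
    by (simp only: Adj star_letter.simps sym sym' act_letter_adjoint_Gen)
next
  case (Gen y)
  show ?thesis by (simp only: Gen star_letter.simps act_letter_adjoint_Gen)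
qed

lemma lin_act_letter_adjoint:
  "hinner (lin (act_letter n m q x) u) v = hinner u (lin (act_letter n m q (star_letter x)) v)"
proof -
  have "Poly_Mapping.keys u \<subseteq> UNIV" "Poly_Mapping.keys v \<subseteq> UNIV"
    by auto
  then show ?thesis
  proof (induction u rule: poly_mapping_induct_on)
    case (single k c)
    from this(2) show ?case
    proof (induction v rule: poly_mapping_induct_on)
      case (single l d)
      have "hinner (act_letter n m q x k) (scale d (ebas l)) =
          hinner (ebas k) (scale d (act_letter n m q (star_letter x) l))"
        unfolding hinner_scale act_letter_adjoint ..
      then show ?case by (simp add: hinner_scale)
    next
      case zero
      show ?case by simp
    next
      case (add u v)
      then show ?case by (simp only: lin_add hinner_add_right)
    qed
  next
    case zero
    show ?case by simp
  next
    case (add u v)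
    then show ?case by (simp only: lin_add hinner_add_left)
  qed
qed

lemma act_letters_adjoint:
  "hinner (act_letters n m q xs u) v = hinner u (act_letters n m q (rev (map star_letter xs)) v)"
proof (induction xs arbitrary: v)
  case (Cons x xs)
  then show ?case by (simp add: act_letters_append lin_act_letter_adjoint)
qed simp

lemma act_adjoint: "hinner (act n m q a u) v = hinner u (act n m q (star a) v)"
proof -
  have "Poly_Mapping.keys a \<subseteq> UNIV" by simp
  then show ?thesis
  proof (induction a rule: poly_mapping_induct_on)
    case (single w c)
    then show ?case
      using act_letters_adjoint[of n m q "letters w" u v]
      by (simp add: act_single hinner_scale star_word_def)
  next
    case zero
    show ?case by simp
  next
    case (add a b)
    then show ?case by (simp only: star_add act_add hinner_add_left hinner_add_right)
  qed
qed

text \<open>\<open>f0gen\<close> acts by the orthogonal projection onto the span of the \<open>ebas i\<close> with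
  \<open>i 1 = \<dots> = i n = 0\<close>.\<close>

lemma act_f0:
  assumes "v \<in> Hspace n m"
  shows "Poly_Mapping.keys (act n m q f0gen v) \<subseteq> {i \<in> idx n m. \<forall>k\<in>{1..n}. i k = 0}"
    and "Poly_Mapping.keys w \<subseteq> {i \<in> idx n m. \<forall>k\<in>{1..n}. i k = 0} \<Longrightarrow>
      hinner (v - act n m q f0gen v) w = 0"
proof -
  have k: "Poly_Mapping.keys v \<subseteq> idx n m" using assms by (simp add: Hspace_def)
  then have "Poly_Mapping.keys (lin (act_letter n m q (Gen F0)) v) \<subseteq> {i \<in> idx n m. \<forall>k\<in>{1..n}. i k = 0}"
    by (rule keys_lin) auto
  then show "Poly_Mapping.keys (act n m q f0gen v) \<subseteq> {i \<in> idx n m. \<forall>k\<in>{1..n}. i k = 0}" by simp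
  assume w: "Poly_Mapping.keys w \<subseteq> {i \<in> idx n m. \<forall>k\<in>{1..n}. i k = 0}"
  from k have "hinner v w = hinner (act n m q f0gen v) w"
  proof (induction v rule: poly_mapping_induct_on)
    case (single i c)
    with w show ?case by (auto simp: in_keys_iff hinner_scale)
  qed (auto simp: lin_add hinner_add_left)
  moreover have "hinner v w = hinner (v - act n m q f0gen v) w + hinner (act n m q f0gen v) w"
    by (simp only: hinner_add_left[symmetric] diff_add_cancel)
  ultimately show "hinner (v - act n m q f0gen v) w = 0" by simp
qed

subsection \<open>The defining relations hold in the representation\<close>

context
  fixes n m :: nat and q :: real
  assumes q: "0 < q" "q < 1" and m: "m \<ge> 1"
begin

private definition rcf :: "nat \<Rightarrow> int \<Rightarrow> real" where
  "rcf k a = (if k \<le> n then sqrt (q powi (2 * (a - 1)) - 1)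
            else if k < n + m then sqrt (1 - q powi (2 * (a - 1))) else 1)"

private definition sh :: "nat \<Rightarrow> int \<Rightarrow> (nat \<Rightarrow> int) \<Rightarrow> nat \<Rightarrow> int" where
  "sh k c i = (if k < n + m then i(k := i k + c) else i)"

private lemma act_t:
  "act n m q (tgen k) (ebas i) = Poly_Mapping.single (sh k (- 1) i) (of_real (q powi Ssum k i * rcf k (i k)))"
  "act n m q (tadj k) (ebas i) = Poly_Mapping.single (sh k 1 i) (of_real (q powi Ssum k i * rcf k (i k + 1)))"
  using m by (simp_all add: rcf_def sh_def of_real_power_int)

private lemma act_t_single:
  "act n m q (tgen k) (Poly_Mapping.single i c) =
    Poly_Mapping.single (sh k (- 1) i) (c * of_real (q powi Ssum k i * rcf k (i k)))"
  "act n m q (tadj k) (Poly_Mapping.single i c) =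
    Poly_Mapping.single (sh k 1 i) (c * of_real (q powi Ssum k i * rcf k (i k + 1)))"
  using act_scale_vec[of n m q "tgen k" c "ebas i"] act_scale_vec[of n m q "tadj k" c "ebas i"]
  unfolding act_t by simp_all

private lemma act_f0_single:
  "act n m q f0gen (Poly_Mapping.single i c) =
    (if \<forall>k\<in>{1..n}. i k = 0 then Poly_Mapping.single i c else 0)"
  "act n m q f0adj (Poly_Mapping.single i c) =
    (if \<forall>k\<in>{1..n}. i k = 0 then Poly_Mapping.single i c else 0)"
  by simp_all

private lemma sh_other: "j \<noteq> k \<Longrightarrow> sh k c i j = i j"
  and sh_commute: "j \<noteq> k \<Longrightarrow> sh j d (sh k c i) = sh k c (sh j d i)"
  and sh_same: "sh k c (sh k d i) = sh k (c + d) i" "sh k 0 i = i"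
  and sh_at: "k < n + m \<Longrightarrow> sh k c i k = i k + c"
  by (auto simp: sh_def fun_upd_twist)

private lemma Ssum_sh_le: "j \<le> k \<Longrightarrow> Ssum j (sh k c i) = Ssum j i"
  by (simp add: sh_def)

private lemma Ssum_sh_gt:
  assumes "1 \<le> k" "k < j" "k < n + m"
  shows "Ssum j (sh k c i) = Ssum j i + c"
proof -
  have "Ssum j f = f k + (\<Sum>l\<in>{1..<j} - {k}. f l)" for f
    unfolding Ssum_def using assms by (intro sum.remove) auto
  from this[of "sh k c i"] this[of i] show ?thesis
    using assms by (simp add: sh_at sh_other)
qed

private lemma q_powi_Suc: "q powi (a + 1) = q * q powi a" "q powi (a - 1) = q powi a / q"
  using q by (simp_all add: power_int_add power_int_diff)

private lemma rel_tt:
  assumes "1 \<le> i" "i < j" "j \<le> n + m"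
  shows "act n m q (tgen i * tgen j) (ebas \<iota>) = act n m q (scale q (tgen j * tgen i)) (ebas \<iota>)"
proof -
  have *: "sh j c \<iota> i = \<iota> i" "sh i c \<iota> j = \<iota> j" "sh i (- 1) (sh j (- 1) \<iota>) = sh j (- 1) (sh i (- 1) \<iota>)"
    "Ssum i (sh j c \<iota>) = Ssum i \<iota>" "Ssum j (sh i (- 1) \<iota>) = Ssum j \<iota> - 1" for c
    using assms by (simp_all add: sh_other sh_commute Ssum_sh_le Ssum_sh_gt)
  show ?thesis
    unfolding act_mult act_scale act_t act_t_single * q_powi_Suc using q by (simp add: mult_ac)
qed

private lemma rel_tt':
  assumes "i \<in> {1..n+m}" "j \<in> {1..n+m}" "i \<noteq> j"
  shows "act n m q (tgen i * tadj j) (ebas \<iota>) = act n m q (scale q (tadj j * tgen i)) (ebas \<iota>)"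
proof (cases "i < j")
  case True
  then have *: "sh j c \<iota> i = \<iota> i" "sh i c \<iota> j = \<iota> j" "sh i (- 1) (sh j 1 \<iota>) = sh j 1 (sh i (- 1) \<iota>)"
    "Ssum i (sh j c \<iota>) = Ssum i \<iota>" "Ssum j (sh i (- 1) \<iota>) = Ssum j \<iota> - 1" for c
    using assms by (simp_all add: sh_other sh_commute Ssum_sh_le Ssum_sh_gt)
  show ?thesis
    unfolding act_mult act_scale act_t act_t_single * q_powi_Suc using q by (simp add: mult_ac)
next
  case False
  with assms have *: "sh j c \<iota> i = \<iota> i" "sh i c \<iota> j = \<iota> j"
    "sh i (- 1) (sh j 1 \<iota>) = sh j 1 (sh i (- 1) \<iota>)"
    "Ssum j (sh i c \<iota>) = Ssum j \<iota>" "Ssum i (sh j 1 \<iota>) = Ssum i \<iota> + 1" for c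
    by (simp_all add: sh_other sh_commute Ssum_sh_le Ssum_sh_gt)
  show ?thesis
    unfolding act_mult act_scale act_t act_t_single * q_powi_Suc by (simp add: mult_ac)
qed

private definition Q :: "(nat \<Rightarrow> int) \<Rightarrow> nat \<Rightarrow> real" where
  "Q i k = q powi (2 * Ssum k i)"

private lemma Ssum_Suc: "1 \<le> k \<Longrightarrow> Ssum (Suc k) i = Ssum k i + i k"
  by (simp add: Ssum_def)

private lemma powi_ge_1: "a \<le> 0 \<Longrightarrow> 1 \<le> q powi a"
proof (cases "a = 0")
  case False
  assume "a \<le> 0"
  then have "q powi a = inverse q ^ nat (- a)" using False by (simp add: power_int_def)
  also have "1 \<le> \<dots>" using q by (intro one_le_power one_le_inverse) simp_all
  finally show ?thesis .
qed simp

private lemma powi_le_1: "0 \<le> a \<Longrightarrow> q powi a \<le> 1"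
  using q by (simp add: power_int_def power_le_one)

private lemma powi_sq: "q powi a * q powi a = q powi (2 * a)"
  using q power_int_add[of q a a] by simp

private lemma act_tt'_same:
  assumes i: "i \<in> idx n m" and k: "1 \<le> k" "k \<le> n + m"
  shows "act n m q (tgen k * tadj k) (ebas i) = Poly_Mapping.single i (of_real
    (if k \<le> n then Q i (Suc k) - Q i k else if k < n + m then Q i k - Q i (Suc k) else Q i k))"
proof -
  have sh: "sh k (-1) (sh k (1) i) = i" "rcf k (sh k (1) i k) = rcf k (i k + 1)"
    using k m by (cases "k < n + m", simp_all add: sh_same sh_at sh_def rcf_def)+
  have eq: "act n m q (tgen k * tadj k) (ebas i) =
      Poly_Mapping.single i (of_real (q powi (2 * Ssum k i) * (rcf k (i k + 1))\<^sup>2))"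
    unfolding act_mult act_t act_t_single sh Ssum_sh_le[OF order_refl]
    unfolding powi_sq[symmetric] power2_eq_square of_real_mult mult_1_left
    by (simp only: mult_ac)
  have "q powi (2 * Ssum k i) * (rcf k (i k + 1))\<^sup>2 =
      (if k \<le> n then Q i (Suc k) - Q i k else if k < n + m then Q i k - Q i (Suc k) else Q i k)"
  proof -
    have Suc: "Q i (Suc k) = q powi (2 * Ssum k i) * q powi (2 * i k)"
      using q k by (simp add: Q_def Ssum_Suc distrib_left power_int_add)
    consider "k \<le> n" | "n < k" "k < n + m" | "k = n + m" using k by linarith
    then show ?thesis
    proof cases
      case 1
      then have "i k \<le> 0" using idx_bounds(1)[OF i k(1)] m by simp
      then show ?thesis using 1 Suc powi_ge_1[of "2 * i k"] by (simp add: rcf_def Q_def algebra_simps)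
    next
      case 2
      then have "i k \<ge> 1" using idx_bounds(2)[OF i k(1)] by simp
      then show ?thesis using 2 Suc powi_le_1[of "2 * i k"] by (simp add: rcf_def Q_def algebra_simps)
    qed (use m in \<open>simp add: rcf_def Q_def\<close>)
  qed
  then show ?thesis unfolding eq by simp
qed

private lemma act_t't_same:
  assumes i: "i \<in> idx n m" and k: "1 \<le> k" "k \<le> n + m"
  shows "act n m q (tadj k * tgen k) (ebas i) = Poly_Mapping.single i (of_real
    (if k \<le> n then q powi (-2) * Q i (Suc k) - Q i k
     else if k < n + m then Q i k - q powi (-2) * Q i (Suc k) else Q i k))"
proof -
  have sh: "sh k (1) (sh k (-1) i) = i" "rcf k (sh k (-1) i k + 1) = rcf k (i k)"
    using k m by (cases "k < n + m", simp_all add: sh_same sh_at sh_def rcf_def)+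
  have eq: "act n m q (tadj k * tgen k) (ebas i) =
      Poly_Mapping.single i (of_real (q powi (2 * Ssum k i) * (rcf k (i k))\<^sup>2))"
    unfolding act_mult act_t act_t_single sh Ssum_sh_le[OF order_refl]
    unfolding powi_sq[symmetric] power2_eq_square of_real_mult mult_1_left
    by (simp only: mult_ac)
  have "q powi (2 * Ssum k i) * (rcf k (i k))\<^sup>2 =
      (if k \<le> n then q powi (-2) * Q i (Suc k) - Q i k
       else if k < n + m then Q i k - q powi (-2) * Q i (Suc k) else Q i k)"
  proof -
    have "q powi (-2) * Q i (Suc k) = q powi (-2 + (2 * Ssum k i + 2 * i k))"
      using q k by (subst power_int_add) (simp_all add: Q_def Ssum_Suc distrib_left)
    also have "-2 + (2 * Ssum k i + 2 * i k) = 2 * Ssum k i + 2 * (i k - 1)" by simp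
    also have "q powi \<dots> = q powi (2 * Ssum k i) * q powi (2 * (i k - 1))"
      using q by (subst power_int_add) simp_all
    finally have Suc: "q powi (-2) * Q i (Suc k) = q powi (2 * Ssum k i) * q powi (2 * (i k - 1))" .
    consider "k \<le> n" | "n < k" "k < n + m" | "k = n + m" using k by linarith
    then show ?thesis
    proof cases
      case 1
      then have "i k \<le> 0" using idx_bounds(1)[OF i k(1)] m by simp
      then have "(rcf k (i k))\<^sup>2 = q powi (2 * (i k - 1)) - 1"
        using 1 powi_ge_1[of "2 * (i k - 1)"] by (simp add: rcf_def)
      then show ?thesis using 1 Suc by (simp add: Q_def right_diff_distrib)
    next
      case 2
      then have "i k \<ge> 1" using idx_bounds(2)[OF i k(1)] by simp
      then have "(rcf k (i k))\<^sup>2 = 1 - q powi (2 * (i k - 1))"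
        using 2 powi_le_1[of "2 * (i k - 1)"] by (simp add: rcf_def)
      then show ?thesis using 2 Suc by (simp add: Q_def right_diff_distrib)
    qed (use m in \<open>simp add: rcf_def Q_def\<close>)
  qed
  then show ?thesis unfolding eq by simp
qed

private lemma sum_single: "(\<Sum>k\<in>A. Poly_Mapping.single i (of_real (f k) :: complex)) =
    Poly_Mapping.single i (of_real (sum f A))"
  by (induction A rule: infinite_finite_induct) (auto simp: single_add)

private lemma act_sum_low:
  assumes i: "i \<in> idx n m" and a: "1 \<le> a" "a \<le> Suc n"
  shows "act n m q (\<Sum>k=a..n. tgen k * tadj k) (ebas i) =
    Poly_Mapping.single i (of_real (Q i (Suc n) - Q i a))"
proof -
  have "act n m q (\<Sum>k=a..n. tgen k * tadj k) (ebas i) =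
      (\<Sum>k=a..n. Poly_Mapping.single i (of_real (Q i (Suc k) - Q i k)))"
    unfolding act_sum
  proof (rule sum.cong)
    fix k assume "k \<in> {a..n}"
    with a show "act n m q (tgen k * tadj k) (ebas i) =
        Poly_Mapping.single i (complex_of_real (Q i (Suc k) - Q i k))"
      by (subst act_tt'_same[OF i]) auto
  qed simp
  also have "\<dots> = Poly_Mapping.single i (of_real (\<Sum>k=a..n. Q i (Suc k) - Q i k))"
    by (rule sum_single)
  also have "(\<Sum>k=a..n. Q i (Suc k) - Q i k) = Q i (Suc n) - Q i a"
    using a by (intro sum_Suc_diff) auto
  finally show ?thesis .
qed

private lemma act_sum_high:
  assumes i: "i \<in> idx n m" and a: "n < a" "a \<le> n + m"
  shows "act n m q (\<Sum>k=a..n+m. tgen k * tadj k) (ebas i) = Poly_Mapping.single i (of_real (Q i a))"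
proof -
  define f where "f k = (if k < n + m then Q i k - Q i (Suc k) else Q i k)" for k
  have "act n m q (\<Sum>k=a..n+m. tgen k * tadj k) (ebas i) =
      (\<Sum>k=a..n+m. Poly_Mapping.single i (of_real (f k)))"
    unfolding act_sum
  proof (rule sum.cong)
    fix k assume "k \<in> {a..n+m}"
    with a show "act n m q (tgen k * tadj k) (ebas i) = Poly_Mapping.single i (of_real (f k))"
      by (subst act_tt'_same[OF i]) (auto simp: f_def)
  qed simp
  also have "\<dots> = Poly_Mapping.single i (of_real (\<Sum>k=a..n+m. f k))"
    by (rule sum_single)
  also have "(\<Sum>k=a..n+m. f k) = Q i a"
    using a(2)
  proof (induction a rule: inc_induct)
    case (step b)
    have "(\<Sum>k=b..n+m. f k) = f b + (\<Sum>k=Suc b..n+m. f k)"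
      using step(2) by (intro sum.atLeast_Suc_atMost) simp
    with step show ?case by (simp add: f_def)
  qed (simp add: f_def)
  finally show ?thesis .
qed

private lemma act_eqI:
  "act n m q l (ebas i) = Poly_Mapping.single i (of_real a) \<Longrightarrow>
   act n m q r (ebas i) = Poly_Mapping.single i (of_real b) \<Longrightarrow> a = b \<Longrightarrow>
   act n m q l (ebas i) = act n m q r (ebas i)"
  by simp

private lemma act_add_single: "act n m q l (ebas i) = Poly_Mapping.single i (of_real a) \<Longrightarrow>
   act n m q r (ebas i) = Poly_Mapping.single i (of_real b) \<Longrightarrow>
   act n m q (l + r) (ebas i) = Poly_Mapping.single i (of_real (a + b))"
  and act_diff_single: "act n m q l (ebas i) = Poly_Mapping.single i (of_real a) \<Longrightarrow>
   act n m q r (ebas i) = Poly_Mapping.single i (of_real b) \<Longrightarrow>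
   act n m q (l - r) (ebas i) = Poly_Mapping.single i (of_real (a - b))"
  and act_scale_single: "act n m q l (ebas i) = Poly_Mapping.single i (of_real a) \<Longrightarrow>
   act n m q (scale (of_real c) l) (ebas i) = Poly_Mapping.single i (of_real (c * a))"
  by (simp_all add: act_add act_diff act_scale single_add single_diff)

private lemma coef_eq: "complex_of_real q powi (-2) - 1 = of_real (q powi (-2) - 1)"
  by (simp add: of_real_power_int)

private lemma rel_high:
  assumes i: "i \<in> idx n m" and k: "n < k" "k \<le> n + m"
  shows "act n m q (tgen k * tadj k) (ebas i) =
    act n m q (tadj k * tgen k + scale (q powi (-2) - 1) (\<Sum>l=k+1..n+m. tgen l * tadj l)) (ebas i)"
proof -
  define x where "x = q powi (-2)"
  have k1: "1 \<le> k" using k by simp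
  note same = act_tt'_same[OF i k1 k(2)] act_t't_same[OF i k1 k(2), folded x_def]
  show ?thesis
  proof (cases "k = n + m")
    case True
    have "{k+1..n+m} = {}" using True by simp
    then have "act n m q (scale (q powi (-2) - 1) (\<Sum>l=k+1..n+m. tgen l * tadj l)) (ebas i) = 0"
      by (simp only: sum.empty scale_simps act_zero)
    moreover have "act n m q (tgen k * tadj k) (ebas i) = act n m q (tadj k * tgen k) (ebas i)"
      unfolding same using True m by simp
    ultimately show ?thesis by (simp only: act_add add_0_right)
  next
    case False
    then have k': "k < n + m" "n < k + 1" "k + 1 \<le> n + m" using k by auto
    have "act n m q (scale (q powi (-2) - 1) (\<Sum>l=k+1..n+m. tgen l * tadj l)) (ebas i) =
        Poly_Mapping.single i (of_real ((x - 1) * Q i (k + 1)))"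
      unfolding coef_eq x_def by (rule act_scale_single[OF act_sum_high[OF i k'(2,3)]])
    note eq = act_add_single[OF same(2) this]
    show ?thesis unfolding eq same using k k' by (simp add: left_diff_distrib)
  qed
qed

private lemma rel_low:
  assumes i: "i \<in> idx n m" and k: "1 \<le> k" "k \<le> n"
  shows "act n m q (tgen k * tadj k) (ebas i) =
    act n m q (tadj k * tgen k + scale (q powi (-2) - 1) (\<Sum>l=k+1..n. tgen l * tadj l)
      - scale (q powi (-2) - 1) (\<Sum>l=n+1..n+m. tgen l * tadj l)) (ebas i)"
proof -
  define x where "x = q powi (-2)"
  have k': "k \<le> n + m" "1 \<le> k + 1" "k + 1 \<le> Suc n" "n < n + 1" "n + 1 \<le> n + m"
    using k m by auto
  note same = act_tt'_same[OF i k(1) k'(1)] act_t't_same[OF i k(1) k'(1), folded x_def]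
  have 1: "act n m q (scale (q powi (-2) - 1) (\<Sum>l=k+1..n. tgen l * tadj l)) (ebas i) =
      Poly_Mapping.single i (of_real ((x - 1) * (Q i (Suc n) - Q i (k + 1))))"
    unfolding coef_eq x_def by (rule act_scale_single[OF act_sum_low[OF i k'(2,3)]])
  have 2: "act n m q (scale (q powi (-2) - 1) (\<Sum>l=n+1..n+m. tgen l * tadj l)) (ebas i) =
      Poly_Mapping.single i (of_real ((x - 1) * Q i (n + 1)))"
    unfolding coef_eq x_def by (rule act_scale_single[OF act_sum_high[OF i k'(4,5)]])
  note eq = act_diff_single[OF act_add_single[OF same(2) 1] 2]
  show ?thesis unfolding eq same using k by (simp add: left_diff_distrib right_diff_distrib)
qed

private lemma act_x_elem:
  assumes i: "i \<in> idx n m"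
  shows "act n m q (x_elem n m) (Poly_Mapping.single i c) =
    Poly_Mapping.single i (c * of_real (Q i (Suc n)))"
proof -
  have "act n m q (x_elem n m) (ebas i) = Poly_Mapping.single i (of_real (Q i (Suc n)))"
    unfolding x_elem_def Suc_eq_plus1 by (rule act_sum_high[OF i]) (use m in simp_all)
  then have "act n m q (x_elem n m) (scale c (ebas i)) =
      scale c (Poly_Mapping.single i (of_real (Q i (Suc n))))"
    unfolding act_scale_vec by (rule arg_cong)
  then show ?thesis unfolding scale_simps mult_1_right .
qed

private lemma rel_c:
  assumes i: "i \<in> idx n m"
  shows "act n m q (c_elem n m) (ebas i) = act n m q 1 (ebas i)"
proof -
  have 1: "Q i 1 = 1" by (simp add: Q_def Ssum_def)
  have low: "act n m q (\<Sum>k=1..n. tgen k * tadj k) (ebas i) =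
      Poly_Mapping.single i (of_real (Q i (Suc n) - 1))"
    by (rule act_sum_low[OF i, of 1, unfolded 1]) simp_all
  have high: "act n m q (\<Sum>k=n+1..n+m. tgen k * tadj k) (ebas i) =
      Poly_Mapping.single i (of_real (Q i (Suc n)))"
    unfolding Suc_eq_plus1 by (rule act_sum_high[OF i]) (use m in simp_all)
  show ?thesis
    unfolding c_elem_def act_add act_uminus low high act_one
    by (simp add: single_diff)
qed

private lemma rel_f0:
  assumes "(l, r) \<in> rels_f0 n m" and i: "i \<in> idx n m"
  shows "act n m q l (ebas i) = act n m q r (ebas i)"
proof -
  have Q1: "Q i (Suc n) = 1" if "\<forall>k\<in>{1..n}. i k = 0"
  proof -
    have "Ssum (Suc n) i = 0" unfolding Ssum_def using that by (intro sum.neutral) auto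
    then show ?thesis by (simp add: Q_def)
  qed
  have sh_zero: "(\<forall>k\<in>{1..n}. sh j c i k = 0) \<longleftrightarrow> (\<forall>k\<in>{1..n}. i k = 0)" if "n < j" for j c
    using that by (intro ball_cong) (auto simp: sh_other)
  have 1: "act n m q (tadj j * f0gen) (ebas i) = act n m q 0 (ebas i)" if "j \<in> {1..n}" for j
  proof (cases "\<forall>k\<in>{1..n}. i k = 0")
    case True
    with that have "rcf j (i j + 1) = 0" by (simp add: rcf_def)
    then show ?thesis
      unfolding act_mult act_f0_single act_t if_P[OF True] by simp
  next
    case False
    show ?thesis
      unfolding act_mult act_f0_single if_not_P[OF False] act_zero act_zero_vec ..
  qed
  have 2: "act n m q (f0gen * tgen j) (ebas i) = act n m q 0 (ebas i)" if "j \<in> {1..n}" for j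
  proof -
    have "i j \<le> 0" using idx_bounds(1)[OF i, of j] m that by auto
    then have "sh j (- 1) i j \<noteq> 0" using that m by (subst sh_at) auto
    with that have False: "\<not> (\<forall>k\<in>{1..n}. sh j (- 1) i k = 0)" by blast
    show ?thesis
      unfolding act_mult act_t act_f0_single if_not_P[OF False] act_zero ..
  qed
  have 3: "act n m q (x_elem n m * f0gen) (ebas i) = act n m q f0gen (ebas i)"
    "act n m q (f0gen * x_elem n m) (ebas i) = act n m q f0gen (ebas i)"
    "act n m q (f0gen * f0gen) (ebas i) = act n m q f0gen (ebas i)"
    "act n m q f0adj (ebas i) = act n m q f0gen (ebas i)"
  proof -
    show "act n m q f0adj (ebas i) = act n m q f0gen (ebas i)"
      unfolding act_f0_single ..
    have 0: "act n m q (x_elem n m) (ebas i) = ebas i" if "\<forall>k\<in>{1..n}. i k = 0"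
      unfolding act_x_elem[OF i] Q1[OF that] by simp
    have f0: "act n m q f0gen (ebas i) = ebas i" if "\<forall>k\<in>{1..n}. i k = 0"
      unfolding act_f0_single if_P[OF that] ..
    have f0': "act n m q f0gen (Poly_Mapping.single i c) = 0" if "\<not> (\<forall>k\<in>{1..n}. i k = 0)" for c
      unfolding act_f0_single if_not_P[OF that] ..
    show "act n m q (x_elem n m * f0gen) (ebas i) = act n m q f0gen (ebas i)"
      by (cases "\<forall>k\<in>{1..n}. i k = 0") (simp_all only: act_mult 0 f0 f0' act_zero_vec not_False_eq_True)
    show "act n m q (f0gen * x_elem n m) (ebas i) = act n m q f0gen (ebas i)"
    proof (cases "\<forall>k\<in>{1..n}. i k = 0")
      case True
      show ?thesis unfolding act_mult 0[OF True] ..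
    next
      case False
      show ?thesis unfolding act_mult act_x_elem[OF i] f0'[OF False] ..
    qed
    show "act n m q (f0gen * f0gen) (ebas i) = act n m q f0gen (ebas i)"
      by (cases "\<forall>k\<in>{1..n}. i k = 0") (simp_all only: act_mult f0 f0' act_zero_vec not_False_eq_True)
  qed
  have 4: "act n m q (tgen j * f0gen) (ebas i) = act n m q (f0gen * tgen j) (ebas i)"
    "act n m q (tadj j * f0gen) (ebas i) = act n m q (f0gen * tadj j) (ebas i)"
    if "j \<in> {n+1..n+m}" for j
  proof -
    have "n < j" using that by simp
    note sh = sh_zero[OF this]
    show "act n m q (tgen j * f0gen) (ebas i) = act n m q (f0gen * tgen j) (ebas i)"
    proof (cases "\<forall>k\<in>{1..n}. i k = 0")
      case True
      show ?thesis unfolding act_mult act_f0_single act_t sh if_P[OF True] ..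
    next
      case False
      show ?thesis unfolding act_mult act_f0_single act_t sh if_not_P[OF False] act_zero_vec ..
    qed
    show "act n m q (tadj j * f0gen) (ebas i) = act n m q (f0gen * tadj j) (ebas i)"
    proof (cases "\<forall>k\<in>{1..n}. i k = 0")
      case True
      show ?thesis unfolding act_mult act_f0_single act_t sh if_P[OF True] ..
    next
      case False
      show ?thesis unfolding act_mult act_f0_single act_t sh if_not_P[OF False] act_zero_vec ..
    qed
  qed
  from assms(1) show ?thesis
    unfolding rels_f0_def Un_iff insert_iff empty_iff mem_Collect_eq prod.inject
    by (elim disjE exE conjE) (simp_all only: 1 2 3 4)
qed

lemma act_fun_rels:
  assumes "(l, r) \<in> fun_rels n m q" and i: "i \<in> idx n m"
  shows "act n m q l (ebas i) = act n m q r (ebas i)"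
proof -
  consider "(l, r) \<in> rels_hat n m q" | "l = c_elem n m" "r = 1" | "(l, r) \<in> rels_f0 n m"
    using assms(1) by (auto simp: fun_rels_def rels_tilde_def)
  then show ?thesis
  proof cases
    case 1
    then show ?thesis
      unfolding rels_hat_def Un_iff mem_Collect_eq prod.inject
      by (elim disjE exE conjE) (simp_all only: rel_tt rel_tt' rel_high[OF i] rel_low[OF i] not_False_eq_True)
  qed (use rel_c[OF i] rel_f0[OF _ i] in blast)+
qed

end

subsection \<open>The representation descends to \<open>Fun_tilde\<close>\<close>

lemma gen_carrier [simp]:
  "x \<in> X \<Longrightarrow> Poly_Mapping.keys (gen x) \<subseteq> words_over X"
  "x \<in> X \<Longrightarrow> Poly_Mapping.keys (adj x) \<subseteq> words_over X"
  by (auto simp: gen_def adj_def)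

lemma sum_carrier:
  fixes f :: "'k \<Rightarrow> 'x free_star"
  shows "(\<And>k. k \<in> A \<Longrightarrow> Poly_Mapping.keys (f k) \<subseteq> words_over X) \<Longrightarrow>
    Poly_Mapping.keys (sum f A) \<subseteq> words_over X"
  by (induction A rule: infinite_finite_induct) (simp_all add: free_star_alg_closed)

lemma fun_rels_carrier:
  assumes "(l, r) \<in> fun_rels n m q"
  shows "l - r \<in> carrier (free_star_alg (hgens n m))"
proof -
  have g: "1 \<le> j \<Longrightarrow> j \<le> n + m \<Longrightarrow> TG j \<in> hgens n m" "F0 \<in> hgens n m" for j
    by (auto simp: hgens_def)
  have s: "1 \<le> a \<Longrightarrow> b \<le> n + m \<Longrightarrow>
      Poly_Mapping.keys (\<Sum>k=a..b. tgen k * tadj k) \<subseteq> words_over (hgens n m)" for a b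
    by (rule sum_carrier) (simp add: g free_star_alg_closed)
  have "Poly_Mapping.keys l \<subseteq> words_over (hgens n m) \<and> Poly_Mapping.keys r \<subseteq> words_over (hgens n m)"
    using assms
    unfolding fun_rels_def rels_tilde_def rels_hat_def rels_f0_def Un_iff insert_iff empty_iff
      mem_Collect_eq prod.inject c_elem_def x_elem_def
    by (elim disjE exE conjE)
      (simp_all add: g s free_star_alg_closed scale_closed del: One_nat_def)
  then show ?thesis by (simp add: free_star_alg_closed(2))
qed

abbreviation fun_ideal :: "nat \<Rightarrow> nat \<Rightarrow> real \<Rightarrow> hgen free_star set" where
  "fun_ideal n m q \<equiv> star_ideal (hgens n m) (fun_rels n m q)"

lemma fun_ideal_ideal: "ideal (fun_ideal n m q) (free_star_alg (hgens n m))"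
  by (rule star_ideal_ideal) (rule fun_rels_carrier)

lemma act_fun_ideal:
  assumes q: "0 < q" "q < 1" and m: "m \<ge> 1"
    and a: "a \<in> fun_ideal n m q" and v: "v \<in> Hspace n m"
  shows "act n m q a v = 0"
proof -
  let ?K = "{a \<in> carrier (free_star_alg (hgens n m)). \<forall>v\<in>Hspace n m. act n m q a v = 0}"
  have K: "ideal ?K (free_star_alg (hgens n m))"
  proof (rule ideal_free_star_algI)
    fix a x assume "a \<in> ?K" "x \<in> carrier (free_star_alg (hgens n m))"
    then show "a * x \<in> ?K"
      using act_Hspace[OF m, of _ n x q] by (simp add: act_mult free_star_alg_closed)
  next
    show "?K \<subseteq> carrier (free_star_alg (hgens n m))" by blast
  qed (simp_all add: act_add act_uminus act_mult free_star_alg_closed)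
  have "l - r \<in> ?K \<and> star (l - r) \<in> ?K" if lr: "(l, r) \<in> fun_rels n m q" for l r
  proof -
    note c = fun_rels_carrier[OF lr]
    have 0: "act n m q (l - r) v = 0" if "v \<in> Hspace n m" for v
      using that by (rule act_eq_0_Hspace) (simp add: act_diff act_fun_rels[OF q m lr])
    have c': "star (l - r) \<in> carrier (free_star_alg (hgens n m))"
      using c star_carrier by simp
    have "act n m q (star (l - r)) v = 0" if v: "v \<in> Hspace n m" for v
    proof -
      let ?w = "act n m q (star (l - r)) v"
      have "?w \<in> Hspace n m" by (rule act_Hspace[OF m v c'])
      then have "hinner ?w ?w = 0"
        by (simp only: act_adjoint star_star 0 hinner_zero)
      then show ?thesis by (simp only: hinner_self_eq_0)
    qed
    with 0 c c' show ?thesis by simp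
  qed
  then have "fun_ideal n m q \<subseteq> ?K" by (intro star_ideal_minimal[OF K])
  with a v show ?thesis by blast
qed

lemma rep_fun_cls:
  assumes "0 < q" "q < 1" "m \<ge> 1" "v \<in> Hspace n m"
  shows "rep n m q (fun_cls n m q a) v = act n m q a v"
proof -
  have "(\<lambda>b. act n m q b v) ` fun_cls n m q a = {act n m q a v}"
  proof -
    have "0 \<in> fun_ideal n m q"
      using additive_subgroup.zero_closed[OF ideal.axioms(1)[OF fun_ideal_ideal]] by simp
    then show ?thesis
      using act_fun_ideal[OF assms(1-3) _ assms(4)] by (force simp: cls_eq act_add)
  qed
  then show ?thesis by (simp add: rep_def)
qed

lemma carrier_Fun_tilde:
  "carrier (Fun_tilde n m q) = fun_cls n m q ` carrier (free_star_alg (hgens n m))"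
  by (simp add: Fun_tilde_def carrier_presented del: free_star_alg_simps)

lemma ring_Fun_tilde: "ring (Fun_tilde n m q)"
  unfolding Fun_tilde_def presented_def by (rule ideal.quotient_is_ring[OF fun_ideal_ideal])

lemma fun_cls_hom: "fun_cls n m q \<in> ring_hom (free_star_alg (hgens n m)) (Fun_tilde n m q)"
  using ideal.rcos_ring_hom[OF fun_ideal_ideal]
  unfolding Fun_tilde_def presented_def cls_def .

lemma rep_hom:
  assumes "0 < q" "q < 1" "m \<ge> 1" "v \<in> Hspace n m"
    and "f \<in> carrier (Fun_tilde n m q)" "g \<in> carrier (Fun_tilde n m q)"
  shows "rep n m q (f \<otimes>\<^bsub>Fun_tilde n m q\<^esub> g) v = rep n m q f (rep n m q g v)"
    and "rep n m q (f \<oplus>\<^bsub>Fun_tilde n m q\<^esub> g) v = rep n m q f v + rep n m q g v"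
    and "rep n m q \<one>\<^bsub>Fun_tilde n m q\<^esub> v = v"
proof -
  obtain a b where ab: "a \<in> carrier (free_star_alg (hgens n m))" "f = fun_cls n m q a"
    "b \<in> carrier (free_star_alg (hgens n m))" "g = fun_cls n m q b"
    using assms(5,6) unfolding carrier_Fun_tilde by blast
  note h = fun_cls_hom[of n m q]
  have "f \<otimes>\<^bsub>Fun_tilde n m q\<^esub> g = fun_cls n m q (a * b)"
    using ring_hom_mult[OF h ab(1,3)] ab by simp
  then show "rep n m q (f \<otimes>\<^bsub>Fun_tilde n m q\<^esub> g) v = rep n m q f (rep n m q g v)"
    using ab(2,4) by (simp add: rep_fun_cls[OF assms(1-3)] assms(4) act_mult
        act_Hspace[OF assms(3,4) ab(3)])
  have "f \<oplus>\<^bsub>Fun_tilde n m q\<^esub> g = fun_cls n m q (a + b)"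
    using ring_hom_add[OF h ab(1,3)] ab by simp
  then show "rep n m q (f \<oplus>\<^bsub>Fun_tilde n m q\<^esub> g) v = rep n m q f v + rep n m q g v"
    using ab(2,4) by (simp add: rep_fun_cls[OF assms(1-4)] act_add)
  have "\<one>\<^bsub>Fun_tilde n m q\<^esub> = fun_cls n m q 1"
    using ring_hom_one[OF h] by simp
  then show "rep n m q \<one>\<^bsub>Fun_tilde n m q\<^esub> v = v"
    by (simp add: rep_fun_cls[OF assms(1-4)])
qed


subsection \<open>The automorphisms \<open>rot\<close> and the ideal \<open>D_H\<close>\<close>

definition rot_word :: "real \<Rightarrow> hgen fword \<Rightarrow> complex" where
  "rot_word \<phi> w = prod_list (map (rot_letter \<phi>) (letters w))"

lemma rot_free_eq: "rot_free \<phi> = lin (\<lambda>w. Poly_Mapping.single w (rot_word \<phi> w))"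
  by (simp add: rot_free_def rot_word_def)

lemma rot_word_simps [simp]:
  "rot_word \<phi> (u + v) = rot_word \<phi> u * rot_word \<phi> v" "rot_word \<phi> 0 = 1"
  by (simp_all add: rot_word_def plus_fword_def zero_fword_def)

lemma rot_letter_minus: "rot_letter \<phi> x * rot_letter (- \<phi>) x = 1"
  by (cases "(\<phi>, x)" rule: rot_letter.cases) (simp_all add: cis_mult cis_cnj)

lemma rot_word_minus: "rot_word \<phi> w * rot_word (- \<phi>) w = 1"
proof (cases w)
  case (FWord xs)
  have "prod_list (map (rot_letter \<phi>) xs) * prod_list (map (rot_letter (- \<phi>)) xs) = 1"
  proof (induction xs)
    case (Cons x xs)
    then have "(rot_letter \<phi> x * rot_letter (- \<phi>) x) *
        (prod_list (map (rot_letter \<phi>) xs) * prod_list (map (rot_letter (- \<phi>)) xs)) = 1"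
      by (simp only: rot_letter_minus mult_1)
    then show ?case by (simp only: list.map prod_list.Cons mult_ac)
  qed simp
  then show ?thesis by (simp add: FWord rot_word_def)
qed

lemma rot_free_simps [simp]:
  "rot_free \<phi> (a + b) = rot_free \<phi> a + rot_free \<phi> b"
  "rot_free \<phi> (- a) = - rot_free \<phi> a" "rot_free \<phi> (a - b) = rot_free \<phi> a - rot_free \<phi> b"
  "rot_free \<phi> (scale c a) = scale c (rot_free \<phi> a)" "rot_free \<phi> 0 = 0"
  "rot_free \<phi> (sum f A) = (\<Sum>x\<in>A. rot_free \<phi> (f x))"
  by (simp_all add: rot_free_eq lin_add lin_uminus lin_diff lin_scale lin_sum)

lemma rot_free_single: "rot_free \<phi> (Poly_Mapping.single w c) = Poly_Mapping.single w (c * rot_word \<phi> w)"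
  by (simp add: rot_free_eq)

lemma rot_free_one [simp]: "rot_free \<phi> 1 = 1"
  using rot_free_single[of \<phi> 0 1] by simp

lemma rot_free_gen [simp]:
  "rot_free \<phi> (tgen j) = scale (cis \<phi>) (tgen j)"
  "rot_free \<phi> (tadj j) = scale (cnj (cis \<phi>)) (tadj j)"
  "rot_free \<phi> f0gen = f0gen" "rot_free \<phi> f0adj = f0adj"
  by (simp_all add: gen_def adj_def rot_free_single rot_word_def)

lemma rot_free_mult [simp]: "rot_free \<phi> (a * b) = rot_free \<phi> a * rot_free \<phi> b"
proof -
  have "Poly_Mapping.keys a \<subseteq> UNIV" "Poly_Mapping.keys b \<subseteq> UNIV" by simp_all
  then show ?thesis
  proof (induction a rule: poly_mapping_induct_on)
    case (single k c)
    from this(2) show ?case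
    proof (induction b rule: poly_mapping_induct_on)
      case (single l d)
      show ?case by (simp add: rot_free_single mult_single mult_ac)
    qed (simp_all add: distrib_left)
  qed (simp_all add: distrib_right)
qed

lemma rot_free_inverse: "rot_free \<phi> (rot_free (- \<phi>) a) = a"
proof -
  have "Poly_Mapping.keys a \<subseteq> UNIV" by simp
  then show ?thesis
  proof (induction a rule: poly_mapping_induct_on)
    case (single k c)
    have "rot_word (- \<phi>) k * rot_word \<phi> k = 1" using rot_word_minus[of \<phi> k] by (simp add: mult.commute)
    then show ?case by (simp add: rot_free_single mult.assoc)
  qed simp_all
qed

lemma rot_free_carrier:
  "Poly_Mapping.keys a \<subseteq> words_over X \<Longrightarrow> Poly_Mapping.keys (rot_free \<phi> a) \<subseteq> words_over X"
  unfolding rot_free_eq by (rule keys_lin) auto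

lemma star_rot_free: "star (rot_free \<phi> a) = rot_free \<phi> (star a)"
proof -
  have letter: "cnj (rot_letter \<phi> x) = rot_letter \<phi> (star_letter x)" for x
    by (cases "(\<phi>, x)" rule: rot_letter.cases) simp_all
  have word: "cnj (rot_word \<phi> w) = rot_word \<phi> (star_word w)" for w
  proof (cases w)
    case (FWord xs)
    show ?thesis unfolding FWord
      by (induction xs) (simp_all add: rot_word_def star_word_def letter mult.commute)
  qed
  have "Poly_Mapping.keys a \<subseteq> UNIV" by simp
  then show ?thesis
    by (induction a rule: poly_mapping_induct_on) (simp_all add: star_add rot_free_single word)
qed

lemma scale_diff: "scale c (a - b) = scale c a - scale c b"
  by (rule poly_mapping_eqI) (simp add: lookup_minus right_diff_distrib)

lemma rot_fun_rels:
  assumes "(l, r) \<in> fun_rels n m q"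
  shows "\<exists>c. rot_free \<phi> (l - r) = scale c (l - r)"
proof -
  have u: "cis \<phi> * cnj (cis \<phi>) = 1" "cnj (cis \<phi>) * cis \<phi> = 1"
    by (simp_all add: cis_cnj cis_mult)
  have tt: "rot_free \<phi> (tgen i * tgen j) = scale (cis \<phi> * cis \<phi>) (tgen i * tgen j)"
    "rot_free \<phi> (tgen i * tadj j) = tgen i * tadj j"
    "rot_free \<phi> (tadj i * tgen j) = tadj i * tgen j" for i j
    by (simp_all only: rot_free_mult rot_free_gen scale_mult[symmetric] scale_simps u)
  have f: "rot_free \<phi> (tgen j * f0gen) = scale (cis \<phi>) (tgen j * f0gen)"
    "rot_free \<phi> (f0gen * tgen j) = scale (cis \<phi>) (f0gen * tgen j)"
    "rot_free \<phi> (tadj j * f0gen) = scale (cnj (cis \<phi>)) (tadj j * f0gen)"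
    "rot_free \<phi> (f0gen * tadj j) = scale (cnj (cis \<phi>)) (f0gen * tadj j)" for j
    by (simp_all only: rot_free_mult rot_free_gen scale_mult[symmetric])
  have x: "rot_free \<phi> (x_elem n m) = x_elem n m"
    by (simp only: x_elem_def rot_free_simps tt)
  have xf: "rot_free \<phi> (x_elem n m * f0gen) = x_elem n m * f0gen"
    "rot_free \<phi> (f0gen * x_elem n m) = f0gen * x_elem n m"
    "rot_free \<phi> (f0gen * f0gen) = f0gen * f0gen"
    by (simp_all only: rot_free_mult rot_free_gen x)
  have "rot_free \<phi> (l - r) = l - r \<or> rot_free \<phi> (l - r) = scale (cis \<phi>) (l - r) \<or>
      rot_free \<phi> (l - r) = scale (cnj (cis \<phi>)) (l - r) \<or>
      rot_free \<phi> (l - r) = scale (cis \<phi> * cis \<phi>) (l - r)"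
    using assms
    unfolding fun_rels_def rels_tilde_def rels_hat_def rels_f0_def Un_iff insert_iff empty_iff
      mem_Collect_eq prod.inject c_elem_def
    by (elim disjE exE conjE)
      (simp_all only: rot_free_simps tt f xf rot_free_gen rot_free_one scale_diff scale_simps
        mult.commute[of _ "complex_of_real q"] mult.assoc diff_0_right simp_thms)
  then show ?thesis by (metis scale_simps(2))
qed

lemma scale_ideal:
  assumes "ideal J (free_star_alg X)" "a \<in> J"
  shows "scale c a \<in> J"
proof -
  interpret J: ideal J "free_star_alg X" by fact
  have "scale c 1 * a \<in> J"
    using J.I_l_closed[OF assms(2), of "scale c 1"] by (simp add: scale_closed)
  then show ?thesis by (simp flip: scale_mult)
qed

lemma rot_fun_ideal:
  assumes "a \<in> fun_ideal n m q"
  shows "rot_free \<phi> a \<in> fun_ideal n m q"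
proof -
  note J = fun_ideal_ideal[of n m q]
  interpret J: ideal "fun_ideal n m q" "free_star_alg (hgens n m)" by (rule J)
  let ?K = "{a \<in> fun_ideal n m q. rot_free \<phi> a \<in> fun_ideal n m q}"
  have carr: "Poly_Mapping.keys b \<subseteq> words_over (hgens n m)" if "b \<in> fun_ideal n m q" for b
    using J.a_Hcarr[OF that] by simp
  have zero: "0 \<in> fun_ideal n m q"
    using additive_subgroup.zero_closed[OF J.is_additive_subgroup] by simp
  have add: "b + d \<in> fun_ideal n m q" if "b \<in> fun_ideal n m q" "d \<in> fun_ideal n m q" for b d
    using additive_subgroup.a_closed[OF J.is_additive_subgroup that] by simp
  have uminus: "- b \<in> fun_ideal n m q" if "b \<in> fun_ideal n m q" for b
  proof -
    have "scale (- 1) b = - b" by (rule poly_mapping_eqI) simp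
    then show ?thesis using scale_ideal[OF J that, of "- 1"] by simp
  qed
  have mult: "x * b \<in> fun_ideal n m q" "b * x \<in> fun_ideal n m q"
    if "b \<in> fun_ideal n m q" "Poly_Mapping.keys x \<subseteq> words_over (hgens n m)" for b x
    using J.I_l_closed[OF that(1), of x] J.I_r_closed[OF that(1), of x] that(2) by simp_all
  have K: "ideal ?K (free_star_alg (hgens n m))"
  proof (rule ideal_free_star_algI)
    show "?K \<subseteq> carrier (free_star_alg (hgens n m))" using carr by auto
  qed (simp_all add: zero add mult uminus rot_free_carrier)
  have "l - r \<in> ?K \<and> star (l - r) \<in> ?K" if lr: "(l, r) \<in> fun_rels n m q" for l r
  proof -
    obtain c where c: "rot_free \<phi> (l - r) = scale c (l - r)" using rot_fun_rels[OF lr] by blast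
    have 1: "l - r \<in> fun_ideal n m q" "star (l - r) \<in> fun_ideal n m q"
      using star_ideal_contains[OF fun_rels_carrier lr] by simp_all
    have 2: "rot_free \<phi> (l - r) \<in> fun_ideal n m q"
      unfolding c by (rule scale_ideal[OF J 1(1)])
    then have "star (rot_free \<phi> (l - r)) \<in> fun_ideal n m q"
      by (rule star_ideal_star[rotated]) (rule fun_rels_carrier)
    then have "rot_free \<phi> (star (l - r)) \<in> fun_ideal n m q"
      by (simp only: star_rot_free)
    with 1 2 show ?thesis by blast
  qed
  then have "fun_ideal n m q \<subseteq> ?K" by (intro star_ideal_minimal[OF K])
  with assms show ?thesis by blast
qed

lemma rot_fun_cls: "rot \<phi> (fun_cls n m q a) = fun_cls n m q (rot_free \<phi> a)"
proof -
  have "\<exists>k. j + rot_free \<phi> a = rot_free \<phi> (k + a) \<and> k \<in> fun_ideal n m q"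
    if "j \<in> fun_ideal n m q" for j
    using rot_fun_ideal[OF that, of "- \<phi>"]
    by (intro exI[of _ "rot_free (- \<phi>) j"]) (simp add: rot_free_inverse)
  then show ?thesis
    unfolding rot_def cls_eq using rot_fun_ideal by (fastforce simp: image_iff)
qed

lemma rot_hom: "rot \<phi> \<in> ring_hom (Fun_tilde n m q) (Fun_tilde n m q)"
proof (rule ring_hom_memI)
  note h = fun_cls_hom[of n m q]
  have carr: "rot_free \<phi> a \<in> carrier (free_star_alg (hgens n m))"
    if "a \<in> carrier (free_star_alg (hgens n m))" for a
    using that rot_free_carrier by simp
  fix f assume "f \<in> carrier (Fun_tilde n m q)"
  then obtain a where a: "a \<in> carrier (free_star_alg (hgens n m))" "f = fun_cls n m q a"
    unfolding carrier_Fun_tilde by blast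
  show "rot \<phi> f \<in> carrier (Fun_tilde n m q)"
    unfolding a(2) rot_fun_cls carrier_Fun_tilde using carr[OF a(1)] by blast
  fix g assume "g \<in> carrier (Fun_tilde n m q)"
  then obtain b where b: "b \<in> carrier (free_star_alg (hgens n m))" "g = fun_cls n m q b"
    unfolding carrier_Fun_tilde by blast
  show "rot \<phi> (f \<otimes>\<^bsub>Fun_tilde n m q\<^esub> g) = rot \<phi> f \<otimes>\<^bsub>Fun_tilde n m q\<^esub> rot \<phi> g"
  proof -
    have "f \<otimes>\<^bsub>Fun_tilde n m q\<^esub> g = fun_cls n m q (a * b)"
      using ring_hom_mult[OF h a(1) b(1)] a b by simp
    then have "rot \<phi> (f \<otimes>\<^bsub>Fun_tilde n m q\<^esub> g) = fun_cls n m q (rot_free \<phi> a * rot_free \<phi> b)"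
      by (simp only: rot_fun_cls rot_free_mult rot_free_simps)
    also have "\<dots> = rot \<phi> f \<otimes>\<^bsub>Fun_tilde n m q\<^esub> rot \<phi> g"
      using ring_hom_mult[OF h carr[OF a(1)] carr[OF b(1)]] a b by (simp add: rot_fun_cls)
    finally show ?thesis .
  qed
  show "rot \<phi> (f \<oplus>\<^bsub>Fun_tilde n m q\<^esub> g) = rot \<phi> f \<oplus>\<^bsub>Fun_tilde n m q\<^esub> rot \<phi> g"
  proof -
    have "f \<oplus>\<^bsub>Fun_tilde n m q\<^esub> g = fun_cls n m q (a + b)"
      using ring_hom_add[OF h a(1) b(1)] a b by simp
    then have "rot \<phi> (f \<oplus>\<^bsub>Fun_tilde n m q\<^esub> g) = fun_cls n m q (rot_free \<phi> a + rot_free \<phi> b)"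
      by (simp only: rot_fun_cls rot_free_mult rot_free_simps)
    also have "\<dots> = rot \<phi> f \<oplus>\<^bsub>Fun_tilde n m q\<^esub> rot \<phi> g"
      using ring_hom_add[OF h carr[OF a(1)] carr[OF b(1)]] a b by (simp add: rot_fun_cls)
    finally show ?thesis .
  qed
next
  have "\<one>\<^bsub>Fun_tilde n m q\<^esub> = fun_cls n m q 1"
    using ring_hom_one[OF fun_cls_hom[of n m q]] by simp
  then show "rot \<phi> \<one>\<^bsub>Fun_tilde n m q\<^esub> = \<one>\<^bsub>Fun_tilde n m q\<^esub>"
    by (simp add: rot_fun_cls)
qed

lemma subring_invariants:
  "subring {f \<in> carrier (Fun_tilde n m q). \<forall>\<phi>. rot \<phi> f = f} (Fun_tilde n m q)"
proof -
  interpret R: ring "Fun_tilde n m q" by (rule ring_Fun_tilde)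
  interpret h: ring_hom_ring "Fun_tilde n m q" "Fun_tilde n m q" "rot \<phi>" for \<phi>
    by (rule ring_hom_ringI2[OF ring_Fun_tilde ring_Fun_tilde rot_hom])
  show ?thesis by (rule R.subringI) auto
qed

lemma ring_Fun_H: "ring (Fun_H n m q)"
  unfolding Fun_H_def by (rule ring.subring_is_ring[OF ring_Fun_tilde subring_invariants])

lemma D_H_ideal: "ideal (D_H n m q) (Fun_H n m q)"
  unfolding D_H_def
proof (rule ring.genideal_ideal[OF ring_Fun_H])
  have "f0gen \<in> carrier (free_star_alg (hgens n m))" by (simp add: hgens_def)
  then show "{fun_cls n m q f0gen} \<subseteq> carrier (Fun_H n m q)"
    by (simp add: Fun_H_def carrier_Fun_tilde rot_fun_cls del: free_star_alg_simps)
qed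

end

theory Submission
  imports Defs
begin

text \<open>
  Put \<open>Q\<^sub>j = t\<^sub>j t\<^sub>j\<^sup>* + \<dots> + t\<^sub>N t\<^sub>N\<^sup>*\<close> for \<open>j > n\<close>, and
  \<open>Q\<^sub>j = x\<^bsub>n+1\<^esub> - t\<^sub>j t\<^sub>j\<^sup>* - \<dots> - t\<^sub>n t\<^sub>n\<^sup>*\<close> for \<open>j \<le> n\<close>. These elements commute with each other
  and commute up to nonzero scalars with all letters, \<open>Q\<^sub>j f\<^sub>0 = f\<^sub>0\<close> for \<open>j \<le> n + 1\<close>, and
  \<open>t\<^sub>j t\<^sub>j\<^sup>*\<close>, \<open>t\<^sub>j\<^sup>* t\<^sub>j\<close> are linear combinations of \<open>Q\<^sub>j\<close> and \<open>Q\<^bsub>j+1\<^esub>\<close>. Hence the two-sided ideal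
  generated by \<open>f\<^sub>0\<close> is spanned by the products \<open>t\<^sup>\<lambda> Q\<^sup>c f\<^sub>0 (t\<^sup>\<mu>)\<^sup>*\<close>, where \<open>t\<^sup>\<lambda>\<close> is an ordered
  product of powers of \<open>t\<^sub>j\<close> or \<open>t\<^sub>j\<^sup>*\<close>, \<open>c\<close> is supported on \<open>{n+2..N}\<close>, and \<open>\<mu> \<ge> 0\<close> on \<open>{1..n}\<close>.

  Such a product maps basis vectors to multiples of basis vectors. Source and target determine
  \<open>\<mu>\<close> and \<open>\<lambda>\<^sub>1, \<dots>, \<lambda>\<^bsub>N-1\<^esub>\<close>. For these fixed, the coefficients are, up to a common nonzero factor,
  characters of the semigroup of pairs of an angle (acting by the rotation, which fixes the given
  element) and a multi-index, and different \<open>(\<lambda>\<^sub>N, c)\<close> give different characters. Independence of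
  characters then shows that an invariant element annihilated by the representation vanishes.
\<close>

section \<open>Restriction of the alphabet\<close>

text \<open>
  Killing the letters outside \<open>X\<close> extends the defining ideal to an ideal of the whole type of
  finitely supported functions on words, so that congruences need no carrier conditions.
\<close>

definition restr :: "'x set \<Rightarrow> 'x free_star \<Rightarrow> 'x free_star" where
  "restr X = lin (\<lambda>w. if w \<in> words_over X then Poly_Mapping.single w 1 else 0)"

lemma words_over_add_iff: "u + v \<in> words_over X \<longleftrightarrow> u \<in> words_over X \<and> v \<in> words_over X"
  by (auto simp: words_over_def plus_fword_def)

lemma restr_single:
  "restr X (Poly_Mapping.single w c) = (if w \<in> words_over X then Poly_Mapping.single w c else 0)"
  by (simp add: restr_def)

lemma restr_linear [simp]:
  "restr X (a + b) = restr X a + restr X b" "restr X (a - b) = restr X a - restr X b"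
  "restr X (- a) = - restr X a" "restr X 0 = 0" "restr X (scale c a) = scale c (restr X a)"
  by (simp_all add: restr_def lin_add lin_diff lin_uminus lin_scale)

lemma restr_keys: "Poly_Mapping.keys (restr X a) \<subseteq> words_over X"
  unfolding restr_def by (rule keys_lin[of _ UNIV]) auto

lemma restr_id: "Poly_Mapping.keys a \<subseteq> words_over X \<Longrightarrow> restr X a = a"
  by (induction a rule: poly_mapping_induct_on) (auto simp: restr_single)

lemma restr_mult [simp]: "restr X (a * b) = restr X a * restr X b"
proof -
  have "Poly_Mapping.keys a \<subseteq> UNIV" "Poly_Mapping.keys b \<subseteq> UNIV" by simp_all
  then show ?thesis
  proof (induction a rule: poly_mapping_induct_on)
    case (single k c)
    from this(2) show ?case
      by (induction b rule: poly_mapping_induct_on)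
        (auto simp: distrib_left mult_single restr_single words_over_add_iff)
  qed (simp_all add: distrib_right)
qed

lemma restr_star [simp]: "restr X (star a) = star (restr X a)"
proof -
  have "Poly_Mapping.keys a \<subseteq> UNIV" by simp
  then show ?thesis
    by (induction a rule: poly_mapping_induct_on) (auto simp: star_add restr_single)
qed

lemma star_scale: "star (scale c a) = scale (cnj c) (star a)"
proof -
  have "Poly_Mapping.keys a \<subseteq> UNIV" by simp
  then show ?thesis
    by (induction a rule: poly_mapping_induct_on) (auto simp: star_add scale_add)
qed

lemma star_diff: "star (a - b) = star a - star b"
  using star_add[of a "- b"] by (simp add: star_uminus)

lemma star_sum: "star (sum f A) = (\<Sum>x\<in>A. star (f x))"
  by (induction A rule: infinite_finite_induct) (auto simp: star_add)

lemmas scale_pull = scale_mult[symmetric]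


section \<open>Congruence modulo the defining relations\<close>

locale hyperbolic =
  fixes n m :: nat and q :: real
  assumes q0: "0 < q" and q1: "q < 1" and m0: "1 \<le> m"
begin

definition eqv :: "hgen free_star \<Rightarrow> hgen free_star \<Rightarrow> bool" (infix "\<approx>" 50) where
  "a \<approx> b \<longleftrightarrow> restr (hgens n m) (a - b) \<in> fun_ideal n m q"

lemma fun_ideal_closed:
  shows fun_ideal_zero: "0 \<in> fun_ideal n m q"
    and fun_ideal_add: "a \<in> fun_ideal n m q \<Longrightarrow> b \<in> fun_ideal n m q \<Longrightarrow> a + b \<in> fun_ideal n m q"
    and fun_ideal_scale: "a \<in> fun_ideal n m q \<Longrightarrow> scale c a \<in> fun_ideal n m q"
    and fun_ideal_mult:
      "a \<in> fun_ideal n m q \<Longrightarrow> Poly_Mapping.keys b \<subseteq> words_over (hgens n m) \<Longrightarrow> a * b \<in> fun_ideal n m q"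
      "a \<in> fun_ideal n m q \<Longrightarrow> Poly_Mapping.keys b \<subseteq> words_over (hgens n m) \<Longrightarrow> b * a \<in> fun_ideal n m q"
proof -
  interpret J: ideal "fun_ideal n m q" "free_star_alg (hgens n m)" by (rule fun_ideal_ideal)
  show "0 \<in> fun_ideal n m q"
    using additive_subgroup.zero_closed[OF J.is_additive_subgroup] by simp
  show "a \<in> fun_ideal n m q \<Longrightarrow> b \<in> fun_ideal n m q \<Longrightarrow> a + b \<in> fun_ideal n m q"
    using additive_subgroup.a_closed[OF J.is_additive_subgroup, of a b] by simp
  show "a \<in> fun_ideal n m q \<Longrightarrow> scale c a \<in> fun_ideal n m q"
    by (rule scale_ideal[OF fun_ideal_ideal])
  show "a \<in> fun_ideal n m q \<Longrightarrow> Poly_Mapping.keys b \<subseteq> words_over (hgens n m) \<Longrightarrow> a * b \<in> fun_ideal n m q"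
    "a \<in> fun_ideal n m q \<Longrightarrow> Poly_Mapping.keys b \<subseteq> words_over (hgens n m) \<Longrightarrow> b * a \<in> fun_ideal n m q"
    using J.I_l_closed[of a b] J.I_r_closed[of a b] by simp_all
qed

lemma eqv_refl [simp]: "a \<approx> a"
  by (simp add: eqv_def fun_ideal_zero)

lemma eqv_scale: "a \<approx> b \<Longrightarrow> scale c a \<approx> scale c b"
  unfolding eqv_def scale_diff[symmetric] restr_linear(5) by (rule fun_ideal_scale)

lemma eqv_sym: "a \<approx> b \<Longrightarrow> b \<approx> a"
proof -
  assume "a \<approx> b"
  then have "scale (- 1) (restr (hgens n m) (a - b)) \<in> fun_ideal n m q"
    unfolding eqv_def by (rule fun_ideal_scale)
  also have "scale (- 1) (restr (hgens n m) (a - b)) = restr (hgens n m) (b - a)"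
    by (rule poly_mapping_eqI) (simp add: lookup_minus)
  finally show ?thesis unfolding eqv_def .
qed

lemma eqv_trans [trans]: "a \<approx> b \<Longrightarrow> b \<approx> c \<Longrightarrow> a \<approx> c"
  unfolding eqv_def using fun_ideal_add[of "restr (hgens n m) (a - b)" "restr (hgens n m) (b - c)"]
  by simp

lemma eqv_add: "a \<approx> b \<Longrightarrow> c \<approx> d \<Longrightarrow> a + c \<approx> b + d"
  unfolding eqv_def using fun_ideal_add[of "restr (hgens n m) (a - b)" "restr (hgens n m) (c - d)"]
  by (simp add: algebra_simps)

lemma eqv_uminus: "a \<approx> b \<Longrightarrow> - a \<approx> - b"
  using eqv_sym[of a b] unfolding eqv_def by simp

lemma eqv_diff: "a \<approx> b \<Longrightarrow> c \<approx> d \<Longrightarrow> a - c \<approx> b - d"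
  using eqv_add[OF _ eqv_uminus, of a b c d] by simp

lemma eqv_mult: "a \<approx> b \<Longrightarrow> c \<approx> d \<Longrightarrow> a * c \<approx> b * d"
proof -
  assume *: "a \<approx> b" "c \<approx> d"
  let ?r = "restr (hgens n m)"
  have "?r (a - b) * ?r c + ?r b * ?r (c - d) \<in> fun_ideal n m q"
    using * unfolding eqv_def by (intro fun_ideal_add fun_ideal_mult restr_keys)
  then show ?thesis by (simp add: eqv_def algebra_simps)
qed

lemma eqv_mult_left: "c \<approx> d \<Longrightarrow> a * c \<approx> a * d"
  and eqv_mult_right: "a \<approx> b \<Longrightarrow> a * c \<approx> b * c"
  by (simp_all add: eqv_mult)

lemma eqv_star: "a \<approx> b \<Longrightarrow> star a \<approx> star b"
  unfolding eqv_def star_diff[symmetric] restr_star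
  by (rule star_ideal_star[OF fun_rels_carrier])

lemma eqv_rel: "(l, r) \<in> fun_rels n m q \<Longrightarrow> l \<approx> r"
  using fun_rels_carrier[of l r n m q] star_ideal_contains(1)[OF fun_rels_carrier]
  by (simp add: eqv_def restr_id del: restr_linear(2))

text \<open>Restriction deletes these letters. Inductions over arbitrary words, as in
  \<open>lspan_mult\<close>, can therefore treat them as zero instead of excluding them.\<close>

lemma eqv_outside: "j \<notin> {1..n+m} \<Longrightarrow> tgen j \<approx> 0" "j \<notin> {1..n+m} \<Longrightarrow> tadj j \<approx> 0"
  using fun_ideal_zero
  by (auto simp: eqv_def restr_single gen_def adj_def hgens_def image_iff simp del: One_nat_def)

lemma eqv_cls:
  assumes "a \<in> carrier (free_star_alg (hgens n m))" "b \<in> carrier (free_star_alg (hgens n m))"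
    and "a \<approx> b"
  shows "fun_cls n m q a = fun_cls n m q b"
  using assms(3) cls_eq_iff[OF fun_ideal_ideal assms(1,2)] assms(1,2)
  by (simp add: eqv_def restr_id)

section \<open>Commutation up to a scalar\<close>

definition comm :: "complex \<Rightarrow> hgen free_star \<Rightarrow> hgen free_star \<Rightarrow> bool" where
  "comm s a b \<longleftrightarrow> a * b \<approx> scale s (b * a)"

lemma comm_mult_right:
  assumes "comm s a b" "comm r a c"
  shows "comm (s * r) a (b * c)"
proof -
  have "a * (b * c) = a * b * c" by (simp add: mult.assoc)
  also have "\<dots> \<approx> scale s (b * a) * c" using assms(1) unfolding comm_def by (rule eqv_mult_right)
  also have "\<dots> = scale s (b * (a * c))" by (simp add: scale_pull mult.assoc)
  also have "\<dots> \<approx> scale s (b * scale r (c * a))"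
    using assms(2) unfolding comm_def by (intro eqv_scale eqv_mult_left)
  also have "\<dots> = scale (s * r) (b * c * a)" by (simp add: scale_pull mult.assoc)
  finally show ?thesis unfolding comm_def .
qed

lemma comm_mult_left:
  assumes "comm s a c" "comm r b c"
  shows "comm (s * r) (a * b) c"
proof -
  have "a * b * c = a * (b * c)" by (simp add: mult.assoc)
  also have "\<dots> \<approx> a * scale r (c * b)" using assms(2) unfolding comm_def by (rule eqv_mult_left)
  also have "\<dots> = scale r (a * c * b)" by (simp add: scale_pull mult.assoc)
  also have "\<dots> \<approx> scale r (scale s (c * a) * b)"
    using assms(1) unfolding comm_def by (intro eqv_scale eqv_mult_right)
  also have "\<dots> = scale (s * r) (c * (a * b))" by (simp add: scale_pull mult.assoc mult.commute)
  finally show ?thesis unfolding comm_def .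
qed

lemma comm_add_left: "comm s a c \<Longrightarrow> comm s b c \<Longrightarrow> comm s (a + b) c"
  unfolding comm_def by (simp add: distrib_left distrib_right scale_add eqv_add)

lemma comm_add_right: "comm s c a \<Longrightarrow> comm s c b \<Longrightarrow> comm s c (a + b)"
  unfolding comm_def by (simp add: distrib_left distrib_right scale_add eqv_add)

lemma comm_scale_left: "comm s a c \<Longrightarrow> comm s (scale r a) c"
  unfolding comm_def using eqv_scale[of "a * c" "scale s (c * a)" r]
  by (simp add: scale_pull mult.commute)

lemma comm_scale_right: "comm s c a \<Longrightarrow> comm s c (scale r a)"
  unfolding comm_def using eqv_scale[of "c * a" "scale s (a * c)" r]
  by (simp add: scale_pull mult.commute)

lemma comm_zero: "comm s 0 c" "comm s c 0"
  by (simp_all add: comm_def)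

lemma comm_sym:
  assumes "comm s a b" "s \<noteq> 0"
  shows "comm (inverse s) b a"
  using eqv_scale[of "a * b" "scale s (b * a)" "inverse s"] assms eqv_sym
  unfolding comm_def by simp

lemma comm_star: "comm s a b \<Longrightarrow> comm (cnj s) (star b) (star a)"
  unfolding comm_def using eqv_star[of "a * b" "scale s (b * a)"]
  by (simp add: star_mult star_scale)

text \<open>Membership in a linear span and vanishing do not depend on the scalar of a commutation,
  so it is forgotten here. That it is nonzero makes the relation symmetric.\<close>

definition qcomm :: "hgen free_star \<Rightarrow> hgen free_star \<Rightarrow> bool" where
  "qcomm a b \<longleftrightarrow> (\<exists>s. s \<noteq> 0 \<and> comm s a b)"

lemma qcommI: "comm s a b \<Longrightarrow> s \<noteq> 0 \<Longrightarrow> qcomm a b"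
  unfolding qcomm_def by blast

lemma qcomm_sym: "qcomm a b \<Longrightarrow> qcomm b a"
  unfolding qcomm_def using comm_sym nonzero_imp_inverse_nonzero by blast

lemma qcomm_mult_right: "qcomm a b \<Longrightarrow> qcomm a c \<Longrightarrow> qcomm a (b * c)"
  unfolding qcomm_def using comm_mult_right by (metis mult_eq_0_iff)

lemma qcomm_star: "qcomm a b \<Longrightarrow> qcomm (star a) (star b)"
  unfolding qcomm_def using comm_star comm_sym by (metis complex_cnj_zero_iff nonzero_imp_inverse_nonzero)

lemma comm_one: "comm 1 a 1" "comm 1 1 a"
  by (simp_all add: comm_def)

lemma qcomm_one [simp]: "qcomm a 1"
  by (rule qcommI[OF comm_one(1)]) simp

lemma qcomm_power: "qcomm a b \<Longrightarrow> qcomm a (b ^ k)"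
  by (induction k) (simp_all add: qcomm_mult_right)

lemma comm_power: "comm 1 a b \<Longrightarrow> comm 1 a (b ^ k)"
  by (induction k) (use comm_mult_right[of 1 a b 1] comm_one in simp_all)

lemma qcomm_prod_list: "(\<And>b. b \<in> set bs \<Longrightarrow> qcomm a b) \<Longrightarrow> qcomm a (prod_list bs)"
  by (induction bs) (simp_all add: qcomm_mult_right)

lemma comm_prod_list: "(\<And>b. b \<in> set bs \<Longrightarrow> comm 1 a b) \<Longrightarrow> comm 1 a (prod_list bs)"
  by (induction bs) (use comm_mult_right[of 1 a _ 1] comm_one in simp_all)

section \<open>The elements \<open>Qe j\<close>\<close>

text \<open>
  In the representation \<open>Qe j\<close> acts on a basis vector by \<open>q powi (2 * Ssum j i)\<close>. With the signs
  \<open>sg j\<close> both products of \<open>tgen j\<close> and \<open>tadj j\<close> are combinations of \<open>Qe j\<close> and \<open>Qe (Suc j)\<close>.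
\<close>

definition sg :: "nat \<Rightarrow> complex" where
  "sg j = (if j \<le> n then - 1 else 1)"

definition Qe :: "nat \<Rightarrow> hgen free_star" where
  "Qe j = (if j \<le> n then x_elem n m - (\<Sum>k=j..n. tgen k * tadj k)
           else (\<Sum>k=j..n+m. tgen k * tadj k))"

lemma sg_sg [simp]: "sg j * sg j = 1"
  by (simp add: sg_def)

lemma Qe_rec:
  assumes "1 \<le> j" "j \<le> n + m"
  shows "Qe j = scale (sg j) (tgen j * tadj j) + Qe (Suc j)"
proof -
  have minus: "scale (- 1) a = - a" for a :: "hgen free_star"
    by (rule poly_mapping_eqI) simp
  consider "j < n" | "j = n" | "n < j" by linarith
  then show ?thesis
  proof cases
    case 1
    then show ?thesis by (simp add: Qe_def sg_def minus sum.atLeast_Suc_atMost[of j n])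
  next
    case 2
    then show ?thesis by (simp add: Qe_def sg_def minus x_elem_def)
  next
    case 3
    then show ?thesis using assms by (simp add: Qe_def sg_def sum.atLeast_Suc_atMost[of j "n + m"])
  qed
qed

lemma Qe_last: "Qe (Suc (n + m)) = 0"
  by (simp add: Qe_def)

lemma star_Qe [simp]: "star (Qe j) = Qe j"
  by (simp add: Qe_def x_elem_def star_diff star_sum star_mult star_gen)

lemma t_tadj:
  assumes "1 \<le> j" "j \<le> n + m"
  shows "tgen j * tadj j = scale (sg j) (Qe j - Qe (Suc j))"
  by (simp add: Qe_rec[OF assms])

text \<open>Written with \<open>Qe\<close>, the two forms of the relation for
  \<open>tgen j * tadj j\<close> (low and high index) become one: the products in the two orders
  differ by \<open>sg j * (q powi (- 2) - 1)\<close> times \<open>Qe (Suc j)\<close>. The rest is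
  \<open>t_tadj\<close>.\<close>

lemma tadj_t:
  assumes "1 \<le> j" "j \<le> n + m"
  shows "tadj j * tgen j \<approx> scale (sg j) (Qe j - scale (q powi (- 2)) (Qe (Suc j)))"
proof -
  let ?r = "complex_of_real q powi (- 2) - 1"
  have "tgen j * tadj j \<approx> tadj j * tgen j + scale (sg j * ?r) (Qe (Suc j))"
  proof (cases "j \<le> n")
    case True
    have "tgen j * tadj j \<approx> tadj j * tgen j + scale ?r (\<Sum>k=j+1..n. tgen k * tadj k)
        - scale ?r (\<Sum>k=n+1..n+m. tgen k * tadj k)"
      by (rule eqv_rel, unfold fun_rels_def rels_tilde_def rels_hat_def, rule UnI1, rule UnI1, rule UnI2)
        (use True assms in \<open>auto intro!: exI[of _ j]\<close>)
    also have "\<dots> = tadj j * tgen j + scale (sg j * ?r) (Qe (Suc j))"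
    proof -
      have "Qe (Suc j) = (\<Sum>k=n+1..n+m. tgen k * tadj k) - (\<Sum>k=j+1..n. tgen k * tadj k)"
        using True by (cases "j = n") (simp_all add: Qe_def x_elem_def)
      then show ?thesis using True
        by (simp only: sg_def if_True, intro poly_mapping_eqI)
          (simp add: lookup_add lookup_minus algebra_simps)
    qed
    finally show ?thesis .
  next
    case False
    have "tgen j * tadj j \<approx> tadj j * tgen j + scale ?r (\<Sum>k=j+1..n+m. tgen k * tadj k)"
      by (rule eqv_rel, unfold fun_rels_def rels_tilde_def rels_hat_def, rule UnI1, rule UnI1, rule UnI1, rule UnI2)
        (use False assms in \<open>auto intro!: exI[of _ j]\<close>)
    with False show ?thesis by (simp add: Qe_def sg_def)
  qed
  from eqv_diff[OF eqv_sym[OF this] eqv_refl, of "scale (sg j * ?r) (Qe (Suc j))"]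
  have "tadj j * tgen j \<approx> tgen j * tadj j - scale (sg j * ?r) (Qe (Suc j))" by simp
  also have "\<dots> = scale (sg j) (Qe j - scale (q powi (- 2)) (Qe (Suc j)))"
    unfolding t_tadj[OF assms]
    by (rule poly_mapping_eqI) (simp add: lookup_minus algebra_simps)
  finally show ?thesis .
qed

lemma comm_t_t: "1 \<le> i \<Longrightarrow> i < j \<Longrightarrow> j \<le> n + m \<Longrightarrow> comm q (tgen i) (tgen j)"
  unfolding comm_def by (rule eqv_rel) (auto simp: fun_rels_def rels_tilde_def rels_hat_def)

lemma comm_t_tadj:
  "i \<in> {1..n+m} \<Longrightarrow> j \<in> {1..n+m} \<Longrightarrow> i \<noteq> j \<Longrightarrow> comm q (tgen i) (tadj j)"
  unfolding comm_def by (rule eqv_rel) (auto simp: fun_rels_def rels_tilde_def rels_hat_def)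

text \<open>Downward induction on \<open>j\<close> from \<open>Qe (Suc (n + m)) = 0\<close>, which
  commutes with everything up to any scalar. In the summand \<open>tgen j * tadj j\<close> both
  letters contribute \<open>inverse q\<close> if \<open>i < j\<close>, and \<open>q\<close> and
  \<open>inverse q\<close> cancel if \<open>j < i\<close>.\<close>

lemma comm_Qe_t:
  assumes "1 \<le> i" "i \<le> n + m" "1 \<le> j" "j \<le> Suc (n + m)"
  shows "comm (if i < j then q powi (- 2) else 1) (Qe j) (tgen i)"
  using assms(4,3)
proof (induction j rule: inc_induct)
  case base
  show ?case by (simp add: Qe_last comm_zero)
next
  case (step j)
  then have j: "1 \<le> j" "j \<le> n + m" by simp_all
  have c: "complex_of_real q \<noteq> 0" using q0 by simp
  note IH = step.IH[OF le_SucI[OF step.prems]]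
  have a: "comm (inverse q) (tadj j) (tgen i)" if "i \<noteq> j"
    using comm_sym[OF comm_t_tadj[of i j]] assms j that c by (simp add: of_real_inverse)
  consider "i < j" | "i = j" | "j < i" by linarith
  then show ?case
  proof cases
    case 1
    have "comm (inverse q) (tgen j) (tgen i)"
      using comm_sym[OF comm_t_t[OF assms(1) 1 j(2)]] c by (simp add: of_real_inverse)
    from comm_mult_left[OF this a] 1
    have "comm (q powi (- 2)) (tgen j * tadj j) (tgen i)"
      by (simp add: power_int_minus power2_eq_square)
    from comm_add_left[OF comm_scale_left[OF this] , of "Qe (Suc j)" "sg j"] IH 1
    show ?thesis by (simp add: Qe_rec[OF j])
  next
    case 2
    \<comment> \<open>For \<open>i = j\<close> the product \<open>tadj i * tgen i\<close> is
      rewritten by \<open>tadj_t\<close>; its \<open>Qe (Suc i)\<close> term cancels against the one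
      from the induction hypothesis, since \<open>sg i\<close> squares to 1.\<close>
    have "Qe i * tgen i = scale (sg i) (tgen i * (tadj i * tgen i)) + Qe (Suc i) * tgen i"
      using j 2 by (subst Qe_rec) (simp_all add: distrib_right scale_pull mult.assoc)
    also have "\<dots> \<approx> scale (sg i) (tgen i * scale (sg i) (Qe i - scale (q powi (- 2)) (Qe (Suc i))))
        + scale (q powi (- 2)) (tgen i * Qe (Suc i))"
      using IH 2 unfolding comm_def
      by (intro eqv_add eqv_scale eqv_mult_left tadj_t assms) simp
    also have "\<dots> = tgen i * Qe i"
      by (simp add: scale_pull right_diff_distrib scale_diff sg_def)
    finally show ?thesis using 2 by (simp add: comm_def)
  next
    case 3
    have "comm q (tgen j) (tgen i)" using comm_t_t[OF j(1) 3 assms(2)] .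
    from comm_mult_left[OF this a] 3 c
    have "comm 1 (tgen j * tadj j) (tgen i)" by simp
    from comm_add_left[OF comm_scale_left[OF this], of "Qe (Suc j)" "sg j"] IH 3
    show ?thesis by (simp add: Qe_rec[OF j])
  qed
qed

lemma comm_Qe_tadj:
  assumes "1 \<le> i" "i \<le> n + m" "1 \<le> j" "j \<le> Suc (n + m)"
  shows "comm (if i < j then q powi 2 else 1) (Qe j) (tadj i)"
proof -
  have "comm (if i < j then q powi (- 2) else 1) (tadj i) (Qe j)"
    using comm_star[OF comm_Qe_t[OF assms]] by (simp add: star_gen split: if_splits)
  from comm_sym[OF this] show ?thesis
    using q0 by (cases "i < j") (simp_all add: power_int_minus)
qed

lemma comm_Qe_Qe:
  assumes "1 \<le> j" "j \<le> Suc (n + m)" "1 \<le> k" "k \<le> Suc (n + m)"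
  shows "comm 1 (Qe j) (Qe k)"
  using assms(4,3)
proof (induction k rule: inc_induct)
  case base
  show ?case by (simp add: Qe_last comm_zero)
next
  case (step k)
  then have k: "1 \<le> k" "k \<le> n + m" by simp_all
  have "comm 1 (Qe j) (tgen k * tadj k)"
    using comm_mult_right[OF comm_Qe_t[OF k assms(1,2)] comm_Qe_tadj[OF k assms(1,2)]] q0
    by (simp add: power_int_minus split: if_splits)
  from comm_add_right[OF comm_scale_right[OF this] step.IH[OF le_SucI[OF k(1)]], of "sg k"]
  show ?case by (simp add: Qe_rec[OF k])
qed

section \<open>Relations between \<open>f0gen\<close> and the elements \<open>Qe j\<close>\<close>

lemma f0_rels:
  shows f0adj: "f0adj \<approx> f0gen"
    and f0_f0: "f0gen * f0gen \<approx> f0gen"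
    and tadj_f0: "1 \<le> j \<Longrightarrow> j \<le> n \<Longrightarrow> tadj j * f0gen \<approx> 0"
    and f0_t: "1 \<le> j \<Longrightarrow> j \<le> n \<Longrightarrow> f0gen * tgen j \<approx> 0"
    and comm_t_f0: "n < j \<Longrightarrow> j \<le> n + m \<Longrightarrow> comm 1 (tgen j) f0gen"
    and comm_tadj_f0: "n < j \<Longrightarrow> j \<le> n + m \<Longrightarrow> comm 1 (tadj j) f0gen"
    and x_f0: "x_elem n m * f0gen \<approx> f0gen"
  by (auto simp: comm_def fun_rels_def rels_f0_def intro!: eqv_rel)

text \<open>The induction starts at \<open>Qe (Suc n) = x_elem n m\<close>, which fixes
  \<open>f0gen\<close>; every further summand ends in a low adjoint letter and so kills
  \<open>f0gen\<close>.\<close>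

lemma Qe_f0:
  assumes "1 \<le> j" "j \<le> Suc n"
  shows "Qe j * f0gen \<approx> f0gen"
  using assms(2,1)
proof (induction j rule: inc_induct)
  case base
  have "Qe (Suc n) = x_elem n m" by (simp add: Qe_def x_elem_def)
  then show ?case using x_f0 by simp
next
  case (step j)
  then have j: "1 \<le> j" "j \<le> n" "j \<le> n + m" by simp_all
  have "Qe j * f0gen = scale (sg j) (tgen j * (tadj j * f0gen)) + Qe (Suc j) * f0gen"
    by (simp add: Qe_rec[OF j(1,3)] distrib_right scale_pull mult.assoc)
  also have "\<dots> \<approx> scale (sg j) (tgen j * 0) + f0gen"
    by (intro eqv_add eqv_scale eqv_mult_left tadj_f0 j step.IH) simp
  finally show ?case by simp
qed

text \<open>Up to index \<open>Suc n\<close> both products are congruent to \<open>f0gen\<close>,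
  the second by applying the star to \<open>Qe_f0\<close>. Above it \<open>Qe j\<close> is a sum of
  products of letters commuting with \<open>f0gen\<close>.\<close>

lemma comm_Qe_f0:
  assumes "1 \<le> j" "j \<le> Suc (n + m)"
  shows "comm 1 (Qe j) f0gen"
proof (cases "j \<le> Suc n")
  case True
  note * = Qe_f0[OF assms(1) True]
  have "f0gen * Qe j \<approx> f0adj * Qe j" by (intro eqv_mult_right eqv_sym[OF f0adj])
  also have "\<dots> \<approx> f0adj" using eqv_star[OF *] by (simp add: star_mult star_gen)
  also have "\<dots> \<approx> f0gen" by (rule f0adj)
  finally have "f0gen * Qe j \<approx> f0gen" .
  from eqv_trans[OF * eqv_sym[OF this]] show ?thesis by (simp add: comm_def)
next
  case False
  from assms(2) have "n < j \<longrightarrow> comm 1 (Qe j) f0gen"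
  proof (induction j rule: inc_induct)
    case base
    show ?case by (simp add: Qe_last comm_zero)
  next
    case (step k)
    show ?case
    proof
      assume k: "n < k"
      with step have "k \<le> n + m" by simp
      with k have "comm 1 (tgen k * tadj k) f0gen"
        using comm_mult_left[OF comm_t_f0 comm_tadj_f0] by simp
      from comm_add_left[OF comm_scale_left[OF this], of "Qe (Suc k)" "sg k"] step k
      show "comm 1 (Qe k) f0gen" by (simp add: Qe_rec)
    qed
  qed
  with False show ?thesis by simp
qed

lemma qcomm_letters:
  assumes "i \<in> {1..n+m}" "j \<in> {1..n+m}" "i \<noteq> j"
  shows "qcomm (tgen i) (tgen j)" "qcomm (tgen i) (tadj j)"
    "qcomm (tadj i) (tgen j)" "qcomm (tadj i) (tadj j)"
proof -
  have c: "complex_of_real q \<noteq> 0" using q0 by simp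
  have tt: "qcomm (tgen k) (tgen l)" if "k \<in> {1..n+m}" "l \<in> {1..n+m}" "k \<noteq> l" for k l
    using that comm_t_t[of k l] comm_t_t[of l k] qcommI[OF _ c] qcomm_sym
    by (cases k l rule: linorder_cases) auto
  show "qcomm (tgen i) (tgen j)" by (rule tt[OF assms])
  show "qcomm (tadj i) (tadj j)" using qcomm_star[OF tt[OF assms]] by (simp add: star_gen)
  show "qcomm (tgen i) (tadj j)" by (rule qcommI[OF comm_t_tadj[OF assms] c])
  show "qcomm (tadj i) (tgen j)"
    using comm_t_tadj[OF assms(2,1)] assms(3) by (intro qcomm_sym[OF qcommI[OF _ c]]) simp
qed

lemma qcomm_Qe:
  assumes "i \<in> {1..n+m}" "j \<in> {1..Suc (n+m)}"
  shows "qcomm (Qe j) (tgen i)" "qcomm (Qe j) (tadj i)"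
  using assms q0 qcommI[OF comm_Qe_t[of i j]] qcommI[OF comm_Qe_tadj[of i j]]
  by (auto split: if_splits)

section \<open>Spanning sets\<close>

definition spn :: "('k \<Rightarrow> hgen free_star) \<Rightarrow> 'k set \<Rightarrow> hgen free_star set" where
  "spn M K = {a. \<exists>v. Poly_Mapping.keys v \<subseteq> K \<and> a \<approx> lin M v}"

lemma spn_eqv: "a \<approx> b \<Longrightarrow> b \<in> spn M K \<Longrightarrow> a \<in> spn M K"
  unfolding spn_def using eqv_trans by blast

lemma spn_base: "k \<in> K \<Longrightarrow> M k \<in> spn M K"
  unfolding spn_def by (auto intro!: exI[of _ "Poly_Mapping.single k 1"])

lemma spn_zero: "0 \<in> spn M K"
  unfolding spn_def by (auto intro!: exI[of _ 0])

lemma spn_add: "a \<in> spn M K \<Longrightarrow> b \<in> spn M K \<Longrightarrow> a + b \<in> spn M K"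
proof -
  assume "a \<in> spn M K" "b \<in> spn M K"
  then obtain u v where "Poly_Mapping.keys u \<subseteq> K" "a \<approx> lin M u"
    "Poly_Mapping.keys v \<subseteq> K" "b \<approx> lin M v"
    unfolding spn_def by blast
  then show ?thesis
    unfolding spn_def using keys_add[of u v] eqv_add[of a "lin M u" b "lin M v"]
    by (auto simp: lin_add intro!: exI[of _ "u + v"])
qed

lemma spn_scale: "a \<in> spn M K \<Longrightarrow> scale c a \<in> spn M K"
proof -
  assume "a \<in> spn M K"
  then obtain u where "Poly_Mapping.keys u \<subseteq> K" "a \<approx> lin M u"
    unfolding spn_def by blast
  moreover have "Poly_Mapping.keys (scale c u) \<subseteq> Poly_Mapping.keys u" by (auto simp: in_keys_iff)
  ultimately show ?thesis
    unfolding spn_def using eqv_scale[of a "lin M u" c]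
    by (auto simp: lin_scale intro!: exI[of _ "scale c u"])
qed

lemma spn_uminus: "a \<in> spn M K \<Longrightarrow> - a \<in> spn M K"
proof -
  have "- a = scale (- 1) a" by (rule poly_mapping_eqI) simp
  then show "a \<in> spn M K \<Longrightarrow> - a \<in> spn M K" using spn_scale by metis
qed

lemma spn_diff: "a \<in> spn M K \<Longrightarrow> b \<in> spn M K \<Longrightarrow> a - b \<in> spn M K"
  using spn_add[OF _ spn_uminus, of a M K b] by simp

lemma spn_lin:
  assumes "Poly_Mapping.keys v \<subseteq> A" "\<And>k. k \<in> A \<Longrightarrow> f k \<in> spn M K"
  shows "lin f v \<in> spn M K"
  using assms(1)
  by (induction v rule: poly_mapping_induct_on) (auto simp: lin_add spn_add spn_scale spn_zero assms(2))

lemma mult_lin: "a * lin f v = lin (\<lambda>k. a * f k) v" "lin f v * a = lin (\<lambda>k. f k * a) v"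
  for a :: "hgen free_star"
  by (simp_all add: lin_def sum_distrib_left sum_distrib_right scale_pull)

lemma star_lin: "star (lin f v) = (\<Sum>k\<in>Poly_Mapping.keys v. scale (cnj (Poly_Mapping.lookup v k)) (star (f k)))"
  by (simp add: lin_def star_sum star_scale)

lemma spn_mult:
  assumes "b \<in> spn M K" "\<And>k. k \<in> K \<Longrightarrow> a * M k \<in> spn M' K'"
  shows "a * b \<in> spn M' K'"
proof -
  from assms(1) obtain v where v: "Poly_Mapping.keys v \<subseteq> K" "b \<approx> lin M v"
    unfolding spn_def by blast
  have "a * b \<approx> lin (\<lambda>k. a * M k) v" using eqv_mult_left[OF v(2)] by (simp add: mult_lin)
  moreover have "lin (\<lambda>k. a * M k) v \<in> spn M' K'" by (rule spn_lin[OF v(1) assms(2)])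
  ultimately show ?thesis by (rule spn_eqv)
qed

lemma spn_mult_right:
  assumes "b \<in> spn M K" "\<And>k. k \<in> K \<Longrightarrow> M k * a \<in> spn M' K'"
  shows "b * a \<in> spn M' K'"
proof -
  from assms(1) obtain v where v: "Poly_Mapping.keys v \<subseteq> K" "b \<approx> lin M v"
    unfolding spn_def by blast
  have "b * a \<approx> lin (\<lambda>k. M k * a) v" using eqv_mult_right[OF v(2)] by (simp add: mult_lin)
  moreover have "lin (\<lambda>k. M k * a) v \<in> spn M' K'" by (rule spn_lin[OF v(1) assms(2)])
  ultimately show ?thesis by (rule spn_eqv)
qed

text \<open>Products are kept nested to the right, so a swap is needed both inside a left context
  and at the front.\<close>

lemma qcomm_swap:
  assumes "qcomm x y"
  obtains s where "\<And>a b. a * (x * (y * b)) \<approx> scale s (a * (y * (x * b)))"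
    "\<And>b. x * (y * b) \<approx> scale s (y * (x * b))"
proof -
  from assms obtain s where s: "x * y \<approx> scale s (y * x)" unfolding qcomm_def comm_def by blast
  have *: "x * (y * b) \<approx> scale s (y * (x * b))" for b
    using eqv_mult_right[OF s, of b] by (simp add: scale_pull mult.assoc)
  have "a * (x * (y * b)) \<approx> scale s (a * (y * (x * b)))" for a b
    using eqv_mult_left[OF *, of a b] by (simp add: scale_pull)
  with * show thesis using that by blast
qed

lemma qcomm_spn:
  assumes "qcomm x y"
  shows "a * (y * (x * b)) \<in> spn M K \<Longrightarrow> a * (x * (y * b)) \<in> spn M K"
    and "y * (x * b) \<in> spn M K \<Longrightarrow> x * (y * b) \<in> spn M K"
  using qcomm_swap[OF assms] by (meson spn_eqv spn_scale)+

lemma qcomm_zero: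
  assumes "qcomm x y"
  shows "a * (y * (x * b)) \<approx> 0 \<Longrightarrow> a * (x * (y * b)) \<approx> 0"
    and "y * (x * b) \<approx> 0 \<Longrightarrow> x * (y * b) \<approx> 0"
  using qcomm_swap[OF assms] by (metis eqv_trans eqv_scale scale_simps(3))+


section \<open>Normal form of the left ideal generated by \<open>f0gen\<close>\<close>

text \<open>One signed exponent per index suffices, negative values counting adjoint letters: a
  product of \<open>tgen j\<close> and \<open>tadj j\<close> in either order reduces to
  \<open>Qe j\<close> and \<open>Qe (Suc j)\<close>.\<close>

definition pw :: "nat \<Rightarrow> int \<Rightarrow> hgen free_star" where
  "pw j k = (if 0 \<le> k then tgen j ^ nat k else tadj j ^ nat (- k))"

lemma pw_0 [simp]: "pw j 0 = 1"
  by (simp add: pw_def)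

lemma pw_up: "0 \<le> k \<Longrightarrow> tgen j * pw j k = pw j (k + 1)" "k \<le> 0 \<Longrightarrow> tadj j * pw j k = pw j (k - 1)"
proof -
  show "0 \<le> k \<Longrightarrow> tgen j * pw j k = pw j (k + 1)"
    by (simp add: pw_def nat_add_distrib)
  assume "k \<le> 0"
  then have "nat (1 - k) = Suc (nat (- k))" by simp
  with \<open>k \<le> 0\<close> show "tadj j * pw j k = pw j (k - 1)"
    by (cases "k = 0") (simp_all add: pw_def)
qed

lemma pw_right: "k < 0 \<Longrightarrow> pw j k = pw j (k + 1) * tadj j"
  using pw_up(2)[of "k + 1" j] by (cases "k = - 1") (simp_all add: pw_def power_commutes)

lemma qcomm_pw: "qcomm x (tgen j) \<Longrightarrow> qcomm x (tadj j) \<Longrightarrow> qcomm x (pw j k)"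
  by (simp add: pw_def qcomm_power)

definition PP :: "(nat \<Rightarrow> int) \<Rightarrow> nat list \<Rightarrow> hgen free_star" where
  "PP l xs = prod_list (map (\<lambda>j. pw j (l j)) xs)"

lemma PP_simps [simp]: "PP l [] = 1" "PP l (x # xs) = pw x (l x) * PP l xs"
  "PP l (xs @ ys) = PP l xs * PP l ys"
  by (simp_all add: PP_def)

lemma PP_cong: "(\<And>j. j \<in> set xs \<Longrightarrow> l j = l' j) \<Longrightarrow> PP l xs = PP l' xs"
  by (induction xs) auto

lemma qcomm_PP:
  "(\<And>i. i \<in> set xs \<Longrightarrow> qcomm x (tgen i) \<and> qcomm x (tadj i)) \<Longrightarrow> qcomm x (PP l xs)"
  by (induction xs) (auto intro: qcomm_mult_right qcomm_pw)

definition all_gens :: "nat list" where "all_gens = [1..<Suc (n + m)]"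

lemma set_all_gens [simp]: "set all_gens = {1..n+m}" and distinct_all_gens: "distinct all_gens"
  by (auto simp: all_gens_def)

text \<open>Isolates the slot of index \<open>j\<close>. The outer factors do not depend on its
  exponent \<open>k\<close>, so that exponent can be changed afterwards, and they contain no letter
  of index \<open>j\<close>, so \<open>tgen j\<close> and \<open>tadj j\<close> move past them up to
  a nonzero scalar.\<close>

lemma PP_split:
  assumes "j \<in> {1..n+m}"
  obtains P1 P2 where "\<And>k. PP (l(j := k)) all_gens = P1 * (pw j k * P2)"
    "\<And>x. (\<And>i. i \<in> {1..n+m} \<Longrightarrow> i \<noteq> j \<Longrightarrow> qcomm x (tgen i) \<and> qcomm x (tadj i)) \<Longrightarrow>
      qcomm x P1 \<and> qcomm x P2"
proof -
  have "j \<in> set all_gens" using assms by auto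
  then obtain us vs where W: "all_gens = us @ j # vs" by (meson split_list)
  have "distinct (us @ j # vs)" unfolding W[symmetric] by (rule distinct_all_gens)
  then have nin: "j \<notin> set us" "j \<notin> set vs" by auto
  have sub: "set us \<subseteq> {1..n+m} - {j}" "set vs \<subseteq> {1..n+m} - {j}"
  proof -
    have "set us \<union> set vs \<subseteq> set all_gens" unfolding W by auto
    also have "\<dots> = {1..n+m}" by simp
    finally show "set us \<subseteq> {1..n+m} - {j}" "set vs \<subseteq> {1..n+m} - {j}" using nin by auto
  qed
  show thesis
  proof
    show "PP (l(j := k)) all_gens = PP l us * (pw j k * PP l vs)" for k
    proof -
      have "PP (l(j := k)) us = PP l us" "PP (l(j := k)) vs = PP l vs"
        using nin by (auto intro!: PP_cong)
      then show ?thesis unfolding W by simp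
    qed
    show "qcomm x (PP l us) \<and> qcomm x (PP l vs)"
      if "\<And>i. i \<in> {1..n+m} \<Longrightarrow> i \<noteq> j \<Longrightarrow> qcomm x (tgen i) \<and> qcomm x (tadj i)" for x
      using that sub by (intro conjI qcomm_PP) blast+
  qed
qed

text \<open>The list starts at \<open>n+2\<close> because \<open>Qe j\<close> is absorbed by
  \<open>f0gen\<close> for all smaller indices.\<close>

definition Qm :: "(nat \<Rightarrow> nat) \<Rightarrow> hgen free_star" where
  "Qm c = prod_list (map (\<lambda>j. Qe j ^ c j) [n+2..<Suc (n + m)])"

lemma comm_Qe_Qm: "1 \<le> l \<Longrightarrow> l \<le> Suc (n + m) \<Longrightarrow> comm 1 (Qe l) (Qm c)"
  unfolding Qm_def by (rule comm_prod_list) (auto intro!: comm_power comm_Qe_Qe)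

lemma comm_f0_Qm: "comm 1 f0gen (Qm c)"
  unfolding Qm_def using comm_sym[OF comm_Qe_f0]
  by (intro comm_prod_list) (auto intro!: comm_power)

lemma qcomm_letter_Qm:
  assumes "j \<in> {1..n+m}"
  shows "qcomm (tadj j) (Qm c)"
  unfolding Qm_def using assms
  by (intro qcomm_prod_list) (auto intro!: qcomm_power qcomm_sym[OF qcomm_Qe(2)])

lemma Qe_Qm:
  assumes "n + 2 \<le> l" "l \<le> n + m"
  shows "Qe l * Qm c \<approx> Qm (c(l := Suc (c l)))"
proof -
  let ?F = "\<lambda>c xs. prod_list (map (\<lambda>j. Qe j ^ c j) xs)"
  have "l \<in> set [n+2..<Suc (n + m)]" using assms by auto
  then obtain us vs where W: "[n+2..<Suc (n + m)] = us @ l # vs" by (meson split_list)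
  have "distinct (us @ l # vs)" unfolding W[symmetric] by simp
  then have nin: "l \<notin> set us" "l \<notin> set vs" by auto
  have sub: "set us \<subseteq> {1..n+m}"
  proof -
    have "set us \<subseteq> set [n+2..<Suc (n + m)]" unfolding W by auto
    then show ?thesis by auto
  qed
  have "?F (c(l := Suc (c l))) us = ?F c us" "?F (c(l := Suc (c l))) vs = ?F c vs"
    using nin by (auto intro!: arg_cong[where f = prod_list])
  then have eq: "Qm (c(l := Suc (c l))) = ?F c us * Qe l * (Qe l ^ c l * ?F c vs)"
    unfolding Qm_def W by (simp add: mult.assoc)
  have "comm 1 (Qe l) (?F c us)"
    using sub assms by (intro comm_prod_list) (force intro!: comm_power comm_Qe_Qe)
  then have "Qe l * ?F c us * (Qe l ^ c l * ?F c vs) \<approx> Qm (c(l := Suc (c l)))"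
    unfolding eq comm_def by (intro eqv_mult_right) simp
  then show ?thesis by (simp only: Qm_def W map_append list.map prod_list.append prod_list.Cons mult.assoc)
qed

text \<open>Low exponents are nonnegative since low adjoint letters kill \<open>f0gen\<close>. Zero
  values outside the index ranges let two keys be compared as functions.\<close>

definition lkeys :: "((nat \<Rightarrow> int) \<times> (nat \<Rightarrow> nat)) set" where
  "lkeys = {(l, c). (\<forall>j. j \<notin> {1..n+m} \<longrightarrow> l j = 0) \<and> (\<forall>j\<in>{1..n}. 0 \<le> l j) \<and>
    (\<forall>j. j \<notin> {n+2..n+m} \<longrightarrow> c j = 0)}"

fun LM :: "(nat \<Rightarrow> int) \<times> (nat \<Rightarrow> nat) \<Rightarrow> hgen free_star" where
  "LM (l, c) = PP l all_gens * (Qm c * f0gen)"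

abbreviation lspan :: "hgen free_star set" where "lspan \<equiv> spn LM lkeys"

text \<open>If a low exponent is negative, \<open>pw_right\<close> splits off the last adjoint
  letter of that power. It moves right to \<open>f0gen\<close> and kills it, so the product is
  congruent to zero.\<close>

lemma LM_in_lspan:
  assumes "\<And>j. j \<notin> {1..n+m} \<Longrightarrow> l j = 0" "\<And>j. j \<notin> {n+2..n+m} \<Longrightarrow> c j = 0"
  shows "PP l all_gens * (Qm c * f0gen) \<in> lspan"
proof (cases "\<forall>j\<in>{1..n}. 0 \<le> l j")
  case True
  then have "(l, c) \<in> lkeys" using assms by (auto simp: lkeys_def)
  from spn_base[OF this, of LM] show ?thesis by simp
next
  case False
  then obtain j where j: "j \<in> {1..n}" "l j < 0" by force
  then have jN: "j \<in> {1..n+m}" by auto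
  obtain P1 P2 where P: "\<And>k. PP (l(j := k)) all_gens = P1 * (pw j k * P2)"
    "\<And>x. (\<And>i. i \<in> {1..n+m} \<Longrightarrow> i \<noteq> j \<Longrightarrow> qcomm x (tgen i) \<and> qcomm x (tadj i)) \<Longrightarrow>
      qcomm x P1 \<and> qcomm x P2"
    using PP_split[OF jN, of l] by blast
  have P2: "qcomm (tadj j) P2" using P(2)[of "tadj j"] qcomm_letters[OF jN] by blast
  have "tadj j * (P2 * (Qm c * f0gen)) \<approx> 0"
  proof (intro qcomm_zero(2)[OF P2] qcomm_zero(1)[OF qcomm_letter_Qm[OF jN]])
    have "P2 * (Qm c * (tadj j * f0gen)) \<approx> P2 * (Qm c * 0)"
      using j by (intro eqv_mult_left tadj_f0) auto
    then show "P2 * (Qm c * (tadj j * f0gen)) \<approx> 0" by simp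
  qed
  from eqv_mult_left[OF this, of "P1 * pw j (l j + 1)"]
  have "PP (l(j := l j)) all_gens * (Qm c * f0gen) \<approx> 0"
    unfolding P(1) pw_right[OF j(2)] by (simp add: mult.assoc)
  then show ?thesis using spn_eqv[OF _ spn_zero] by simp
qed

text \<open>The factor \<open>Qe k\<close> is absorbed by \<open>f0gen\<close> for
  \<open>k \<le> Suc n\<close>, raises an exponent of \<open>Qm\<close> in the middle range, and is
  zero at \<open>Suc (n + m)\<close>.\<close>

lemma PP_Qe_in_lspan:
  assumes "\<And>j. j \<notin> {1..n+m} \<Longrightarrow> l j = 0" "\<And>j. j \<notin> {n+2..n+m} \<Longrightarrow> c j = 0"
    and k: "1 \<le> k" "k \<le> Suc (n + m)"
  shows "PP l all_gens * (Qe k * (Qm c * f0gen)) \<in> lspan"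
proof -
  consider "k \<le> Suc n" | "n + 2 \<le> k" "k \<le> n + m" | "k = Suc (n + m)" using k by linarith
  then show ?thesis
  proof cases
    case 1
    have "Qe k * (Qm c * f0gen) = Qe k * Qm c * f0gen" by (simp add: mult.assoc)
    also have "\<dots> \<approx> Qm c * Qe k * f0gen"
      using comm_Qe_Qm[OF k, of c] by (intro eqv_mult_right) (simp add: comm_def)
    also have "\<dots> = Qm c * (Qe k * f0gen)" by (simp add: mult.assoc)
    also have "\<dots> \<approx> Qm c * f0gen" by (intro eqv_mult_left Qe_f0 k 1)
    finally show ?thesis
      using LM_in_lspan[of l c] assms(1,2) by (blast intro: spn_eqv eqv_mult_left)
  next
    case 2
    have "Qe k * (Qm c * f0gen) \<approx> Qm (c(k := Suc (c k))) * f0gen"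
      using eqv_mult_right[OF Qe_Qm[OF 2], of c f0gen] by (simp add: mult.assoc)
    moreover have "PP l all_gens * (Qm (c(k := Suc (c k))) * f0gen) \<in> lspan"
      using assms 2 by (intro LM_in_lspan) auto
    ultimately show ?thesis by (blast intro: spn_eqv eqv_mult_left)
  qed (simp add: Qe_last spn_zero)
qed

text \<open>The letter moves past the left factor to the slot of its own index. There it either
  lengthens the power or meets the opposite letter, leaving a combination of \<open>Qe j\<close> and
  \<open>Qe (Suc j)\<close>.\<close>

lemma letter_LM:
  assumes k: "(l, c) \<in> lkeys" and j: "j \<in> {1..n+m}" and x: "x = tgen j \<or> x = tadj j"
  shows "x * LM (l, c) \<in> lspan"
proof -
  have l: "\<And>j. j \<notin> {1..n+m} \<Longrightarrow> l j = 0" and c: "\<And>j. j \<notin> {n+2..n+m} \<Longrightarrow> c j = 0"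
    using k by (auto simp: lkeys_def)
  have lj: "\<And>i k. i \<notin> {1..n+m} \<Longrightarrow> (l(j := k)) i = 0" using l j by auto
  obtain P1 P2 where P: "\<And>k. PP (l(j := k)) all_gens = P1 * (pw j k * P2)"
    "\<And>x. (\<And>i. i \<in> {1..n+m} \<Longrightarrow> i \<noteq> j \<Longrightarrow> qcomm x (tgen i) \<and> qcomm x (tadj i)) \<Longrightarrow>
      qcomm x P1 \<and> qcomm x P2"
    using PP_split[OF j, of l] by blast
  have "qcomm x P1" using P(2)[of x] qcomm_letters[OF j] x by blast
  moreover have "P1 * (x * (pw j (l j) * (P2 * (Qm c * f0gen)))) \<in> lspan"
  proof -
    have up: ?thesis if "x * pw j (l j) = pw j k" for k
    proof -
      have "P1 * (x * (pw j (l j) * (P2 * (Qm c * f0gen)))) =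
          P1 * ((x * pw j (l j)) * P2) * (Qm c * f0gen)" by (simp add: mult.assoc)
      also have "\<dots> = PP (l(j := k)) all_gens * (Qm c * f0gen)" unfolding that P(1) ..
      also have "\<dots> \<in> lspan" by (rule LM_in_lspan, rule lj, assumption, rule c)
      finally show ?thesis .
    qed
    \<comment> \<open>A \<open>Qe i\<close> arising at slot \<open>j\<close> moves right past the
      remaining power and \<open>P2\<close> to \<open>Qm\<close>, where
      \<open>PP_Qe_in_lspan\<close> applies.\<close>
    have Q: "P1 * (Qe i * (pw j k * (P2 * (Qm c * f0gen)))) \<in> lspan" if i: "i \<in> {1..Suc (n+m)}" for i k
    proof -
      have "qcomm (Qe i) (pw j k)" using qcomm_Qe[OF j i] by (rule qcomm_pw)
      moreover have "qcomm (Qe i) P2" using P(2)[of "Qe i"] qcomm_Qe[OF _ i] by blast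
      moreover have "PP (l(j := k)) all_gens * (Qe i * (Qm c * f0gen)) \<in> lspan"
        by (rule PP_Qe_in_lspan, rule lj, assumption, rule c, assumption) (use i in auto)
      then have "P1 * (pw j k * (P2 * (Qe i * (Qm c * f0gen)))) \<in> lspan"
        by (simp add: P(1) mult.assoc)
      ultimately show ?thesis
        using qcomm_spn(1)[of "Qe i" P2 "P1 * pw j k" "Qm c * f0gen" LM lkeys]
          qcomm_spn(1)[of "Qe i" "pw j k" P1 "P2 * (Qm c * f0gen)" LM lkeys]
        by (simp add: mult.assoc)
    qed
    \<comment> \<open>Here \<open>y\<close> is the letter opposite to \<open>x\<close> at the front
      of the power. The scalar \<open>r\<close> is 1 for \<open>tgen j * tadj j\<close> and
      \<open>q powi (- 2)\<close> for the other order.\<close>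
    have down: ?thesis
      if "pw j (l j) = y * pw j k" "x * y \<approx> scale s (Qe j - scale r (Qe (Suc j)))" for y k s r
    proof -
      have "P1 * (x * (pw j (l j) * (P2 * (Qm c * f0gen)))) =
          P1 * ((x * y) * (pw j k * (P2 * (Qm c * f0gen))))" by (simp add: that(1) mult.assoc)
      also have "\<dots> \<approx> P1 * (scale s (Qe j - scale r (Qe (Suc j))) * (pw j k * (P2 * (Qm c * f0gen))))"
        by (intro eqv_mult_left eqv_mult_right that(2))
      also have "\<dots> = scale s (P1 * (Qe j * (pw j k * (P2 * (Qm c * f0gen)))) -
          scale r (P1 * (Qe (Suc j) * (pw j k * (P2 * (Qm c * f0gen))))))"
        by (simp add: scale_pull left_diff_distrib right_diff_distrib)
      finally show ?thesis
        using j by (elim spn_eqv) (auto intro!: spn_scale spn_diff Q simp del: fun_upd_apply)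
    qed
    consider "x = tgen j" "0 \<le> l j" | "x = tadj j" "l j \<le> 0" | "x = tgen j" "l j < 0" | "x = tadj j" "0 < l j"
      using x by linarith
    then show ?thesis
    proof cases
      case 1
      then show ?thesis using pw_up(1) up by blast
    next
      case 2
      then show ?thesis using pw_up(2) up by blast
    next
      case 3
      have "pw j (l j) = tadj j * pw j (l j + 1)" using pw_up(2)[of "l j + 1" j] 3 by simp
      moreover have "x * tadj j \<approx> scale (sg j) (Qe j - scale 1 (Qe (Suc j)))"
        using t_tadj[of j] j 3 by simp
      ultimately show ?thesis by (rule down)
    next
      case 4
      have "pw j (l j) = tgen j * pw j (l j - 1)" using pw_up(1)[of "l j - 1" j] 4 by simp
      moreover have "x * tgen j \<approx> scale (sg j) (Qe j - scale (q powi (- 2)) (Qe (Suc j)))"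
        using tadj_t[of j] j 4 by simp
      ultimately show ?thesis by (rule down)
    qed
  qed
  ultimately have "x * (P1 * (pw j (l j) * (P2 * (Qm c * f0gen)))) \<in> lspan"
    by (rule qcomm_spn(2))
  moreover have "PP l all_gens = P1 * (pw j (l j) * P2)" using P(1)[of "l j"] by simp
  ultimately show ?thesis by (simp add: mult.assoc)
qed

lemma comm_f0_pw:
  assumes "j \<in> {n+1..n+m}"
  shows "comm 1 f0gen (pw j k)"
  using comm_sym[OF comm_t_f0[of j]] comm_sym[OF comm_tadj_f0[of j]] assms
  by (auto simp: pw_def intro!: comm_power)

lemma comm_f0_PP:
  assumes "set xs \<subseteq> {1..n+m}" "\<And>j. j \<in> set xs \<Longrightarrow> j \<le> n \<Longrightarrow> l j = 0"
  shows "comm 1 f0gen (PP l xs)"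
  unfolding PP_def
proof (rule comm_prod_list)
  fix b assume "b \<in> set (map (\<lambda>j. pw j (l j)) xs)"
  then obtain j where j: "j \<in> set xs" "b = pw j (l j)" by auto
  show "comm 1 f0gen b"
  proof (cases "j \<le> n")
    case True
    then show ?thesis using assms(2) j comm_one by simp
  next
    case False
    then show ?thesis unfolding j using assms(1) j by (intro comm_f0_pw) auto
  qed
qed

text \<open>With all low exponents zero, \<open>f0gen\<close> commutes through to the right and is
  absorbed by idempotence. Otherwise some low exponent is positive; a letter \<open>tgen j\<close>
  from that power moves left to \<open>f0gen\<close>, and their product vanishes.\<close>

lemma f0_LM:
  assumes k: "(l, c) \<in> lkeys"
  shows "f0gen * LM (l, c) \<in> lspan"
proof (cases "\<forall>j\<in>{1..n}. l j = 0")
  case True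
  have "comm 1 f0gen (PP l all_gens)" using True by (intro comm_f0_PP) auto
  from comm_mult_right[OF this comm_f0_Qm]
  have "f0gen * (PP l all_gens * Qm c) \<approx> PP l all_gens * Qm c * f0gen" by (simp add: comm_def)
  from eqv_mult_right[OF this, of f0gen]
  have "f0gen * LM (l, c) \<approx> PP l all_gens * Qm c * (f0gen * f0gen)" by (simp add: mult.assoc)
  also have "\<dots> \<approx> PP l all_gens * Qm c * f0gen" by (intro eqv_mult_left f0_f0)
  also have "\<dots> = LM (l, c)" by (simp add: mult.assoc)
  finally show ?thesis using spn_base[OF k] by (rule spn_eqv)
next
  case False
  then obtain j where j: "j \<in> {1..n}" "l j \<noteq> 0" by blast
  with k have "0 \<le> l j" by (auto simp: lkeys_def)
  with j have lj: "0 < l j" by simp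
  from j have jN: "j \<in> {1..n+m}" by auto
  obtain P1 P2 where P: "\<And>k. PP (l(j := k)) all_gens = P1 * (pw j k * P2)"
    "\<And>x. (\<And>i. i \<in> {1..n+m} \<Longrightarrow> i \<noteq> j \<Longrightarrow> qcomm x (tgen i) \<and> qcomm x (tadj i)) \<Longrightarrow>
      qcomm x P1 \<and> qcomm x P2"
    using PP_split[OF jN, of l] by blast
  have "qcomm (tgen j) P1" using P(2)[of "tgen j"] qcomm_letters[OF jN] by blast
  then have P1: "qcomm P1 (tgen j)" by (rule qcomm_sym)
  define R where "R = pw j (l j - 1) * (P2 * (Qm c * f0gen))"
  have "f0gen * (P1 * (tgen j * R)) \<approx> 0"
  proof (rule qcomm_zero(1)[OF P1])
    show "f0gen * (tgen j * (P1 * R)) \<approx> 0"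
      using eqv_mult_right[OF f0_t, of j "P1 * R"] j by (simp add: mult.assoc)
  qed
  moreover have "LM (l, c) = P1 * (tgen j * R)"
    using P(1)[of "l j"] pw_up(1)[of "l j - 1" j] lj by (simp add: R_def flip: mult.assoc)
  ultimately show ?thesis using spn_eqv[OF _ spn_zero] by simp
qed

lemma lspan_mult:
  assumes "b \<in> lspan"
  shows "a * b \<in> lspan"
proof -
  have letter: "Poly_Mapping.single (FWord [x]) 1 * b \<in> lspan" if b: "b \<in> lspan" for x b
  proof (rule spn_mult[OF b])
    fix k :: "(nat \<Rightarrow> int) \<times> (nat \<Rightarrow> nat)"
    assume k: "k \<in> lkeys"
    obtain l c where lc: "k = (l, c)" by fastforce
    consider j where "x = Gen (TG j) \<or> x = Adj (TG j)" | "x = Gen F0" | "x = Adj F0"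
      by (metis hgen.exhaust letter.exhaust)
    then show "Poly_Mapping.single (FWord [x]) 1 * LM k \<in> lspan"
    proof cases
      case (1 j)
      then have x: "Poly_Mapping.single (FWord [x]) 1 = tgen j \<or> Poly_Mapping.single (FWord [x]) 1 = tadj j"
        by (auto simp: gen_def adj_def)
      show ?thesis
      proof (cases "j \<in> {1..n+m}")
        case True
        then show ?thesis unfolding lc using letter_LM[OF k[unfolded lc] _ x] by blast
      next
        case False
        then have "Poly_Mapping.single (FWord [x]) 1 \<approx> 0" using x eqv_outside[of j] by metis
        from eqv_mult_right[OF this, of "LM k"] show ?thesis
          using spn_eqv[OF _ spn_zero] by simp
      qed
    next
      case 2
      then show ?thesis using f0_LM[OF k[unfolded lc]] unfolding lc by (simp add: gen_def)
    next
      case 3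
      have "f0adj * LM k \<approx> f0gen * LM k" by (intro eqv_mult_right f0adj)
      from spn_eqv[OF this[unfolded lc] f0_LM[OF k[unfolded lc]]] 3 show ?thesis
        unfolding lc by (simp add: adj_def)
    qed
  qed
  have word: "Poly_Mapping.single (FWord xs) 1 * b \<in> lspan" for xs
  proof (induction xs)
    case Nil
    have "Poly_Mapping.single (FWord []) 1 = (1 :: hgen free_star)"
      by (simp add: zero_fword_def flip: single_one)
    then show ?case using assms by simp
  next
    case (Cons x xs)
    have "Poly_Mapping.single (FWord (x # xs)) 1 * b =
        Poly_Mapping.single (FWord [x]) 1 * (Poly_Mapping.single (FWord xs) 1 * b)"
      by (simp add: mult_single plus_fword_def flip: mult.assoc)
    then show ?case using letter[OF Cons.IH] by simp
  qed
  have "Poly_Mapping.keys a \<subseteq> UNIV" by simp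
  then show ?thesis
  proof (induction a rule: poly_mapping_induct_on)
    case zero
    show ?case by (simp add: spn_zero)
  next
    case (single w c)
    have "Poly_Mapping.single w c * b = scale c (Poly_Mapping.single w 1 * b)"
      by (simp add: scale_mult)
    then show ?case using spn_scale[OF word[of "letters w"]] by simp
  next
    case (add u v)
    then show ?case by (simp add: distrib_right spn_add)
  qed
qed

lemma f0_in_lspan: "f0gen \<in> lspan"
proof -
  have "PP (\<lambda>_. 0) xs = 1" for xs by (induction xs) simp_all
  moreover have "Qm (\<lambda>_. 0) = 1" by (simp add: Qm_def map_replicate_const)
  ultimately show ?thesis using LM_in_lspan[of "\<lambda>_. 0" "\<lambda>_. 0"] by simp
qed

lemma mult_f0_in_lspan: "a * f0gen \<in> lspan"
  by (rule lspan_mult[OF f0_in_lspan])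


section \<open>Normal form of the two-sided ideal generated by \<open>f0gen\<close>\<close>

type_synonym key = "((nat \<Rightarrow> int) \<times> (nat \<Rightarrow> nat)) \<times> (nat \<Rightarrow> int)"

definition low_gens :: "nat list" where "low_gens = [1..<Suc n]"

lemma set_low_gens [simp]: "set low_gens = {1..n}"
  by (auto simp: low_gens_def)

text \<open>Right of \<open>f0gen\<close> only low letters are recorded: the high letters and the
  \<open>Qe\<close> factors commute with \<open>f0gen\<close> and can be taken up by the left
  factor.\<close>

fun MM :: "key \<Rightarrow> hgen free_star" where
  "MM (k, \<mu>) = LM k * star (PP \<mu> low_gens)"

definition mkeys :: "key set" where
  "mkeys = lkeys \<times> {\<mu>. (\<forall>j\<in>{1..n}. 0 \<le> \<mu> j) \<and> (\<forall>j. j \<notin> {1..n} \<longrightarrow> \<mu> j = 0)}"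

abbreviation mspan :: "hgen free_star set" where "mspan \<equiv> spn MM mkeys"

text \<open>Since \<open>f0gen\<close> is a selfadjoint idempotent, \<open>a * f0gen * b\<close> is
  congruent to \<open>a * f0gen * star (star b * f0gen)\<close>. The left normal form is applied to
  \<open>star b * f0gen\<close>, the starred high part is moved across \<open>f0gen\<close>, and the
  left normal form is applied once more to everything left of \<open>f0gen\<close>.\<close>

lemma mult_f0_mult_in_mspan: "a * f0gen * b \<in> mspan"
proof -
  have low: "a * f0gen * star (PP \<mu> low_gens) \<in> mspan" if "\<forall>j\<in>{1..n}. 0 \<le> \<mu> j" for \<mu> a
  proof (rule spn_mult_right[OF mult_f0_in_lspan])
    fix k :: "(nat \<Rightarrow> int) \<times> (nat \<Rightarrow> nat)"
    assume "k \<in> lkeys"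
    \<comment> \<open>Only the values on \<open>{1..n}\<close> enter the product;
      \<open>mkeys\<close> demands zeros elsewhere.\<close>
    define \<mu>' where "\<mu>' = (\<lambda>j. if j \<in> {1..n} then \<mu> j else 0)"
    have "PP \<mu> low_gens = PP \<mu>' low_gens" by (rule PP_cong) (auto simp: \<mu>'_def)
    moreover have "(k, \<mu>') \<in> mkeys" using \<open>k \<in> lkeys\<close> that by (auto simp: mkeys_def \<mu>'_def)
    ultimately show "LM k * star (PP \<mu> low_gens) \<in> mspan"
      using spn_base[of "(k, \<mu>')" mkeys MM] by simp
  qed
  have LM: "a * f0gen * star (LM k) \<in> mspan" if "k \<in> lkeys" for k
  proof -
    obtain l c where k: "k = (l, c)" by fastforce
    have split: "all_gens = low_gens @ [Suc n..<Suc (n + m)]"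
      unfolding all_gens_def low_gens_def using upt_add_eq_append[of 1 "Suc n" m] by simp
    let ?h = "PP l [Suc n..<Suc (n + m)]"
    have "comm 1 f0gen (?h * Qm c)"
      using comm_mult_right[OF comm_f0_PP comm_f0_Qm, of "[Suc n..<Suc (n + m)]" l c] by force
    then have "comm 1 (star (?h * Qm c)) f0adj"
      using comm_star[of 1 f0gen] by (simp add: star_gen)
    then have h: "f0adj * star (?h * Qm c) \<approx> star (?h * Qm c) * f0adj"
      using eqv_sym by (simp add: comm_def)
    have "a * f0gen * star (LM k) =
        a * f0gen * (f0adj * star (?h * Qm c)) * star (PP l low_gens)"
      unfolding k LM.simps split PP_simps star_mult star_gen mult.assoc ..
    also have "\<dots> \<approx> a * f0gen * (star (?h * Qm c) * f0adj) * star (PP l low_gens)"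
      by (intro eqv_mult_right eqv_mult_left h)
    also have "\<dots> \<approx> a * f0gen * (star (?h * Qm c) * f0gen) * star (PP l low_gens)"
      by (intro eqv_mult_right eqv_mult_left f0adj)
    also have "\<dots> = (a * f0gen * star (?h * Qm c)) * f0gen * star (PP l low_gens)"
      by (simp add: mult.assoc)
    finally show ?thesis
      using that by (elim spn_eqv) (intro low, auto simp: k lkeys_def)
  qed
  obtain v where v: "Poly_Mapping.keys v \<subseteq> lkeys" "star b * f0gen \<approx> lin LM v"
    using mult_f0_in_lspan[of "star b"] unfolding spn_def by blast
  have "a * f0gen * b \<approx> a * (f0gen * f0gen) * b"
    by (intro eqv_mult_right eqv_mult_left eqv_sym[OF f0_f0])
  also have "\<dots> \<approx> a * (f0gen * f0adj) * b"
    by (intro eqv_mult_right eqv_mult_left eqv_sym[OF f0adj])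
  also have "\<dots> = a * f0gen * star (star b * f0gen)"
    by (simp add: star_mult star_star star_gen mult.assoc)
  also have "\<dots> \<approx> a * f0gen * star (lin LM v)"
    by (intro eqv_mult_left eqv_star v(2))
  also have "\<dots> = (\<Sum>k\<in>Poly_Mapping.keys v.
      scale (cnj (Poly_Mapping.lookup v k)) (a * f0gen * star (LM k)))"
    by (simp add: star_lin sum_distrib_left scale_pull)
  finally show ?thesis
  proof (rule spn_eqv)
    have "finite K \<Longrightarrow> K \<subseteq> lkeys \<Longrightarrow>
      (\<Sum>k\<in>K. scale (cnj (Poly_Mapping.lookup v k)) (a * f0gen * star (LM k))) \<in> mspan" for K
      by (induction K rule: finite_induct) (auto intro!: spn_zero spn_add spn_scale LM)
    from this[OF finite_keys v(1)] show "(\<Sum>k\<in>Poly_Mapping.keys v.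
      scale (cnj (Poly_Mapping.lookup v k)) (a * f0gen * star (LM k))) \<in> mspan" .
  qed
qed

lemma MM_sandwich: "\<exists>a b. MM k = a * f0gen * b"
proof -
  obtain l c \<mu> where "k = ((l, c), \<mu>)" by (metis surj_pair)
  then have "MM k = (PP l all_gens * Qm c) * f0gen * star (PP \<mu> low_gens)"
    by (simp add: mult.assoc)
  then show ?thesis by blast
qed

lemma mspan_mult:
  assumes "b \<in> mspan"
  shows "a * b \<in> mspan" "b * a \<in> mspan"
proof -
  have "a * MM k \<in> mspan" "MM k * a \<in> mspan" for k
    using MM_sandwich[of k] mult_f0_mult_in_mspan by (metis mult.assoc)+
  then show "a * b \<in> mspan" "b * a \<in> mspan"
    using spn_mult[OF assms] spn_mult_right[OF assms] by blast+
qed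

section \<open>Elements of the two-sided ideal generated by \<open>f0gen\<close>\<close>

text \<open>\<open>cls_eq_iff\<close> compares classes of carrier elements only, so the passage from
  \<open>eqv\<close> back to classes needs this condition.\<close>

abbreviation carr :: "hgen free_star \<Rightarrow> bool" where
  "carr a \<equiv> Poly_Mapping.keys a \<subseteq> words_over (hgens n m)"

lemma carr_one: "carr 1"
  by (simp flip: single_one)

lemma carr_prod_list: "(\<And>b. b \<in> set bs \<Longrightarrow> carr b) \<Longrightarrow> carr (prod_list bs)"
  by (induction bs) (simp_all add: carr_one free_star_alg_closed)

lemma carr_power: "carr a \<Longrightarrow> carr (a ^ k)"
  by (induction k) (simp_all add: carr_one free_star_alg_closed)

lemma carr_letters: "j \<in> {1..n+m} \<Longrightarrow> carr (tgen j)" "j \<in> {1..n+m} \<Longrightarrow> carr (tadj j)" "carr f0gen"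
  by (auto simp: hgens_def gen_def adj_def)

lemma carr_pw: "j \<in> {1..n+m} \<Longrightarrow> carr (pw j k)"
  unfolding pw_def using carr_power carr_letters(1,2) by presburger

lemma carr_PP: "set xs \<subseteq> {1..n+m} \<Longrightarrow> carr (PP l xs)"
  unfolding PP_def by (rule carr_prod_list) (use carr_pw in force)

lemma carr_Qe:
  assumes "1 \<le> j"
  shows "carr (Qe j)"
proof -
  have "carr (\<Sum>k=a..b. tgen k * tadj k)" if "1 \<le> a" "b \<le> n + m" for a b
    using that by (intro sum_carrier free_star_alg_closed(3) carr_letters) auto
  then show ?thesis using assms by (simp add: Qe_def x_elem_def free_star_alg_closed)
qed

lemma carr_Qm: "carr (Qm c)"
  unfolding Qm_def by (rule carr_prod_list) (auto intro!: carr_power carr_Qe)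

lemma carr_MM: "carr (MM k)"
proof -
  obtain l c \<mu> where "k = ((l, c), \<mu>)" by (metis surj_pair)
  then show ?thesis
    by (simp add: free_star_alg_closed(3) carr_PP carr_Qm carr_letters(3) star_carrier)
qed

lemma carr_lin_MM: "carr (lin MM v)"
  by (rule keys_lin[of _ UNIV]) (use carr_MM in auto)

lemma Fun_H_simps:
  "mult (Fun_H n m q) = mult (Fun_tilde n m q)" "add (Fun_H n m q) = add (Fun_tilde n m q)"
  "zero (Fun_H n m q) = zero (Fun_tilde n m q)"
  by (simp_all add: Fun_H_def)

lemma cls_add: "carr a \<Longrightarrow> carr b \<Longrightarrow>
    fun_cls n m q a \<oplus>\<^bsub>Fun_tilde n m q\<^esub> fun_cls n m q b = fun_cls n m q (a + b)"
  and cls_mult: "carr a \<Longrightarrow> carr b \<Longrightarrow>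
    fun_cls n m q a \<otimes>\<^bsub>Fun_tilde n m q\<^esub> fun_cls n m q b = fun_cls n m q (a * b)"
  using ring_hom_add[OF fun_cls_hom, of a n m b q] ring_hom_mult[OF fun_cls_hom, of a n m b q] by simp_all

lemma cls_zero: "\<zero>\<^bsub>Fun_tilde n m q\<^esub> = fun_cls n m q 0"
proof -
  interpret h: ring_hom_ring "free_star_alg (hgens n m)" "Fun_tilde n m q" "fun_cls n m q"
    by (rule ring_hom_ringI2[OF ring_free_star_alg ring_Fun_tilde fun_cls_hom])
  show ?thesis using h.hom_zero by simp
qed

lemma Fun_H_repr:
  assumes "f \<in> carrier (Fun_H n m q)"
  obtains a where "carr a" "f = fun_cls n m q a"
  using assms unfolding Fun_H_def by (auto simp: carrier_Fun_tilde)

text \<open>The elements of \<open>Fun_H\<close> with a representative in \<open>mspan\<close> form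
  an ideal containing the class of \<open>f0gen\<close>, hence contain \<open>D_H\<close>. Only the
  whole combination is known to be invariant, not its single terms.\<close>

lemma D_H_repr:
  assumes "f \<in> D_H n m q"
  obtains v where "Poly_Mapping.keys v \<subseteq> mkeys" "f = fun_cls n m q (lin MM v)"
proof -
  let ?R = "Fun_H n m q"
  interpret R: ring ?R by (rule ring_Fun_H)
  define I where "I = {f \<in> carrier ?R. \<exists>a. carr a \<and> a \<in> mspan \<and> f = fun_cls n m q a}"
  have "ideal I ?R"
  proof (rule idealI)
    show "ring ?R" by (rule ring_Fun_H)
    show "subgroup I (add_monoid ?R)"
    proof (rule R.add.subgroupI)
      have "\<zero>\<^bsub>?R\<^esub> \<in> I"
        unfolding I_def using R.zero_closed spn_zero by (auto simp: Fun_H_simps cls_zero intro!: exI[of _ 0])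
      then show "I \<noteq> {}" by blast
      fix f assume "f \<in> I"
      then obtain a where a: "f \<in> carrier ?R" "carr a" "a \<in> mspan" "f = fun_cls n m q a"
        unfolding I_def by blast
      show "\<ominus>\<^bsub>?R\<^esub> f \<in> I"
      proof -
        \<comment> \<open>The additive inverse in \<open>Fun_H\<close> is given abstractly; from
          some representative \<open>b\<close> of it, \<open>b + a\<close> being congruent to zero
          yields that \<open>b\<close> is congruent to \<open>- a\<close>.\<close>
        obtain b where b: "carr b" "\<ominus>\<^bsub>?R\<^esub> f = fun_cls n m q b"
          using Fun_H_repr[OF R.a_inv_closed[OF a(1)]] by blast
        have "fun_cls n m q (b + a) = fun_cls n m q 0"
          using R.l_neg[OF a(1)] b a by (simp add: Fun_H_simps cls_zero cls_add)
        then have "b + a - 0 \<in> fun_ideal n m q"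
          using cls_eq_iff[OF fun_ideal_ideal, of "b + a" n m 0 q] a(2) b(1) free_star_alg_closed(1)[OF b(1) a(2)]
          by simp
        then have "b + a \<approx> 0" using free_star_alg_closed(1)[OF b(1) a(2)]
          by (simp add: eqv_def restr_id del: restr_linear)
        from eqv_diff[OF this eqv_refl[of a]] have "b \<approx> - a" by simp
        from spn_eqv[OF this spn_uminus[OF a(3)]] show ?thesis
          unfolding I_def using b R.a_inv_closed[OF a(1)] by blast
      qed
      fix g assume "g \<in> I"
      then obtain b where b: "g \<in> carrier ?R" "carr b" "b \<in> mspan" "g = fun_cls n m q b"
        unfolding I_def by blast
      have "f \<oplus>\<^bsub>?R\<^esub> g = fun_cls n m q (a + b)" using a b by (simp add: Fun_H_simps cls_add)
      then show "f \<oplus>\<^bsub>?R\<^esub> g \<in> I"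
        unfolding I_def using R.add.m_closed[OF a(1) b(1)] spn_add[OF a(3) b(3)]
          free_star_alg_closed(1)[OF a(2) b(2)] by blast
    qed (auto simp: I_def)
  next
    fix f g assume "f \<in> I" and g: "g \<in> carrier ?R"
    then obtain a b where a: "f \<in> carrier ?R" "carr a" "a \<in> mspan" "f = fun_cls n m q a"
      and b: "carr b" "g = fun_cls n m q b"
      unfolding I_def using Fun_H_repr[OF g] by blast
    have "g \<otimes>\<^bsub>?R\<^esub> f = fun_cls n m q (b * a)" "f \<otimes>\<^bsub>?R\<^esub> g = fun_cls n m q (a * b)"
      using a b by (simp_all add: Fun_H_simps cls_mult)
    then show "g \<otimes>\<^bsub>?R\<^esub> f \<in> I" "f \<otimes>\<^bsub>?R\<^esub> g \<in> I"
      unfolding I_def using R.m_closed[OF g a(1)] R.m_closed[OF a(1) g] mspan_mult[OF a(3), of b]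
        free_star_alg_closed(3)[OF a(2) b(1)] free_star_alg_closed(3)[OF b(1) a(2)] by blast+
  qed
  moreover have "{fun_cls n m q f0gen} \<subseteq> I"
  proof -
    have "f0gen \<in> mspan" using mult_f0_mult_in_mspan[of 1 1] by simp
    moreover have "fun_cls n m q f0gen \<in> carrier ?R"
      using carr_letters(3) by (simp add: Fun_H_def carrier_Fun_tilde rot_fun_cls)
    ultimately show ?thesis unfolding I_def using carr_letters(3) by blast
  qed
  ultimately have "D_H n m q \<subseteq> I" unfolding D_H_def by (rule R.genideal_minimal)
  with assms obtain a where a: "carr a" "a \<in> mspan" "f = fun_cls n m q a" unfolding I_def by blast
  then obtain v where v: "Poly_Mapping.keys v \<subseteq> mkeys" "a \<approx> lin MM v" unfolding spn_def by blast
  then have "f = fun_cls n m q (lin MM v)"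
    unfolding a(3) using a(1) carr_lin_MM by (intro eqv_cls) simp_all
  with v(1) show thesis by (rule that)
qed

section \<open>Weights under the rotations\<close>

definition homog :: "int \<Rightarrow> hgen free_star \<Rightarrow> bool" where
  "homog d a \<longleftrightarrow> (\<forall>\<phi>. rot_free \<phi> a = scale (cis (\<phi> * of_int d)) a)"

lemma homog_mult: "homog d a \<Longrightarrow> homog e b \<Longrightarrow> homog (d + e) (a * b)"
  by (simp add: homog_def scale_pull cis_mult distrib_left add.commute)

lemma homog_one: "homog 0 1"
  by (simp add: homog_def)

lemma homog_power: "homog d a \<Longrightarrow> homog (int k * d) (a ^ k)"
proof (induction k)
  case (Suc k)
  then show ?case using homog_mult[of d a "int k * d" "a ^ k"] by (simp add: distrib_right)
qed (simp add: homog_one)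

lemma homog_star: "homog d a \<Longrightarrow> homog (- d) (star a)"
  by (simp add: homog_def star_scale cis_cnj flip: star_rot_free)

lemma homog_letters: "homog 1 (tgen j)" "homog (- 1) (tadj j)" "homog 0 f0gen"
  by (simp_all add: homog_def cis_cnj)

lemma homog_pw: "homog k (pw j k)"
  using homog_power[OF homog_letters(1), of "nat k" j] homog_power[OF homog_letters(2), of "nat (- k)" j]
  by (cases "0 \<le> k") (simp_all add: pw_def)

lemma homog_PP: "homog (\<Sum>j\<leftarrow>xs. l j) (PP l xs)"
  by (induction xs) (auto intro: homog_one homog_mult homog_pw)

lemma homog_Qe: "homog 0 (Qe j)"
proof -
  have "homog 0 (\<Sum>k=a..b. tgen k * tadj k)" for a b
    using homog_mult[OF homog_letters(1,2)] by (simp add: homog_def)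
  then show ?thesis by (simp add: homog_def Qe_def x_elem_def)
qed

lemma homog_Qm: "homog 0 (Qm c)"
proof -
  have "homog 0 (prod_list (map (\<lambda>j. Qe j ^ c j) xs))" for xs
  proof (induction xs)
    case (Cons j xs)
    then show ?case using homog_mult[OF homog_power[OF homog_Qe]] by fastforce
  qed (simp add: homog_one)
  then show ?thesis by (simp add: Qm_def)
qed

fun deg :: "key \<Rightarrow> int" where
  "deg ((l, c), \<mu>) = (\<Sum>j\<leftarrow>all_gens. l j) - (\<Sum>j\<leftarrow>low_gens. \<mu> j)"

lemma homog_MM: "homog (deg k) (MM k)"
proof -
  obtain l c \<mu> where k: "k = ((l, c), \<mu>)" by (metis surj_pair)
  have "homog ((\<Sum>j\<leftarrow>all_gens. l j) + (0 + 0) + - (\<Sum>j\<leftarrow>low_gens. \<mu> j)) (MM k)"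
    unfolding k MM.simps LM.simps by (intro homog_mult homog_PP homog_Qm homog_letters homog_star)
  then show ?thesis by (simp add: k)
qed

lemma rot_free_lin_MM:
  "rot_free \<phi> (lin MM v) = lin (\<lambda>k. scale (cis (\<phi> * of_int (deg k))) (MM k)) v"
  using homog_MM by (simp add: lin_def homog_def)


section \<open>The action of the normal form\<close>

lemma act_single_vec: "act n m q a (Poly_Mapping.single i g) = scale g (act n m q a (ebas i))"
  using act_scale_vec[of n m q a g "ebas i"] by simp

lemma act_mult_single:
  "act n m q b (ebas i) = Poly_Mapping.single j x \<Longrightarrow> act n m q a (ebas j) = Poly_Mapping.single k y \<Longrightarrow>
    act n m q (a * b) (ebas i) = Poly_Mapping.single k (x * y)"
  using act_single_vec[of a j x] by (simp add: act_mult)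

text \<open>The index reached from \<open>i\<close> by \<open>PP l\<close>: the sign is negative
  because \<open>tgen j\<close> lowers the coordinate.\<close>

definition sft :: "(nat \<Rightarrow> int) \<Rightarrow> nat set \<Rightarrow> (nat \<Rightarrow> int) \<Rightarrow> nat \<Rightarrow> int" where
  "sft l S i = (\<lambda>j. if j \<in> S then i j - l j else i j)"

lemma powi_less_1: "0 < a \<Longrightarrow> q powi a < 1"
  using q0 q1 power_less_one_iff[of q "nat a"] by (simp add: power_int_def)

lemma powi_gt_1: "a < 0 \<Longrightarrow> 1 < q powi a"
  using powi_less_1[of "- a"] q0 one_less_inverse_iff[of "q powi (- a)"]
  by (simp add: power_int_minus)

text \<open>Between two admissible endpoints all intermediate indices are admissible, and on
  admissible indices the square root vanishes only at a step that leaves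
  \<open>idx n m\<close>.\<close>

lemma act_t_pow:
  assumes "1 \<le> j" "j < n + m"
  shows "\<exists>g. act n m q (tgen j ^ a) (ebas i) = Poly_Mapping.single (i(j := i j - int a)) g \<and>
    (i \<in> idx n m \<and> i(j := i j - int a) \<in> idx n m \<longrightarrow> g \<noteq> 0)"
proof (induction a)
  case 0
  show ?case by (auto intro!: exI[of _ 1])
next
  case (Suc a)
  let ?i = "i(j := i j - int a)" and ?i' = "i(j := i j - int (Suc a))"
  from Suc obtain g where g: "act n m q (tgen j ^ a) (ebas i) = Poly_Mapping.single ?i g"
    "i \<in> idx n m \<and> ?i \<in> idx n m \<longrightarrow> g \<noteq> 0" by blast
  define h where "h = q powi Ssum j ?i * (if j \<le> n then sqrt (q powi (2 * (?i j - 1)) - 1)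
      else sqrt (1 - q powi (2 * (?i j - 1))))"
  have "act n m q (tgen j ^ Suc a) (ebas i) = scale g (act n m q (tgen j) (ebas ?i))"
    unfolding power_Suc act_mult g(1) by (rule act_single_vec)
  also have "act n m q (tgen j) (ebas ?i) = Poly_Mapping.single ?i' (of_real h)"
    using assms by (simp add: h_def of_real_power_int algebra_simps)
  finally have "act n m q (tgen j ^ Suc a) (ebas i) = Poly_Mapping.single ?i' (g * of_real h)"
    by simp
  moreover have "g * of_real h \<noteq> 0" if "i \<in> idx n m" "?i' \<in> idx n m"
  proof -
    have i: "?i \<in> idx n m"
      using idx_bounds[OF that(1) assms] idx_bounds[OF that(2) assms] assms
      by (intro idx_upd[OF that(1)]) auto
    moreover have "h \<noteq> 0"
      using idx_bounds[OF i assms] idx_bounds[OF that(2) assms] q0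
        powi_gt_1[of "2 * (?i j - 1)"] powi_less_1[of "2 * (?i j - 1)"]
      by (cases "j \<le> n") (auto simp: h_def)
    ultimately show ?thesis using g(2) that(1) by simp
  qed
  ultimately show ?case by blast
qed

lemma act_tadj_pow:
  assumes "1 \<le> j" "j < n + m"
  shows "\<exists>g. act n m q (tadj j ^ a) (ebas i) = Poly_Mapping.single (i(j := i j + int a)) g \<and>
    (i \<in> idx n m \<and> i(j := i j + int a) \<in> idx n m \<longrightarrow> g \<noteq> 0)"
proof (induction a)
  case 0
  show ?case by (auto intro!: exI[of _ 1])
next
  case (Suc a)
  let ?i = "i(j := i j + int a)" and ?i' = "i(j := i j + int (Suc a))"
  from Suc obtain g where g: "act n m q (tadj j ^ a) (ebas i) = Poly_Mapping.single ?i g"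
    "i \<in> idx n m \<and> ?i \<in> idx n m \<longrightarrow> g \<noteq> 0" by blast
  define h where "h = q powi Ssum j ?i * (if j \<le> n then sqrt (q powi (2 * ?i j) - 1)
      else sqrt (1 - q powi (2 * ?i j)))"
  have "act n m q (tadj j ^ Suc a) (ebas i) = scale g (act n m q (tadj j) (ebas ?i))"
    unfolding power_Suc act_mult g(1) by (rule act_single_vec)
  also have "act n m q (tadj j) (ebas ?i) = Poly_Mapping.single ?i' (of_real h)"
    using assms by (simp add: h_def of_real_power_int algebra_simps)
  finally have "act n m q (tadj j ^ Suc a) (ebas i) = Poly_Mapping.single ?i' (g * of_real h)"
    by simp
  moreover have "g * of_real h \<noteq> 0" if "i \<in> idx n m" "?i' \<in> idx n m"
  proof -
    have i: "?i \<in> idx n m"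
      using idx_bounds[OF that(1) assms] idx_bounds[OF that(2) assms] assms
      by (intro idx_upd[OF that(1)]) auto
    moreover have "h \<noteq> 0"
      using idx_bounds[OF i assms] idx_bounds[OF that(2) assms] q0
        powi_gt_1[of "2 * ?i j"] powi_less_1[of "2 * ?i j"]
      by (cases "j \<le> n") (auto simp: h_def)
    ultimately show ?thesis using g(2) that(1) by simp
  qed
  ultimately show ?case by blast
qed

lemma act_pw:
  assumes "1 \<le> j" "j < n + m"
  shows "\<exists>g. act n m q (pw j k) (ebas i) = Poly_Mapping.single (i(j := i j - k)) g \<and>
    (i \<in> idx n m \<and> i(j := i j - k) \<in> idx n m \<longrightarrow> g \<noteq> 0)"
  using act_t_pow[OF assms, of "nat k" i] act_tadj_pow[OF assms, of "nat (- k)" i]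
  by (cases "0 \<le> k") (simp_all add: pw_def)

lemma act_PP:
  assumes "distinct xs" "set xs \<subseteq> {1..<n+m}"
  shows "\<exists>g. act n m q (PP l xs) (ebas i) = Poly_Mapping.single (sft l (set xs) i) g \<and>
    (i \<in> idx n m \<and> sft l (set xs) i \<in> idx n m \<longrightarrow> g \<noteq> 0)"
  using assms
proof (induction xs)
  case Nil
  show ?case by (auto simp: sft_def intro!: exI[of _ 1])
next
  case (Cons j xs)
  let ?i = "sft l (set xs) i" and ?i' = "sft l (set (j # xs)) i"
  from Cons obtain g where g: "act n m q (PP l xs) (ebas i) = Poly_Mapping.single ?i g"
    "i \<in> idx n m \<and> ?i \<in> idx n m \<longrightarrow> g \<noteq> 0" by auto
  have j: "1 \<le> j" "j < n + m" using Cons.prems by auto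
  have i': "?i(j := ?i j - l j) = ?i'" using Cons.prems by (auto simp: sft_def fun_eq_iff)
  from act_pw[OF j, of "l j" ?i] obtain h where
    h: "act n m q (pw j (l j)) (ebas ?i) = Poly_Mapping.single ?i' h"
    "?i \<in> idx n m \<and> ?i' \<in> idx n m \<longrightarrow> h \<noteq> 0" unfolding i' by blast
  have "act n m q (PP l (j # xs)) (ebas i) = Poly_Mapping.single ?i' (g * h)"
    unfolding PP_simps by (rule act_mult_single[OF g(1) h(1)])
  moreover have "g * h \<noteq> 0" if "i \<in> idx n m" "?i' \<in> idx n m"
  proof -
    \<comment> \<open>Every coordinate of \<open>?i\<close> is a coordinate of \<open>i\<close> or
      of \<open>?i'\<close>.\<close>
    have "?i \<in> idx n m"
      using that Cons.prems unfolding idx_iff sft_def by (auto split: if_splits)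
    with g(2) h(2) that show ?thesis by simp
  qed
  ultimately show ?case by (intro exI[of _ "g * h"] conjI impI) simp_all
qed

text \<open>The last letter and its adjoint act by the same scalar, so the action sees only the
  absolute value of the exponent; its sign will be recovered from the rotations.\<close>

lemma act_pw_last:
  "act n m q (pw (n + m) k) (ebas i) = Poly_Mapping.single i (of_real (q powi (\<bar>k\<bar> * Ssum (n + m) i)))"
proof -
  have nm: "\<not> n + m \<le> n" using m0 by simp
  have c: "(of_real q powi Ssum (n + m) i) ^ a = complex_of_real (q powi (int a * Ssum (n + m) i))" for a
    using power_int_mult[of q "Ssum (n + m) i" "int a"]
    by (simp add: mult.commute flip: of_real_power_int of_real_power)
  have "act n m q (tgen (n + m) ^ a) (ebas i) =
      Poly_Mapping.single i ((of_real q powi Ssum (n + m) i) ^ a)" for a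
  proof (induction a)
    case (Suc a)
    have "act n m q (tgen (n + m)) (ebas i) = Poly_Mapping.single i (of_real q powi Ssum (n + m) i)"
      using nm by simp
    from act_mult_single[OF Suc this] show ?case by (simp add: mult.commute)
  qed simp
  moreover have "act n m q (tadj (n + m) ^ a) (ebas i) =
      Poly_Mapping.single i ((of_real q powi Ssum (n + m) i) ^ a)" for a
  proof (induction a)
    case (Suc a)
    have "act n m q (tadj (n + m)) (ebas i) = Poly_Mapping.single i (of_real q powi Ssum (n + m) i)"
      using nm by simp
    from act_mult_single[OF Suc this] show ?case by (simp add: mult.commute)
  qed simp
  ultimately show ?thesis by (simp add: pw_def c)
qed

lemma powi_sq: "q powi a * q powi a = q powi (2 * a)"
  using q0 power_int_add[of q a a] by simp

lemma act_Qe: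
  assumes i: "i \<in> idx n m" and j: "n < j" "j \<le> n + m"
  shows "act n m q (Qe j) (ebas i) = Poly_Mapping.single i (of_real (q powi (2 * Ssum j i)))"
  using j(2,1)
proof (induction j rule: inc_induct)
  case base
  have "act n m q (Qe (n + m)) (ebas i) = act n m q (tgen (n + m) * tadj (n + m)) (ebas i)"
    using m0 Qe_rec[of "n + m"] by (simp add: Qe_last sg_def)
  also have "\<dots> = Poly_Mapping.single i (of_real (q powi (2 * Ssum (n + m) i)))"
    using m0 by (simp add: act_mult flip: powi_sq)
  finally show ?case .
next
  case (step j)
  let ?d = "q powi (2 * Ssum j i) * (1 - q powi (2 * i j))"
  have "act n m q (tgen j * tadj j) (ebas i) = Poly_Mapping.single i (of_real ?d)"
  proof -
    have "1 - q powi (2 * i j) \<ge> 0"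
      using idx_bounds(2)[OF i _ step(2)] step powi_less_1[of "2 * i j"] by simp
    then have "sqrt (1 - q powi (2 * i j)) * sqrt (1 - q powi (2 * i j)) = 1 - q powi (2 * i j)"
      by simp
    then have "?d = (q powi Ssum j i * sqrt (1 - q powi (2 * i j))) * (q powi Ssum j i * sqrt (1 - q powi (2 * i j)))"
      unfolding powi_sq[symmetric] by (simp only: mult_ac)
    moreover have "act n m q (tgen j * tadj j) (ebas i) = Poly_Mapping.single i (of_real
      ((q powi Ssum j i * sqrt (1 - q powi (2 * i j))) * (q powi Ssum j i * sqrt (1 - q powi (2 * i j)))))"
      using step by (simp add: act_mult of_real_power_int)
    ultimately show ?thesis by (simp only:)
  qed
  moreover have "q powi (2 * Ssum (Suc j) i) = q powi (2 * Ssum j i) * q powi (2 * i j)"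
    using q0 step by (simp add: Ssum_def power_int_add[symmetric] distrib_left)
  ultimately show ?case
    using step Qe_rec[of j] by (simp add: act_add sg_def right_diff_distrib flip: single_add)
qed

definition Qexp :: "(nat \<Rightarrow> nat) \<Rightarrow> (nat \<Rightarrow> int) \<Rightarrow> int" where
  "Qexp c i = (\<Sum>j\<in>{n+2..n+m}. 2 * int (c j) * Ssum j i)"

lemma act_Qm:
  assumes i: "i \<in> idx n m"
  shows "act n m q (Qm c) (ebas i) = Poly_Mapping.single i (of_real (q powi Qexp c i))"
proof -
  have pow: "act n m q (Qe j ^ a) (ebas i) = Poly_Mapping.single i (of_real (q powi (2 * int a * Ssum j i)))"
    if "n < j" "j \<le> n + m" for j a
  proof (induction a)
    case (Suc a)
    have "q powi (2 * int (Suc a) * Ssum j i) = q powi (2 * int a * Ssum j i) * q powi (2 * Ssum j i)"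
      using q0 by (simp add: power_int_add[symmetric] algebra_simps)
    then show ?case using act_mult_single[OF Suc act_Qe[OF i that]] by simp
  qed simp
  have list: "act n m q (prod_list (map (\<lambda>j. Qe j ^ c j) xs)) (ebas i) =
      Poly_Mapping.single i (of_real (q powi (\<Sum>j\<leftarrow>xs. 2 * int (c j) * Ssum j i)))"
    if "set xs \<subseteq> {n<..n+m}" for xs
    using that
  proof (induction xs)
    case (Cons j xs)
    then have "act n m q (prod_list (map (\<lambda>j. Qe j ^ c j) xs)) (ebas i) =
        Poly_Mapping.single i (of_real (q powi (\<Sum>j\<leftarrow>xs. 2 * int (c j) * Ssum j i)))" by simp
    from act_mult_single[OF this pow[of j "c j"]] Cons.prems q0
    show ?case by (simp add: power_int_add mult.commute)
  qed simp
  have sum: "(\<Sum>j\<leftarrow>[n+2..<Suc (n + m)]. f j) = (\<Sum>j\<in>{n+2..n+m}. f j)" for f :: "nat \<Rightarrow> int"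
    by (simp add: sum_list_distinct_conv_sum_set atLeastLessThanSuc_atLeastAtMost del: upt_Suc)
  have "set [n+2..<Suc (n + m)] \<subseteq> {n<..n+m}" by auto
  from list[OF this] show ?thesis unfolding Qm_def Qexp_def sum .
qed

end

section \<open>Linear independence of the normal form\<close>

text \<open>Dedekind's argument: subtract \<open>\<chi> x h\<close> times the relation at
  \<open>g\<close> from the relation at \<open>f h g\<close>. The term of \<open>x\<close>
  disappears and the others acquire the factor \<open>\<chi> k h - \<chi> x h\<close>. The induction
  hypothesis and an \<open>h\<close> separating \<open>l\<close> from \<open>x\<close> give
  \<open>\<alpha> l = 0\<close>; nonvanishing of \<open>\<chi> x\<close> then settles
  \<open>x\<close> itself.\<close>

lemma characters_independent:
  fixes \<chi> :: "'k \<Rightarrow> 'g \<Rightarrow> complex"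
  assumes "finite K"
    and "\<And>g h. g \<in> S \<Longrightarrow> h \<in> S \<Longrightarrow> f g h \<in> S"
    and "\<And>k g h. k \<in> K \<Longrightarrow> g \<in> S \<Longrightarrow> h \<in> S \<Longrightarrow> \<chi> k (f g h) = \<chi> k g * \<chi> k h"
    and "\<And>k. k \<in> K \<Longrightarrow> \<exists>g\<in>S. \<chi> k g \<noteq> 0"
    and "\<And>k l. k \<in> K \<Longrightarrow> l \<in> K \<Longrightarrow> k \<noteq> l \<Longrightarrow> \<exists>g\<in>S. \<chi> k g \<noteq> \<chi> l g"
    and "\<And>g. g \<in> S \<Longrightarrow> (\<Sum>k\<in>K. \<alpha> k * \<chi> k g) = 0"
    and "k \<in> K"
  shows "\<alpha> k = 0"
  using assms(1,3-)
proof (induction K arbitrary: \<alpha> k rule: finite_induct)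
  case (insert x F)
  note mult = insert.prems(1) and sum0 = insert.prems(4)
  have F: "\<alpha> l = 0" if l: "l \<in> F" for l
  proof -
    obtain h where h: "h \<in> S" "\<chi> l h \<noteq> \<chi> x h"
      using insert.prems(3)[of l x] l insert.hyps by blast
    have "(\<Sum>k\<in>F. \<alpha> k * (\<chi> k h - \<chi> x h) * \<chi> k g) = 0" if g: "g \<in> S" for g
    proof -
      have "(\<Sum>k\<in>F. \<alpha> k * (\<chi> k h - \<chi> x h) * \<chi> k g) =
          (\<Sum>k\<in>F. \<alpha> k * \<chi> k (f h g)) - \<chi> x h * (\<Sum>k\<in>F. \<alpha> k * \<chi> k g)"
        unfolding sum_distrib_left sum_subtractf[symmetric]
        by (rule sum.cong) (simp_all add: mult h g algebra_simps)
      also have "(\<Sum>k\<in>F. \<alpha> k * \<chi> k (f h g)) = - \<alpha> x * (\<chi> x h * \<chi> x g)"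
        using sum0[OF assms(2)[OF h(1) g]] insert.hyps mult[of x h g] h g by (simp add: eq_neg_iff_add_eq_0 add.commute)
      also have "(\<Sum>k\<in>F. \<alpha> k * \<chi> k g) = - \<alpha> x * \<chi> x g"
        using sum0[OF g] insert.hyps by (simp add: eq_neg_iff_add_eq_0 add.commute)
      finally show ?thesis by simp
    qed
    then have "\<alpha> l * (\<chi> l h - \<chi> x h) = 0"
      by (rule insert.IH[OF _ _ _ _ l, rotated -1]) (use insert.prems in blast)+
    with h show ?thesis by simp
  qed
  show ?case
  proof (cases "k = x")
    case True
    obtain g where g: "g \<in> S" "\<chi> x g \<noteq> 0" using insert.prems(2) by blast
    have "\<alpha> x * \<chi> x g = 0" using sum0[OF g(1)] insert.hyps F by simp
    with g True show ?thesis by simp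
  qed (use F insert.prems in blast)
qed simp

section \<open>Matrix coefficients of the normal form\<close>

context hyperbolic
begin

text \<open>The basis index from which \<open>star (PP \<mu> low_gens)\<close> reaches
  \<open>vac i\<close>: its low coordinates are raised from \<open>- \<mu> j\<close> to 0.\<close>

definition src :: "(nat \<Rightarrow> int) \<Rightarrow> (nat \<Rightarrow> int) \<Rightarrow> nat \<Rightarrow> int" where
  "src \<mu> i = (\<lambda>j. if j \<in> {1..<n+m} then (if j \<le> n then - \<mu> j else i j) else undefined)"

abbreviation vac :: "(nat \<Rightarrow> int) \<Rightarrow> nat \<Rightarrow> int" where "vac \<equiv> src (\<lambda>_. 0)"

lemma src_idx:
  "(\<And>j. j \<in> {1..n} \<Longrightarrow> 0 \<le> \<mu> j) \<Longrightarrow> (\<And>j. j \<in> {n<..<n+m} \<Longrightarrow> 1 \<le> i j) \<Longrightarrow> src \<mu> i \<in> idx n m"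
  unfolding idx_iff src_def by auto

text \<open>The entries of the image are read off from the adjoint, so that \<open>act_PP\<close>
  applies. An index with zero low coordinates is sent by \<open>PP \<mu> low_gens\<close> to low
  coordinates \<open>- \<mu> j\<close> with the high ones unchanged; it meets
  \<open>src \<mu>0 i\<close> exactly when it is \<open>vac i\<close> and the exponents
  agree.\<close>

lemma act_f0_star:
  assumes \<mu>: "\<And>j. j \<in> {1..n} \<Longrightarrow> 0 \<le> \<mu> j" and \<mu>0: "\<And>j. j \<in> {1..n} \<Longrightarrow> 0 \<le> \<mu>0 j"
    and i: "\<And>j. j \<in> {n<..<n+m} \<Longrightarrow> 1 \<le> i j"
  shows "\<exists>g. act n m q (f0gen * star (PP \<mu> low_gens)) (ebas (src \<mu>0 i)) = Poly_Mapping.single (vac i) g \<and>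
    (g \<noteq> 0 \<longleftrightarrow> (\<forall>j\<in>{1..n}. \<mu> j = \<mu>0 j))"
proof -
  let ?P = "PP \<mu> low_gens"
  define v where "v = act n m q (f0gen * star ?P) (ebas (src \<mu>0 i))"
  have src: "src \<mu>0 i \<in> idx n m" using \<mu>0 i by (rule src_idx)
  have vac: "vac i \<in> idx n m" using i by (intro src_idx) auto
  have "carr (f0gen * star ?P)"
    by (intro free_star_alg_closed(3) carr_letters star_carrier carr_PP) auto
  then have keys: "Poly_Mapping.keys v \<subseteq> idx n m"
    using act_Hspace[OF m0, of "ebas (src \<mu>0 i)" n "f0gen * star ?P" q] src
    by (simp add: v_def Hspace_def del: act_gen)
  have entry: "cnj (Poly_Mapping.lookup v k) =
      hinner (act n m q (?P * f0adj) (ebas k)) (ebas (src \<mu>0 i))" for k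
    unfolding act_adjoint by (simp add: v_def star_mult star_star star_gen del: act_gen)
  have low: "distinct low_gens" "set low_gens \<subseteq> {1..<n+m}"
    using m0 by (auto simp: low_gens_def)
  have P: "\<exists>g. act n m q ?P (ebas k) = Poly_Mapping.single (sft \<mu> {1..n} k) g \<and>
      (k \<in> idx n m \<and> sft \<mu> {1..n} k \<in> idx n m \<longrightarrow> g \<noteq> 0)" for k
    using act_PP[OF low, of \<mu> k] by simp
  have other: "Poly_Mapping.lookup v k = 0"
    if k: "k \<in> idx n m" "k \<noteq> vac i \<or> \<not> (\<forall>j\<in>{1..n}. \<mu> j = \<mu>0 j)" for k
  proof (cases "\<forall>j\<in>{1..n}. k j = 0")
    case True
    have "sft \<mu> {1..n} k \<noteq> src \<mu>0 i"
    proof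
      assume eq: "sft \<mu> {1..n} k = src \<mu>0 i"
      have "k j = vac i j \<and> (j \<in> {1..n} \<longrightarrow> \<mu> j = \<mu>0 j)" for j
        using fun_cong[OF eq, of j] True m0 k(1) by (auto simp: sft_def src_def idx_iff split: if_splits)
      with k(2) show False by (auto simp: fun_eq_iff)
    qed
    moreover obtain g where "act n m q ?P (ebas k) = Poly_Mapping.single (sft \<mu> {1..n} k) g"
      using P by blast
    moreover have "act n m q f0adj (ebas k) = ebas k" using True by simp
    ultimately have "cnj (Poly_Mapping.lookup v k) = 0"
      unfolding entry act_mult by (simp add: lookup_single when_def)
    then show ?thesis by simp
  next
    case False
    then have "act n m q f0adj (ebas k) = 0" by auto
    then have "cnj (Poly_Mapping.lookup v k) = 0"
      unfolding entry act_mult by (simp only: act_zero_vec hinner_zero)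
    then show ?thesis by simp
  qed
  have v: "v = Poly_Mapping.single (vac i) (Poly_Mapping.lookup v (vac i))"
  proof (rule poly_mapping_eqI)
    fix k
    show "Poly_Mapping.lookup v k = Poly_Mapping.lookup (Poly_Mapping.single (vac i) (Poly_Mapping.lookup v (vac i))) k"
      using other[of k] keys by (cases "k \<in> idx n m") (auto simp: lookup_single when_def in_keys_iff)
  qed
  have "Poly_Mapping.lookup v (vac i) \<noteq> 0" if eq: "\<forall>j\<in>{1..n}. \<mu> j = \<mu>0 j"
  proof -
    have sft: "sft \<mu> {1..n} (vac i) = src \<mu>0 i"
      using eq m0 by (auto simp: sft_def src_def fun_eq_iff)
    obtain g where g: "act n m q ?P (ebas (vac i)) = Poly_Mapping.single (src \<mu>0 i) g" "g \<noteq> 0"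
      using P[of "vac i"] vac src unfolding sft by blast
    have "act n m q f0adj (ebas (vac i)) = ebas (vac i)" using m0 by (simp add: src_def)
    with g have "cnj (Poly_Mapping.lookup v (vac i)) = g"
      unfolding entry act_mult by simp
    with g(2) show ?thesis by auto
  qed
  with v other[OF vac] show ?thesis unfolding v_def by blast
qed

text \<open>The exponent of \<open>q\<close> in the eigenvalue of
  \<open>pw (n + m) (l (n + m)) * Qm c\<close> at \<open>ebas (vac i)\<close>.\<close>

definition Eexp :: "key \<Rightarrow> (nat \<Rightarrow> int) \<Rightarrow> int" where
  "Eexp k i = Qexp (snd (fst k)) (vac i) + \<bar>fst (fst k) (n + m)\<bar> * Ssum (n + m) (vac i)"

lemma all_gens_snoc: "all_gens = [1..<n+m] @ [n + m]"
  using m0 by (simp add: all_gens_def)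

text \<open>The path leads from \<open>src \<mu>0 i\<close> to \<open>vac i\<close>, through an
  eigenvalue, to the shifted index. Only keys with this source and target contribute, and the factor
  \<open>g\<close> from the two shifts is common to them.\<close>

lemma act_MM:
  assumes \<mu>0: "\<And>j. j \<in> {1..n} \<Longrightarrow> 0 \<le> \<mu>0 j" "\<And>j. j \<notin> {1..n} \<Longrightarrow> \<mu>0 j = 0"
    and l0: "\<And>j. j \<in> {1..n} \<Longrightarrow> 0 \<le> l0 j"
    and i: "\<And>j. j \<in> {n<..<n+m} \<Longrightarrow> 1 \<le> i j" "\<And>j. j \<in> {n<..<n+m} \<Longrightarrow> 1 \<le> i j - l0 j"
  obtains g where "g \<noteq> 0" "\<And>l c \<mu>. ((l, c), \<mu>) \<in> mkeys \<Longrightarrow>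
    Poly_Mapping.lookup (act n m q (MM ((l, c), \<mu>)) (ebas (src \<mu>0 i))) (sft l0 {1..<n+m} (vac i)) =
      (if \<mu> = \<mu>0 \<and> (\<forall>j\<in>{1..<n+m}. l j = l0 j) then g * of_real (q powi Eexp ((l, c), \<mu>) i) else 0)"
proof -
  have vac: "vac i \<in> idx n m" using i by (intro src_idx) auto
  obtain g1 where g1: "act n m q (f0gen * star (PP \<mu>0 low_gens)) (ebas (src \<mu>0 i)) = Poly_Mapping.single (vac i) g1"
    "g1 \<noteq> 0" using act_f0_star[of \<mu>0 \<mu>0 i] \<mu>0 i by auto
  have "sft l0 {1..<n+m} (vac i) \<in> idx n m"
    using l0 i m0 unfolding idx_iff sft_def src_def by auto
  then obtain g2 where g2: "act n m q (PP l0 [1..<n+m]) (ebas (vac i)) = Poly_Mapping.single (sft l0 {1..<n+m} (vac i)) g2"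
    "g2 \<noteq> 0" using act_PP[of "[1..<n+m]" l0 "vac i"] vac by auto
  show thesis
  proof (rule that)
    show "g1 * g2 \<noteq> 0" using g1 g2 by simp
    fix l c \<mu> assume k: "((l, c), \<mu>) \<in> mkeys"
    let ?M = "act n m q (MM ((l, c), \<mu>)) (ebas (src \<mu>0 i))"
    have M: "MM ((l, c), \<mu>) = PP l [1..<n+m] * (pw (n + m) (l (n + m)) * (Qm c * (f0gen * star (PP \<mu> low_gens))))"
      by (simp add: all_gens_snoc mult.assoc)
    obtain h where h: "act n m q (PP l [1..<n+m]) (ebas (vac i)) = Poly_Mapping.single (sft l {1..<n+m} (vac i)) h"
      using act_PP[of "[1..<n+m]" l "vac i"] by auto
    obtain g where g: "act n m q (f0gen * star (PP \<mu> low_gens)) (ebas (src \<mu>0 i)) = Poly_Mapping.single (vac i) g"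
      "g \<noteq> 0 \<longleftrightarrow> (\<forall>j\<in>{1..n}. \<mu> j = \<mu>0 j)"
      using act_f0_star[of \<mu> \<mu>0 i] \<mu>0 i k by (auto simp: mkeys_def)
    have act: "?M = Poly_Mapping.single (sft l {1..<n+m} (vac i))
        (g * of_real (q powi Qexp c (vac i)) * of_real (q powi (\<bar>l (n + m)\<bar> * Ssum (n + m) (vac i))) * h)"
      unfolding M by (rule act_mult_single[OF act_mult_single[OF act_mult_single[OF g(1) act_Qm[OF vac]] act_pw_last] h])
    have \<mu>eq: "\<mu> = \<mu>0" if "\<forall>j\<in>{1..n}. \<mu> j = \<mu>0 j"
    proof
      fix j show "\<mu> j = \<mu>0 j"
        using that k \<mu>0(2)[of j] by (cases "j \<in> {1..n}") (auto simp: mkeys_def)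
    qed
    show "Poly_Mapping.lookup ?M (sft l0 {1..<n+m} (vac i)) =
      (if \<mu> = \<mu>0 \<and> (\<forall>j\<in>{1..<n+m}. l j = l0 j) then g1 * g2 * of_real (q powi Eexp ((l, c), \<mu>) i) else 0)"
    proof (cases "\<mu> = \<mu>0 \<and> (\<forall>j\<in>{1..<n+m}. l j = l0 j)")
      case True
      have "PP l [1..<n+m] = PP l0 [1..<n+m]" using True by (intro PP_cong) auto
      moreover have sft: "sft l {1..<n+m} (vac i) = sft l0 {1..<n+m} (vac i)"
        using True by (auto simp: sft_def fun_eq_iff)
      ultimately have "h = g2" using h g2(1) by (metis lookup_single_eq)
      moreover have "g = g1" using g(1) g1(1) True by (metis lookup_single_eq)
      ultimately show ?thesis using True q0 unfolding act sft
        by (simp add: Eexp_def power_int_add mult_ac)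
    next
      case False
      have "sft l {1..<n+m} (vac i) = sft l0 {1..<n+m} (vac i) \<Longrightarrow> g = 0"
      proof -
        assume eq: "sft l {1..<n+m} (vac i) = sft l0 {1..<n+m} (vac i)"
        have "l j = l0 j" if "j \<in> {1..<n+m}" for j using fun_cong[OF eq, of j] that by (simp add: sft_def)
        with False \<mu>eq have "\<not> (\<forall>j\<in>{1..n}. \<mu> j = \<mu>0 j)" by blast
        with g(2) show "g = 0" by blast
      qed
      then show ?thesis unfolding act if_not_P[OF False] by (auto simp: lookup_single when_def)
    qed
  qed
qed

section \<open>Characters attached to the keys\<close>

lemma Ssum_vac_add: "j \<le> n + m \<Longrightarrow> Ssum j (vac (\<lambda>k. i k + i' k)) = Ssum j (vac i) + Ssum j (vac i')"
  unfolding Ssum_def sum.distrib[symmetric] by (rule sum.cong) (auto simp: src_def)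

lemma Eexp_add: "Eexp k (\<lambda>j. i j + i' j) = Eexp k i + Eexp k i'"
proof -
  have "Qexp c (vac (\<lambda>j. i j + i' j)) = Qexp c (vac i) + Qexp c (vac i')" for c
    unfolding Qexp_def sum.distrib[symmetric]
    by (rule sum.cong) (auto simp: Ssum_vac_add distrib_left)
  then show ?thesis by (simp add: Eexp_def Ssum_vac_add distrib_left)
qed

lemma Ssum_vac_unit:
  assumes "j \<le> n + m" "n < p" "p < n + m"
  shows "Ssum j (vac (\<lambda>k. if k = p then 1 else 0)) = (if p < j then 1 else 0)"
proof -
  have "Ssum j (vac (\<lambda>k. if k = p then 1 else 0)) = (\<Sum>k=1..<j. if k = p then 1 else 0)"
    unfolding Ssum_def using assms by (intro sum.cong) (auto simp: src_def)
  also have "\<dots> = (if p < j then 1 else 0)" using assms by (auto simp: sum.delta)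
  finally show ?thesis .
qed

text \<open>A unit at coordinate \<open>p\<close> contributes to exactly the sums
  \<open>Ssum j\<close> with \<open>j > p\<close>; the exponent thus reveals a tail sum of
  \<open>c\<close>, and successive tail sums determine \<open>c\<close>.\<close>

lemma Eexp_unit:
  assumes "n < p" "p < n + m"
  shows "Eexp ((l, c), \<mu>) (\<lambda>k. if k = p then 1 else 0) = 2 * int (\<Sum>j=Suc p..n+m. c j) + \<bar>l (n + m)\<bar>"
proof -
  have "Qexp c (vac (\<lambda>k. if k = p then 1 else 0)) = (\<Sum>j\<in>{n+2..n+m}. if p < j then 2 * int (c j) else 0)"
    unfolding Qexp_def using assms by (intro sum.cong) (auto simp: Ssum_vac_unit)
  also have "\<dots> = (\<Sum>j\<in>{j \<in> {n+2..n+m}. p < j}. 2 * int (c j))"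
    by (rule sum.inter_filter[symmetric]) simp
  also have "{j \<in> {n+2..n+m}. p < j} = {Suc p..n+m}" using assms by auto
  finally show ?thesis using assms by (simp add: Eexp_def Ssum_vac_unit sum_distrib_left)
qed

lemma powi_inj: "q powi a = q powi b \<Longrightarrow> a = b"
proof -
  assume "q powi a = q powi b"
  then have "q powi (a - b) = 1" using q0 by (simp add: power_int_diff)
  then show "a = b" using powi_less_1[of "a - b"] powi_gt_1[of "a - b"] by (cases a b rule: linorder_cases) auto
qed

lemma deg_diff:
  assumes "\<And>j. j \<in> {1..<n+m} \<Longrightarrow> l j = l' j"
  shows "deg ((l, c), \<mu>) - deg ((l', c'), \<mu>) = l (n + m) - l' (n + m)"
proof -
  have "map l [1..<n+m] = map l' [1..<n+m]" using assms by simp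
  then show ?thesis by (simp add: all_gens_snoc del: map_eq_conv)
qed

text \<open>Multiplicative in the pair: the phase is a character of the angle, and
  \<open>Eexp\<close> is additive in the multi-index.\<close>

definition chi :: "key \<Rightarrow> real \<times> (nat \<Rightarrow> int) \<Rightarrow> complex" where
  "chi k = (\<lambda>(\<phi>, i). cis (\<phi> * of_int (deg k)) * of_real (q powi Eexp k i))"

text \<open>If the characters agree, angle zero gives equal exponents of \<open>q\<close>, a
  suitable angle gives equal last exponents \<open>l (n + m)\<close>, and unit increments of the
  multi-index then give equal tail sums of \<open>c\<close> and \<open>c'\<close>.\<close>

lemma chi_distinct:
  assumes k: "((l, c), \<mu>) \<in> mkeys" "((l', c'), \<mu>) \<in> mkeys" "(l, c) \<noteq> (l', c')"
    and l: "\<And>j. j \<in> {1..<n+m} \<Longrightarrow> l j = l' j"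
    and S: "\<And>i. i \<in> S \<longleftrightarrow> (\<forall>j\<in>{n<..<n+m}. L j \<le> i j)"
  shows "\<exists>g\<in>UNIV \<times> S. chi ((l, c), \<mu>) g \<noteq> chi ((l', c'), \<mu>) g"
proof (rule ccontr)
  assume neg: "\<not> ?thesis"
  let ?k = "((l, c), \<mu>)" and ?k' = "((l', c'), \<mu>)"
  have eq: "cis (\<phi> * of_int (deg ?k)) * of_real (q powi Eexp ?k i) =
      cis (\<phi> * of_int (deg ?k')) * of_real (q powi Eexp ?k' i)" if "i \<in> S" for \<phi> i
    using neg that by (auto simp: chi_def)
  have E: "Eexp ?k i = Eexp ?k' i" if "i \<in> S" for i
    using eq[OF that, of 0] by (auto intro!: powi_inj simp del: of_real_power_int)
  have LS: "L \<in> S" using S by simp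
  have lN: "l (n + m) = l' (n + m)"
  proof (rule ccontr)
    let ?d = "deg ?k - deg ?k'"
    assume "l (n + m) \<noteq> l' (n + m)"
    then have d: "?d \<noteq> 0" using deg_diff[of l l' c \<mu> c', OF l] by simp
    \<comment> \<open>At the angle \<open>pi / of_int ?d\<close> the two phases differ by the factor
      \<open>cis pi\<close>, which is not 1.\<close>
    have "cis (pi / of_int ?d * of_int (deg ?k)) = cis (pi / of_int ?d * of_int (deg ?k'))"
      using eq[OF LS, of "pi / of_int ?d"] E[OF LS] q0 by simp
    then have "cis (pi / of_int ?d * of_int (deg ?k) - pi / of_int ?d * of_int (deg ?k')) = 1"
      by (simp flip: cis_divide)
    also have "pi / of_int ?d * of_int (deg ?k) - pi / of_int ?d * of_int (deg ?k') = pi / of_int ?d * of_int ?d"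
      by (simp only: of_int_diff right_diff_distrib)
    also have "\<dots> = pi" using d by simp
    finally show False by simp
  qed
  have "l = l'"
  proof
    fix j
    consider "j \<in> {1..<n+m}" | "j = n + m" | "j \<notin> {1..n+m}" by fastforce
    then show "l j = l' j" using l lN k by cases (auto simp: mkeys_def lkeys_def)
  qed
  have C: "(\<Sum>j=Suc p..n+m. c j) = (\<Sum>j=Suc p..n+m. c' j)" if p: "n < p" "p \<le> n + m" for p
  proof (cases "p = n + m")
    case False
    then have p': "p < n + m" using p by simp
    \<comment> \<open>The unit vector may lie outside \<open>S\<close>, so it is added to
      \<open>L\<close> and additivity of \<open>Eexp\<close> removes \<open>L\<close> again.\<close>
    have "(\<lambda>j. L j + (if j = p then 1 else 0)) \<in> S" using S by simp
    from E[OF this] E[OF LS] have "Eexp ?k (\<lambda>j. if j = p then 1 else 0) = Eexp ?k' (\<lambda>j. if j = p then 1 else 0)"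
      by (simp add: Eexp_add)
    then have "int (\<Sum>j=Suc p..n+m. c j) = int (\<Sum>j=Suc p..n+m. c' j)"
      unfolding Eexp_unit[OF p(1) p'] lN by simp
    then show ?thesis by (simp only: of_nat_eq_iff)
  qed simp
  have "c = c'"
  proof
    fix j
    show "c j = c' j"
    proof (cases "j \<in> {n+2..n+m}")
      case True
      then obtain p where p: "j = Suc p" "n < p" "p < n + m" by (cases j) auto
      then show ?thesis using C[of p] C[of j] by (simp add: sum.atLeast_Suc_atMost)
    next
      case False
      then show ?thesis using k by (simp add: mkeys_def lkeys_def)
    qed
  qed
  with \<open>l = l'\<close> k(3) show False by simp
qed

text \<open>For a fixed key, one matrix coefficient of the rotated combination is followed as angle
  and source vary. After division by the common factor from \<open>act_MM\<close> it is a vanishing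
  combination of the distinct characters of the keys in \<open>K\<close>.\<close>

lemma MM_independent:
  assumes v: "Poly_Mapping.keys v \<subseteq> mkeys"
    and zero: "\<And>\<phi> i. i \<in> idx n m \<Longrightarrow> act n m q (rot_free \<phi> (lin MM v)) (ebas i) = 0"
  shows "v = 0"
proof (rule poly_mapping_eqI)
  fix k0 :: key
  obtain l0 c0 \<mu>0 where k0: "k0 = ((l0, c0), \<mu>0)" by (metis surj_pair)
  have "Poly_Mapping.lookup v k0 = 0" if k0v: "k0 \<in> Poly_Mapping.keys v"
  proof -
    have k0m: "((l0, c0), \<mu>0) \<in> mkeys" using v k0v k0 by blast
    then have \<mu>0: "\<And>j. j \<in> {1..n} \<Longrightarrow> 0 \<le> \<mu>0 j" "\<And>j. j \<notin> {1..n} \<Longrightarrow> \<mu>0 j = 0"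
      and l0: "\<And>j. j \<in> {1..n} \<Longrightarrow> 0 \<le> l0 j" by (auto simp: mkeys_def lkeys_def)
    define K where "K = {k \<in> Poly_Mapping.keys v. snd k = \<mu>0 \<and> (\<forall>j\<in>{1..<n+m}. fst (fst k) j = l0 j)}"
    \<comment> \<open>The bound \<open>1 + l0 j\<close> keeps the target index admissible and the
      bound 1 the source; positivity also closes \<open>S\<close> under addition.\<close>
    define L where "L j = max 1 (1 + l0 j)" for j
    define S where "S = {i. \<forall>j\<in>{n<..<n+m}. L j \<le> i j}"
    let ?add = "\<lambda>(\<phi>::real, i) (\<psi>, i'). (\<phi> + \<psi>, \<lambda>j::nat. i j + i' j :: int)"
    show ?thesis
    proof (rule characters_independent[where K = K and S = "UNIV \<times> S" and \<chi> = chi and f = ?add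
          and \<alpha> = "Poly_Mapping.lookup v"])
      show "finite K" by (simp add: K_def)
      show "k0 \<in> K" using k0v k0 by (simp add: K_def)
      show "?add g h \<in> UNIV \<times> S" if "g \<in> UNIV \<times> S" "h \<in> UNIV \<times> S" for g h
      proof -
        have "L j \<le> a + b" if "L j \<le> a" "L j \<le> b" for a b j using that by (simp add: L_def)
        with that show ?thesis by (auto simp: S_def)
      qed
      show "chi k (?add g h) = chi k g * chi k h" for k g h
        using q0 by (cases g; cases h)
          (simp add: chi_def Eexp_add power_int_add distrib_right cis_mult[symmetric] mult_ac)
      show "\<exists>g\<in>UNIV \<times> S. chi k g \<noteq> 0" for k
        using q0 by (intro bexI[of _ "(0, L)"]) (simp_all add: chi_def S_def)
      show "\<exists>g\<in>UNIV \<times> S. chi k g \<noteq> chi k' g" if kk: "k \<in> K" "k' \<in> K" "k \<noteq> k'" for k k'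
      proof -
        have "snd k = \<mu>0" "snd k' = \<mu>0" using kk by (auto simp: K_def)
        then obtain l c l' c' where k: "k = ((l, c), \<mu>0)" "k' = ((l', c'), \<mu>0)"
          by (cases k; cases k') auto
        show ?thesis unfolding k
          by (rule chi_distinct[of _ _ _ _ _ S L]) (use kk v in \<open>auto simp: k K_def S_def\<close>)
      qed
      fix g :: "real \<times> (nat \<Rightarrow> int)"
      assume g: "g \<in> UNIV \<times> S"
      obtain \<phi> i where gi: "g = (\<phi>, i)" by fastforce
      with g have i: "\<And>j. j \<in> {n<..<n+m} \<Longrightarrow> 1 \<le> i j" "\<And>j. j \<in> {n<..<n+m} \<Longrightarrow> 1 \<le> i j - l0 j"
        by (force simp: S_def L_def)+
      from act_MM[of \<mu>0 l0 i, OF \<mu>0 l0 i] obtain d where d: "d \<noteq> 0" "\<And>l c \<mu>. ((l, c), \<mu>) \<in> mkeys \<Longrightarrow>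
        Poly_Mapping.lookup (act n m q (MM ((l, c), \<mu>)) (ebas (src \<mu>0 i))) (sft l0 {1..<n+m} (vac i)) =
        (if \<mu> = \<mu>0 \<and> (\<forall>j\<in>{1..<n+m}. l j = l0 j) then d * of_real (q powi Eexp ((l, c), \<mu>) i) else 0)"
        by blast
      let ?t = "sft l0 {1..<n+m} (vac i)"
      have "src \<mu>0 i \<in> idx n m" using \<mu>0(1) i(1) by (rule src_idx)
      from zero[OF this, of \<phi>] have "0 = Poly_Mapping.lookup (\<Sum>k\<in>Poly_Mapping.keys v.
          scale (Poly_Mapping.lookup v k) (scale (cis (\<phi> * of_int (deg k))) (act n m q (MM k) (ebas (src \<mu>0 i))))) ?t"
        by (simp only: rot_free_lin_MM) (simp only: lin_def act_sum act_scale lookup_zero)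
      also have "\<dots> = (\<Sum>k\<in>Poly_Mapping.keys v. if k \<in> K then d * (Poly_Mapping.lookup v k * chi k g) else 0)"
        unfolding lookup_sum
      proof (rule sum.cong)
        fix k assume k: "k \<in> Poly_Mapping.keys v"
        obtain l c \<mu> where lc: "k = ((l, c), \<mu>)" by (metis surj_pair)
        have "((l, c), \<mu>) \<in> mkeys" using k v lc by blast
        from d(2)[OF this] k show "Poly_Mapping.lookup (scale (Poly_Mapping.lookup v k) (scale (cis (\<phi> * of_int (deg k)))
            (act n m q (MM k) (ebas (src \<mu>0 i))))) ?t = (if k \<in> K then d * (Poly_Mapping.lookup v k * chi k g) else 0)"
          by (simp add: lc K_def gi chi_def del: MM.simps deg.simps)
      qed simp
      also have "\<dots> = d * (\<Sum>k\<in>K. Poly_Mapping.lookup v k * chi k g)"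
      proof -
        have "K \<subseteq> Poly_Mapping.keys v" by (auto simp: K_def)
        then show ?thesis
          by (simp add: sum_distrib_left Int_absorb1 flip: sum.inter_restrict)
      qed
      finally show "(\<Sum>k\<in>K. Poly_Mapping.lookup v k * chi k g) = 0" using d(1) by simp
    qed
  qed
  then show "Poly_Mapping.lookup v k0 = Poly_Mapping.lookup 0 k0"
    by (cases "k0 \<in> Poly_Mapping.keys v") (simp_all add: in_keys_iff)
qed

text \<open>An invariant class is also represented by every rotation of its normal form, so
  vanishing of the representation annihilates all these rotations at once, as
  \<open>MM_independent\<close> requires.\<close>

lemma rep_faithful:
  assumes f: "f \<in> D_H n m q" and zero: "\<forall>v\<in>Hspace n m. rep n m q f v = 0"
  shows "f = \<zero>\<^bsub>Fun_tilde n m q\<^esub>"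
proof -
  obtain v where v: "Poly_Mapping.keys v \<subseteq> mkeys" "f = fun_cls n m q (lin MM v)"
    using D_H_repr[OF f] by blast
  interpret D: ideal "D_H n m q" "Fun_H n m q" by (rule D_H_ideal)
  have inv: "rot \<phi> f = f" for \<phi> using D.a_Hcarr[OF f] by (simp add: Fun_H_def)
  have "v = 0"
  proof (rule MM_independent[OF v(1)])
    fix \<phi> i assume "i \<in> idx n m"
    then have i: "ebas i \<in> Hspace n m" by (simp add: Hspace_def)
    have "act n m q (rot_free \<phi> (lin MM v)) (ebas i) = rep n m q (rot \<phi> f) (ebas i)"
      unfolding v(2) rot_fun_cls by (rule rep_fun_cls[OF q0 q1 m0 i, symmetric])
    then show "act n m q (rot_free \<phi> (lin MM v)) (ebas i) = 0"
      using zero i by (simp add: inv)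
  qed
  then show ?thesis using v(2) by (simp add: cls_zero)
qed

end

theorem theorem4p2:
  fixes q :: real and n m :: nat
  assumes "0 < q" and "q < 1" and "n \<ge> 1" and "m \<ge> 2"
    and "f \<in> D_H n m q"
    and "\<forall>v\<in>Hspace n m. rep n m q f v = 0"
  shows "f = \<zero>\<^bsub>Fun_tilde n m q\<^esub>"
proof -
  interpret hyperbolic n m q using assms by unfold_locales auto
  show ?thesis using assms(5,6) by (rule rep_faithful)
qed

end
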